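(* Let $X$ be a complex space, $X^o\subset X_{\rm reg}$ a Zariski open subset and $(E,h)$ a holomorphic vector bundle on $X^o$ with a possibly singular hermitian metric. Let $\pi:X'\to X$ be a proper holomorphic map between complex spaces which is biholomorphic over $X^o$. Then $$\pi_\ast S_{X'}(\pi^\ast E,\pi^\ast h)=S_X(E,h).$$
   Context: Conventions: all complex spaces are separated, irreducible, reduced, paracompact and countable at infinity. A Zariski open subset is the complement of a closed analytic subset. A (possibly singular) hermitian metric is $h=e^{-\varphi}h_0$ with $h_0$ a smooth hermitian metric and $\varphi$ a quasi-psh function (locally smooth plus psh). For $X$ of dimension $n$, a hermitian metric $ds^2$ on $X^o$ and $(E,h)$ on $X^o$, $\mathscr{D}^{p,q}_{X,ds^2}(E,h)$ is the sheaf on $X$ whose sections over an open $U\subset X$ are the measurable $E$-valued $(p,q)$-forms $\alpha$ on $U\cap X^o$ such that $\alpha$ and $\bar\partial\alpha$ (in the sense of distributions) are square integrable with respect to $ds^2$ and $h$ on $V_x\cap X^o$ for some neighborhood $V_x$ of every $x\in U$. One sets $S_X(E,h):={\rm Ker}(\mathscr{D}^{n,0}_{X,ds^2}(E,h)\stackrel{\bar\partial}{\to}\mathscr{D}^{n,1}_{X,ds^2}(E,h))$, which does not depend on the choice of $ds^2$. On $X'$ the same construction is used with the open subset $\pi^{-1}(X^o)\simeq X^o$, on which $(\pi^\ast E,\pi^\ast h)$ is defined. *)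

theory Defs
  imports "HOL-Analysis.Analysis" "Jordan_Normal_Form.Determinant"
begin

section \<open>Analysis on open subsets of \<open>\<complex>\<^sup>N\<close>\<close>

text \<open>
  The dimension has to vary inside formulas, so a point of \<open>\<complex>\<^sup>N\<close> is an element of
  \<open>{..<N} \<rightarrow>\<^sub>E UNIV\<close>, i.e. a function on \<open>nat\<close> that is \<open>undefined\<close> outside \<open>{..<N}\<close>.
\<close>

definition Cn :: "nat \<Rightarrow> (nat \<Rightarrow> complex) topology" where
  "Cn N = product_topology (\<lambda>_. euclidean) {..<N}"

definition lebC :: "nat \<Rightarrow> (nat \<Rightarrow> complex) measure" where
  "lebC N = completion (PiM {..<N} (\<lambda>_. lborel))"

definition std_basis :: "nat \<Rightarrow> nat \<Rightarrow> nat \<Rightarrow> complex" where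
  "std_basis N j = (\<lambda>i\<in>{..<N}. if i = j then 1 else 0)"

definition holo :: "nat \<Rightarrow> (nat \<Rightarrow> complex) set \<Rightarrow> ((nat \<Rightarrow> complex) \<Rightarrow> complex) \<Rightarrow> bool" where
  "holo N D F \<longleftrightarrow> continuous_map (subtopology (Cn N) D) euclidean F \<and>
     (\<forall>y\<in>D. \<forall>i<N. (\<lambda>t. F (y(i := t))) field_differentiable (at (y i)))"

primrec Ck :: "nat \<Rightarrow> nat \<Rightarrow> (nat \<Rightarrow> complex) set \<Rightarrow> ((nat \<Rightarrow> complex) \<Rightarrow> complex) \<Rightarrow> bool" where
  "Ck N 0 D F \<longleftrightarrow> continuous_map (subtopology (Cn N) D) euclidean F"
| "Ck N (Suc k) D F \<longleftrightarrow> continuous_map (subtopology (Cn N) D) euclidean F \<and>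
     (\<forall>i<N. \<forall>w\<in>{1, \<i>}. \<exists>G. Ck N k D G \<and>
        (\<forall>y\<in>D. ((\<lambda>t::real. F (y(i := y i + of_real t * w))) has_vector_derivative G y) (at 0)))"

definition smooth :: "nat \<Rightarrow> (nat \<Rightarrow> complex) set \<Rightarrow> ((nat \<Rightarrow> complex) \<Rightarrow> complex) \<Rightarrow> bool" where
  "smooth N D F \<longleftrightarrow> (\<forall>k. Ck N k D F)"

definition test_function :: "nat \<Rightarrow> (nat \<Rightarrow> complex) set \<Rightarrow> ((nat \<Rightarrow> complex) \<Rightarrow> complex) \<Rightarrow> bool" where
  "test_function N D \<psi> \<longleftrightarrow> smooth N (topspace (Cn N)) \<psi> \<and>
     (\<exists>K. compactin (Cn N) K \<and> K \<subseteq> D \<and> (\<forall>y\<in>topspace (Cn N) - K. \<psi> y = 0))"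

text \<open>The operator \<open>(\<partial>/\<partial>x\<^sub>j + \<i> \<partial>/\<partial>y\<^sub>j) / 2\<close>.\<close>

definition dzbar :: "nat \<Rightarrow> ((nat \<Rightarrow> complex) \<Rightarrow> complex) \<Rightarrow> (nat \<Rightarrow> complex) \<Rightarrow> complex" where
  "dzbar j F y =
     (vector_derivative (\<lambda>t::real. F (y(j := y j + of_real t))) (at 0)
      + \<i> * vector_derivative (\<lambda>t::real. F (y(j := y j + of_real t * \<i>))) (at 0)) / 2"

text \<open>
  Plurisubharmonic functions with values in \<open>[-\<infinity>, \<infinity>)\<close>, not identically \<open>-\<infinity>\<close> on any
  connected component. The mean value inequality on the discs \<open>a + t \<xi>\<close>, \<open>|t| \<le> 1\<close>, of complex
  lines is written for the nonnegative functions \<open>M - u\<close>, as \<open>u\<close> may take the value \<open>-\<infinity>\<close>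
  and its integral may a priori be \<open>-\<infinity>\<close>.
\<close>

definition psh :: "nat \<Rightarrow> (nat \<Rightarrow> complex) set \<Rightarrow> ((nat \<Rightarrow> complex) \<Rightarrow> ereal) \<Rightarrow> bool" where
  "psh N D u \<longleftrightarrow>
     (\<forall>y\<in>D. u y \<noteq> \<infinity>) \<and>
     (\<forall>c::real. openin (subtopology (Cn N) D) {y\<in>D. u y < ereal c}) \<and>
     (\<forall>C\<in>connected_components_of (subtopology (Cn N) D). \<exists>y\<in>C. u y \<noteq> -\<infinity>) \<and>
     (\<forall>a\<in>D. \<forall>\<xi>\<in>topspace (Cn N).
        (\<forall>t::complex. cmod t \<le> 1 \<longrightarrow> (\<lambda>i\<in>{..<N}. a i + t * \<xi> i) \<in> D) \<longrightarrow>
        (\<forall>M::real. u a \<le> ereal M \<and>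
            (\<forall>\<theta>::real. u (\<lambda>i\<in>{..<N}. a i + cis \<theta> * \<xi> i) \<le> ereal M) \<longrightarrow>
          (\<integral>\<^sup>+\<theta>\<in>{0..2 * pi}. e2ennreal (ereal M - u (\<lambda>i\<in>{..<N}. a i + cis \<theta> * \<xi> i)) \<partial>lborel)
            \<le> ennreal (2 * pi) * e2ennreal (ereal M - u a)))"

section \<open>Complex spaces\<close>

text \<open>
  A reduced complex space is a topological space with a sheaf of complex-valued functions:
  \<open>hol X U f\<close> says that \<open>f\<close> restricts to a section of the structure sheaf over the open set \<open>U\<close>;
  values of \<open>f\<close> outside \<open>U\<close> are irrelevant.
\<close>

record 'a cspace =
  ctop :: "'a topology"
  hol :: "'a set \<Rightarrow> ('a \<Rightarrow> complex) \<Rightarrow> bool"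

definition function_sheaf :: "'a cspace \<Rightarrow> bool" where
  "function_sheaf X \<longleftrightarrow>
     (\<forall>U V f. openin (ctop X) U \<and> openin (ctop X) V \<and> V \<subseteq> U \<and> hol X U f \<longrightarrow> hol X V f) \<and>
     (\<forall>U f g. openin (ctop X) U \<and> hol X U f \<and> (\<forall>x\<in>U. f x = g x) \<longrightarrow> hol X U g) \<and>
     (\<forall>U f. openin (ctop X) U \<and>
        (\<forall>x\<in>U. \<exists>V. openin (ctop X) V \<and> x \<in> V \<and> V \<subseteq> U \<and> hol X V f) \<longrightarrow> hol X U f)"

text \<open>
  \<open>z\<close> identifies the open set \<open>V\<close> with the common zero set of finitely many holomorphic functions
  on an open subset of \<open>\<complex>\<^sup>N\<close>, and the structure sheaf of \<open>V\<close> with the functions that are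
  locally restrictions of holomorphic functions of the ambient space.
\<close>

definition local_model :: "'a cspace \<Rightarrow> nat \<Rightarrow> 'a set \<Rightarrow> ('a \<Rightarrow> nat \<Rightarrow> complex) \<Rightarrow> bool" where
  "local_model X N V z \<longleftrightarrow>
     openin (ctop X) V \<and>
     (\<exists>D \<F>. openin (Cn N) D \<and> finite \<F> \<and> (\<forall>F\<in>\<F>. holo N D F) \<and>
        z ` V = {y\<in>D. \<forall>F\<in>\<F>. F y = 0}) \<and>
     homeomorphic_map (subtopology (ctop X) V) (subtopology (Cn N) (z ` V)) z \<and>
     (\<forall>W f. openin (ctop X) W \<and> W \<subseteq> V \<longrightarrow>
        (hol X W f \<longleftrightarrow>
           (\<forall>x\<in>W. \<exists>B F. openin (Cn N) B \<and> z x \<in> B \<and> holo N B F \<and>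
              (\<forall>x'\<in>W. z x' \<in> B \<longrightarrow> f x' = F (z x')))))"

definition analytic_subset :: "'a cspace \<Rightarrow> 'a set \<Rightarrow> bool" where
  "analytic_subset X A \<longleftrightarrow> A \<subseteq> topspace (ctop X) \<and>
     (\<forall>x\<in>topspace (ctop X). \<exists>U \<F>. openin (ctop X) U \<and> x \<in> U \<and> finite \<F> \<and>
        (\<forall>f\<in>\<F>. hol X U f) \<and> A \<inter> U = {y\<in>U. \<forall>f\<in>\<F>. f y = 0})"

definition irreducible_cspace :: "'a cspace \<Rightarrow> bool" where
  "irreducible_cspace X \<longleftrightarrow> topspace (ctop X) \<noteq> {} \<and>
     (\<forall>A B. analytic_subset X A \<and> analytic_subset X B \<and> A \<union> B = topspace (ctop X) \<longrightarrow>
        A = topspace (ctop X) \<or> B = topspace (ctop X))"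

definition paracompact :: "'a topology \<Rightarrow> bool" where
  "paracompact T \<longleftrightarrow>
     (\<forall>\<U>. (\<forall>U\<in>\<U>. openin T U) \<and> \<Union>\<U> = topspace T \<longrightarrow>
        (\<exists>\<V>. (\<forall>V\<in>\<V>. openin T V \<and> (\<exists>U\<in>\<U>. V \<subseteq> U)) \<and> \<Union>\<V> = topspace T \<and>
           locally_finite_in T \<V>))"

definition countable_at_infinity :: "'a topology \<Rightarrow> bool" where
  "countable_at_infinity T \<longleftrightarrow>
     (\<exists>\<K>. countable \<K> \<and> (\<forall>K\<in>\<K>. compactin T K) \<and> \<Union>\<K> = topspace T)"

definition complex_space :: "'a cspace \<Rightarrow> bool" where
  "complex_space X \<longleftrightarrow>
     Hausdorff_space (ctop X) \<and> paracompact (ctop X) \<and> countable_at_infinity (ctop X) \<and>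
     function_sheaf X \<and>
     (\<forall>x\<in>topspace (ctop X). \<exists>N V z. local_model X N V z \<and> x \<in> V) \<and>
     irreducible_cspace X"

definition chart :: "'a cspace \<Rightarrow> nat \<Rightarrow> 'a set \<Rightarrow> ('a \<Rightarrow> nat \<Rightarrow> complex) \<Rightarrow> bool" where
  "chart X n V z \<longleftrightarrow> local_model X n V z \<and> openin (Cn n) (z ` V)"

definition regular_points :: "'a cspace \<Rightarrow> 'a set" where
  "regular_points X = {x. \<exists>n V z. chart X n V z \<and> x \<in> V}"

text \<open>
  The regular locus is a complex manifold of pure dimension \<open>n\<close>. An irreducible complex space has
  exactly one such \<open>n\<close>, because its regular locus is nonempty and connected.
\<close>

definition has_dimension :: "'a cspace \<Rightarrow> nat \<Rightarrow> bool" where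
  "has_dimension X n \<longleftrightarrow> (\<forall>m V z. chart X m V z \<and> V \<noteq> {} \<longrightarrow> m = n)"

definition zariski_open :: "'a cspace \<Rightarrow> 'a set \<Rightarrow> bool" where
  "zariski_open X U \<longleftrightarrow> (\<exists>A. analytic_subset X A \<and> U = topspace (ctop X) - A)"

definition open_subspace :: "'a cspace \<Rightarrow> 'a set \<Rightarrow> 'a cspace" where
  "open_subspace X U = \<lparr>ctop = subtopology (ctop X) U, hol = hol X\<rparr>"

definition preim :: "'b cspace \<Rightarrow> ('b \<Rightarrow> 'a) \<Rightarrow> 'a set \<Rightarrow> 'b set" where
  "preim Y f U = {y\<in>topspace (ctop Y). f y \<in> U}"

definition holomorphic_map :: "'b cspace \<Rightarrow> 'a cspace \<Rightarrow> ('b \<Rightarrow> 'a) \<Rightarrow> bool" where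
  "holomorphic_map Y X f \<longleftrightarrow> continuous_map (ctop Y) (ctop X) f \<and>
     (\<forall>U u. openin (ctop X) U \<and> hol X U u \<longrightarrow> hol Y (preim Y f U) (u \<circ> f))"

definition biholomorphic_map :: "'b cspace \<Rightarrow> 'a cspace \<Rightarrow> ('b \<Rightarrow> 'a) \<Rightarrow> bool" where
  "biholomorphic_map Y X f \<longleftrightarrow> holomorphic_map Y X f \<and>
     (\<exists>g. holomorphic_map X Y g \<and>
        (\<forall>y\<in>topspace (ctop Y). g (f y) = y) \<and> (\<forall>x\<in>topspace (ctop X). f (g x) = x))"

section \<open>Tangent vectors and hermitian metrics\<close>

text \<open>
  A holomorphic tangent vector at \<open>x\<close> is a \<open>\<complex>\<close>-linear derivation of the ring of germs of
  holomorphic functions at \<open>x\<close>. To make it a unique HOL function, it is extended by \<open>0\<close> to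
  functions that are not holomorphic near \<open>x\<close>.
\<close>

type_synonym 'a tangent = "('a \<Rightarrow> complex) \<Rightarrow> complex"

definition hol_near :: "'a cspace \<Rightarrow> 'a \<Rightarrow> ('a \<Rightarrow> complex) \<Rightarrow> bool" where
  "hol_near X x f \<longleftrightarrow> (\<exists>U. openin (ctop X) U \<and> x \<in> U \<and> hol X U f)"

definition tangent_space :: "'a cspace \<Rightarrow> 'a \<Rightarrow> 'a tangent set" where
  "tangent_space X x = {D.
     (\<forall>f. \<not> hol_near X x f \<longrightarrow> D f = 0) \<and>
     (\<forall>f g U. hol_near X x f \<and> hol_near X x g \<and> openin (ctop X) U \<and> x \<in> U \<and>
        (\<forall>y\<in>U. f y = g y) \<longrightarrow> D f = D g) \<and>
     (\<forall>f g a b. hol_near X x f \<and> hol_near X x g \<longrightarrow>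
        D (\<lambda>y. a * f y + b * g y) = a * D f + b * D g) \<and>
     (\<forall>f g. hol_near X x f \<and> hol_near X x g \<longrightarrow>
        D (\<lambda>y. f y * g y) = D f * g x + f x * D g)}"

definition tcomb :: "complex \<Rightarrow> 'a tangent \<Rightarrow> complex \<Rightarrow> 'a tangent \<Rightarrow> 'a tangent" where
  "tcomb a D b D' = (\<lambda>f. a * D f + b * D' f)"

text \<open>The vector \<open>\<partial>/\<partial>z\<^sub>i\<close> at \<open>x\<close> of the chart \<open>(V, z)\<close>.\<close>

definition coord_vec ::
    "'a cspace \<Rightarrow> 'a set \<Rightarrow> ('a \<Rightarrow> nat \<Rightarrow> complex) \<Rightarrow> 'a \<Rightarrow> nat \<Rightarrow> 'a tangent" where
  "coord_vec X V z x i =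
     (\<lambda>f. if hol_near X x f then deriv (\<lambda>t. f (inv_into V z ((z x)(i := t)))) (z x i) else 0)"

definition differential ::
    "'a cspace \<Rightarrow> ('b \<Rightarrow> 'a) \<Rightarrow> 'b \<Rightarrow> 'b tangent \<Rightarrow> 'a tangent" where
  "differential X f y D = (\<lambda>u. if hol_near X (f y) u then D (u \<circ> f) else 0)"

text \<open>
  A smooth hermitian metric on the manifold \<open>B\<close> (an open set of regular points of \<open>X\<close>), linear in
  its first argument.
\<close>

definition hermitian_metric ::
    "'a cspace \<Rightarrow> nat \<Rightarrow> 'a set \<Rightarrow> ('a \<Rightarrow> 'a tangent \<Rightarrow> 'a tangent \<Rightarrow> complex) \<Rightarrow> bool" where
  "hermitian_metric X n B g \<longleftrightarrow>
     (\<forall>x\<in>B. \<forall>u\<in>tangent_space X x. \<forall>v\<in>tangent_space X x.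
        (\<forall>w\<in>tangent_space X x. \<forall>a b. g x (tcomb a u b v) w = a * g x u w + b * g x v w) \<and>
        g x v u = cnj (g x u v) \<and> (u \<noteq> (\<lambda>f. 0) \<longrightarrow> 0 < Re (g x u u))) \<and>
     (\<forall>V z. chart X n V z \<and> V \<subseteq> B \<longrightarrow>
        (\<forall>i<n. \<forall>j<n. smooth n (z ` V)
           (\<lambda>y. let x = inv_into V z y in g x (coord_vec X V z x i) (coord_vec X V z x j))))"

text \<open>
  The volume density of \<open>g\<close> in a chart, up to a constant factor depending on \<open>n\<close> only (such
  constants do not affect square integrability).
\<close>

definition vol_density ::
    "'a cspace \<Rightarrow> nat \<Rightarrow> ('a \<Rightarrow> 'a tangent \<Rightarrow> 'a tangent \<Rightarrow> complex) \<Rightarrow>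
     'a set \<Rightarrow> ('a \<Rightarrow> nat \<Rightarrow> complex) \<Rightarrow> 'a \<Rightarrow> ennreal" where
  "vol_density X n g V z x = ennreal (Re (Determinant.det (Matrix.mat n n
     (\<lambda>(i, j). g x (coord_vec X V z x i) (coord_vec X V z x j)))))"

text \<open>
  The integral of \<open>f\<close> over the open set \<open>B\<close> of the manifold of regular points with respect to the
  volume of \<open>g\<close>: the supremum, over finite families of disjoint measurable pieces \<open>P\<close> lying in the
  domains of charts \<open>(V, z)\<close> of \<open>B\<close>, of the sums of the integrals over the pieces. As \<open>B\<close> is
  covered by countably many charts, this is the usual integral.
\<close>

definition manifold_nn_integral ::
    "'a cspace \<Rightarrow> nat \<Rightarrow> ('a \<Rightarrow> 'a tangent \<Rightarrow> 'a tangent \<Rightarrow> complex) \<Rightarrow>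
     'a set \<Rightarrow> ('a \<Rightarrow> ennreal) \<Rightarrow> ennreal" where
  "manifold_nn_integral X n g B f =
     (SUP \<P> \<in> {\<P>. finite \<P> \<and> disjoint_family_on fst \<P> \<and>
          (\<forall>(P, V, z)\<in>\<P>. chart X n V z \<and> V \<subseteq> B \<and> P \<subseteq> V \<and> z ` P \<in> sets (lebC n))}.
        \<Sum>(P, V, z)\<in>\<P>. \<integral>\<^sup>+y\<in>z ` P. f (inv_into V z y) * vol_density X n g V z (inv_into V z y) \<partial>lebC n)"

section \<open>Holomorphic vector bundles and singular hermitian metrics\<close>

text \<open>
  The fibre over \<open>x\<close> is a subset of the type \<open>'e\<close> with its own operations. A pair \<open>(T, \<tau>)\<close> in
  \<open>vb_trivs\<close> is a local trivialization over the open set \<open>T\<close>, with \<open>\<tau> x\<close> the isomorphism from the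
  fibre over \<open>x\<close> onto \<open>\<complex>\<^sup>r\<close>. The vector space axioms of the fibres follow from the bijectivity and
  linearity of \<open>\<tau> x\<close>.
\<close>

record ('a, 'e) vbundle =
  vb_rank :: nat
  vb_fibre :: "'a \<Rightarrow> 'e set"
  vb_zero :: "'a \<Rightarrow> 'e"
  vb_add :: "'a \<Rightarrow> 'e \<Rightarrow> 'e \<Rightarrow> 'e"
  vb_scale :: "'a \<Rightarrow> complex \<Rightarrow> 'e \<Rightarrow> 'e"
  vb_trivs :: "('a set \<times> ('a \<Rightarrow> 'e \<Rightarrow> nat \<Rightarrow> complex)) set"

definition local_frame ::
    "('a, 'e) vbundle \<Rightarrow> ('a \<Rightarrow> 'e \<Rightarrow> nat \<Rightarrow> complex) \<Rightarrow> nat \<Rightarrow> 'a \<Rightarrow> 'e" where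
  "local_frame E \<tau> j x = inv_into (vb_fibre E x) (\<tau> x) (std_basis (vb_rank E) j)"

definition holomorphic_vector_bundle :: "'a cspace \<Rightarrow> 'a set \<Rightarrow> ('a, 'e) vbundle \<Rightarrow> bool" where
  "holomorphic_vector_bundle X B E \<longleftrightarrow>
     (\<forall>x\<in>B. vb_zero E x \<in> vb_fibre E x \<and>
        (\<forall>u\<in>vb_fibre E x. \<forall>v\<in>vb_fibre E x. vb_add E x u v \<in> vb_fibre E x) \<and>
        (\<forall>c. \<forall>u\<in>vb_fibre E x. vb_scale E x c u \<in> vb_fibre E x)) \<and>
     (\<forall>x\<in>B. \<exists>(T, \<tau>)\<in>vb_trivs E. x \<in> T) \<and>
     (\<forall>(T, \<tau>)\<in>vb_trivs E. openin (ctop X) T \<and> T \<subseteq> B \<and>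
        (\<forall>x\<in>T. bij_betw (\<tau> x) (vb_fibre E x) (topspace (Cn (vb_rank E))) \<and>
           (\<forall>i<vb_rank E. \<tau> x (vb_zero E x) i = 0) \<and>
           (\<forall>u\<in>vb_fibre E x. \<forall>v\<in>vb_fibre E x. \<forall>i<vb_rank E.
              \<tau> x (vb_add E x u v) i = \<tau> x u i + \<tau> x v i) \<and>
           (\<forall>c. \<forall>u\<in>vb_fibre E x. \<forall>i<vb_rank E. \<tau> x (vb_scale E x c u) i = c * \<tau> x u i))) \<and>
     (\<forall>(T, \<tau>)\<in>vb_trivs E. \<forall>(T', \<tau>')\<in>vb_trivs E. \<forall>i<vb_rank E. \<forall>j<vb_rank E.
        hol X (T \<inter> T') (\<lambda>x. \<tau>' x (local_frame E \<tau> j x) i))"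

definition pullback_bundle ::
    "'b cspace \<Rightarrow> ('b \<Rightarrow> 'a) \<Rightarrow> ('a, 'e) vbundle \<Rightarrow> ('b, 'e) vbundle" where
  "pullback_bundle Y f E =
     \<lparr>vb_rank = vb_rank E, vb_fibre = vb_fibre E \<circ> f, vb_zero = vb_zero E \<circ> f,
      vb_add = vb_add E \<circ> f, vb_scale = vb_scale E \<circ> f,
      vb_trivs = (\<lambda>(T, \<tau>). (preim Y f T, \<tau> \<circ> f)) ` vb_trivs E\<rparr>"

definition smooth_bundle_metric ::
    "'a cspace \<Rightarrow> nat \<Rightarrow> 'a set \<Rightarrow> ('a, 'e) vbundle \<Rightarrow> ('a \<Rightarrow> 'e \<Rightarrow> 'e \<Rightarrow> complex) \<Rightarrow> bool" where
  "smooth_bundle_metric X n B E h0 \<longleftrightarrow>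
     (\<forall>x\<in>B. \<forall>u\<in>vb_fibre E x. \<forall>v\<in>vb_fibre E x.
        (\<forall>w\<in>vb_fibre E x. \<forall>a b.
           h0 x (vb_add E x (vb_scale E x a u) (vb_scale E x b v)) w = a * h0 x u w + b * h0 x v w) \<and>
        h0 x v u = cnj (h0 x u v) \<and> (u \<noteq> vb_zero E x \<longrightarrow> 0 < Re (h0 x u u))) \<and>
     (\<forall>V z. chart X n V z \<longrightarrow>
        (\<forall>(T, \<tau>)\<in>vb_trivs E. V \<subseteq> T \<longrightarrow>
           (\<forall>i<vb_rank E. \<forall>j<vb_rank E. smooth n (z ` V)
              (\<lambda>y. let x = inv_into V z y in h0 x (local_frame E \<tau> i x) (local_frame E \<tau> j x)))))"

definition quasi_psh :: "'a cspace \<Rightarrow> nat \<Rightarrow> 'a set \<Rightarrow> ('a \<Rightarrow> ereal) \<Rightarrow> bool" where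
  "quasi_psh X n B \<phi> \<longleftrightarrow>
     (\<forall>x\<in>B. \<exists>V z (s :: (nat \<Rightarrow> complex) \<Rightarrow> real) u.
        chart X n V z \<and> x \<in> V \<and> V \<subseteq> B \<and>
        smooth n (z ` V) (\<lambda>y. complex_of_real (s y)) \<and> psh n (z ` V) u \<and>
        (\<forall>y\<in>V. \<phi> y = ereal (s (z y)) + u (z y)))"

definition exp_minus :: "ereal \<Rightarrow> ennreal" where
  "exp_minus t = (case t of ereal r \<Rightarrow> ennreal (exp (- r)) | PInfty \<Rightarrow> 0 | MInfty \<Rightarrow> \<infinity>)"

text \<open>
  A possibly singular hermitian metric \<open>h = e\<^bsup>-\<phi>\<^esup> h\<^sub>0\<close> is represented by its squared norm
  \<open>h x v = e\<^bsup>-\<phi>(x)\<^esup> h\<^sub>0(v, v)\<close>, which is infinite for \<open>v \<noteq> 0\<close> at the points with \<open>\<phi>(x) = -\<infinity>\<close>.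
\<close>

definition singular_hermitian_metric ::
    "'a cspace \<Rightarrow> nat \<Rightarrow> 'a set \<Rightarrow> ('a, 'e) vbundle \<Rightarrow> ('a \<Rightarrow> 'e \<Rightarrow> ennreal) \<Rightarrow> bool" where
  "singular_hermitian_metric X n B E h \<longleftrightarrow>
     (\<exists>\<phi> h0. quasi_psh X n B \<phi> \<and> smooth_bundle_metric X n B E h0 \<and>
        (\<forall>x\<in>B. \<forall>v\<in>vb_fibre E x. h x v = exp_minus (\<phi> x) * ennreal (Re (h0 x v v))))"

section \<open>Bundle-valued forms\<close>

text \<open>
  An \<open>E\<close>-valued \<open>(p,q)\<close>-form \<open>\<alpha>\<close> on \<open>W\<close> is given by its values
  \<open>\<alpha>\<^sub>x(v\<^sub>1, \<dots>, v\<^sub>p, cnj w\<^sub>1, \<dots>, cnj w\<^sub>q) = \<alpha> x [v\<^sub>1, \<dots>, v\<^sub>p] [w\<^sub>1, \<dots>, w\<^sub>q]\<close> on holomorphic tangent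
  vectors: linear and alternating in the \<open>v\<^sub>i\<close>, conjugate linear and alternating in the \<open>w\<^sub>j\<close>.
  It is \<open>undefined\<close> on all other arguments.
\<close>

type_synonym ('a, 'e) form = "'a \<Rightarrow> 'a tangent list \<Rightarrow> 'a tangent list \<Rightarrow> 'e"

definition form_args ::
    "'a cspace \<Rightarrow> 'a set \<Rightarrow> nat \<Rightarrow> nat \<Rightarrow> 'a \<Rightarrow> 'a tangent list \<Rightarrow> 'a tangent list \<Rightarrow> bool" where
  "form_args X W p q x vs ws \<longleftrightarrow> x \<in> W \<and> length vs = p \<and> length ws = q \<and>
     set vs \<subseteq> tangent_space X x \<and> set ws \<subseteq> tangent_space X x"

definition mk_form ::
    "'a cspace \<Rightarrow> 'a set \<Rightarrow> nat \<Rightarrow> nat \<Rightarrow> ('a, 'e) form \<Rightarrow> ('a, 'e) form" where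
  "mk_form X W p q \<alpha> = (\<lambda>x vs ws. if form_args X W p q x vs ws then \<alpha> x vs ws else undefined)"

definition is_form ::
    "'a cspace \<Rightarrow> ('a, 'e) vbundle \<Rightarrow> 'a set \<Rightarrow> nat \<Rightarrow> nat \<Rightarrow> ('a, 'e) form \<Rightarrow> bool" where
  "is_form X E W p q \<alpha> \<longleftrightarrow> mk_form X W p q \<alpha> = \<alpha> \<and>
     (\<forall>x vs ws. form_args X W p q x vs ws \<longrightarrow>
        \<alpha> x vs ws \<in> vb_fibre E x \<and>
        (\<forall>i<p. \<forall>u\<in>tangent_space X x. \<forall>v\<in>tangent_space X x. \<forall>a b.
           \<alpha> x (vs[i := tcomb a u b v]) ws =
             vb_add E x (vb_scale E x a (\<alpha> x (vs[i := u]) ws))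
                        (vb_scale E x b (\<alpha> x (vs[i := v]) ws))) \<and>
        (\<forall>j<q. \<forall>u\<in>tangent_space X x. \<forall>v\<in>tangent_space X x. \<forall>a b.
           \<alpha> x vs (ws[j := tcomb a u b v]) =
             vb_add E x (vb_scale E x (cnj a) (\<alpha> x vs (ws[j := u])))
                        (vb_scale E x (cnj b) (\<alpha> x vs (ws[j := v])))) \<and>
        (\<not> distinct vs \<or> \<not> distinct ws \<longrightarrow> \<alpha> x vs ws = vb_zero E x))"

text \<open>
  The \<open>k\<close>-th component, with respect to the trivialization \<open>\<tau>\<close>, of the coefficient of
  \<open>dz\<^sub>I \<and> cnj (dz\<^sub>J)\<close> of \<open>\<alpha>\<close>, as a function on the image of the chart \<open>(V, z)\<close>. Multi-indices are
  finite sets, listed in increasing order.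
\<close>

definition coef ::
    "'a cspace \<Rightarrow> 'a set \<Rightarrow> ('a \<Rightarrow> nat \<Rightarrow> complex) \<Rightarrow> ('a \<Rightarrow> 'e \<Rightarrow> nat \<Rightarrow> complex) \<Rightarrow>
     ('a, 'e) form \<Rightarrow> nat set \<Rightarrow> nat set \<Rightarrow> nat \<Rightarrow> (nat \<Rightarrow> complex) \<Rightarrow> complex" where
  "coef X V z \<tau> \<alpha> I J k y = (let x = inv_into V z y in
     \<tau> x (\<alpha> x (map (coord_vec X V z x) (sorted_list_of_set I))
              (map (coord_vec X V z x) (sorted_list_of_set J))) k)"

definition indices :: "nat \<Rightarrow> nat \<Rightarrow> nat set set" where
  "indices n p = {I. I \<subseteq> {..<n} \<and> card I = p}"

definition measurable_form ::
    "'a cspace \<Rightarrow> nat \<Rightarrow> ('a, 'e) vbundle \<Rightarrow> 'a set \<Rightarrow> nat \<Rightarrow> nat \<Rightarrow> ('a, 'e) form \<Rightarrow> bool" where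
  "measurable_form X n E W p q \<alpha> \<longleftrightarrow> is_form X E W p q \<alpha> \<and>
     (\<forall>V z. \<forall>(T, \<tau>)\<in>vb_trivs E. \<forall>I\<in>indices n p. \<forall>J\<in>indices n q. \<forall>k<vb_rank E.
        chart X n V z \<and> V \<subseteq> W \<inter> T \<longrightarrow>
        coef X V z \<tau> \<alpha> I J k \<in> borel_measurable (restrict_space (lebC n) (z ` V)))"

definition ae_equal ::
    "'a cspace \<Rightarrow> nat \<Rightarrow> 'a set \<Rightarrow> ('a, 'e) form \<Rightarrow> ('a, 'e) form \<Rightarrow> bool" where
  "ae_equal X n W \<alpha> \<beta> \<longleftrightarrow>
     (\<forall>V z. chart X n V z \<and> V \<subseteq> W \<longrightarrow>
        (AE y in lebC n. y \<in> z ` V \<longrightarrow> \<alpha> (inv_into V z y) = \<beta> (inv_into V z y)))"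

definition unitary_frame ::
    "'a cspace \<Rightarrow> nat \<Rightarrow> ('a \<Rightarrow> 'a tangent \<Rightarrow> 'a tangent \<Rightarrow> complex) \<Rightarrow> 'a \<Rightarrow> (nat \<Rightarrow> 'a tangent) \<Rightarrow> bool" where
  "unitary_frame X n g x e \<longleftrightarrow> (\<forall>i<n. e i \<in> tangent_space X x) \<and>
     (\<forall>i<n. \<forall>j<n. g x (e i) (e j) = (if i = j then 1 else 0))"

text \<open>
  The squared pointwise norm of \<open>\<alpha>\<close> with respect to \<open>g\<close> and \<open>h\<close>; it does not depend on the choice
  of the unitary frame.
\<close>

definition form_norm2 ::
    "'a cspace \<Rightarrow> nat \<Rightarrow> ('a \<Rightarrow> 'a tangent \<Rightarrow> 'a tangent \<Rightarrow> complex) \<Rightarrow> ('a \<Rightarrow> 'e \<Rightarrow> ennreal) \<Rightarrow>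
     nat \<Rightarrow> nat \<Rightarrow> ('a, 'e) form \<Rightarrow> 'a \<Rightarrow> ennreal" where
  "form_norm2 X n g h p q \<alpha> x = (let e = (SOME e. unitary_frame X n g x e) in
     \<Sum>I\<in>indices n p. \<Sum>J\<in>indices n q.
        h x (\<alpha> x (map e (sorted_list_of_set I)) (map e (sorted_list_of_set J))))"

definition square_integrable ::
    "'a cspace \<Rightarrow> nat \<Rightarrow> 'a set \<Rightarrow> ('a \<Rightarrow> 'a tangent \<Rightarrow> 'a tangent \<Rightarrow> complex) \<Rightarrow> ('a \<Rightarrow> 'e \<Rightarrow> ennreal) \<Rightarrow>
     nat \<Rightarrow> nat \<Rightarrow> 'a set \<Rightarrow> ('a, 'e) form \<Rightarrow> bool" where
  "square_integrable X n Xo g h p q U \<alpha> \<longleftrightarrow>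
     (\<forall>x\<in>U. \<exists>V. openin (ctop X) V \<and> x \<in> V \<and> V \<subseteq> U \<and>
        manifold_nn_integral X n g (V \<inter> Xo) (form_norm2 X n g h p q \<alpha>) < \<infinity>)"

definition locally_integrable_form ::
    "'a cspace \<Rightarrow> nat \<Rightarrow> ('a, 'e) vbundle \<Rightarrow> 'a set \<Rightarrow> nat \<Rightarrow> nat \<Rightarrow> ('a, 'e) form \<Rightarrow> bool" where
  "locally_integrable_form X n E W p q \<alpha> \<longleftrightarrow>
     (\<forall>V z K. \<forall>(T, \<tau>)\<in>vb_trivs E. \<forall>I\<in>indices n p. \<forall>J\<in>indices n q. \<forall>k<vb_rank E.
        chart X n V z \<and> V \<subseteq> W \<inter> T \<and> compactin (Cn n) K \<and> K \<subseteq> z ` V \<longrightarrow>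
        set_integrable (lebC n) K (coef X V z \<tau> \<alpha> I J k))"

text \<open>
  \<open>dbar \<alpha> = \<beta>\<close> in the sense of distributions, for a \<open>(p,q)\<close>-form \<open>\<alpha>\<close> and a \<open>(p,q+1)\<close>-form \<open>\<beta>\<close>
  on \<open>W\<close>: in local coordinates and a local holomorphic frame of \<open>E\<close>,
  \<open>\<beta>\<^sub>I\<^sub>J = (-1)\<^sup>p \<Sum>\<^sub>j\<^sub>\<in>\<^sub>J (-1)\<^bsup>|{l \<in> J. l < j}|\<^esup> dzbar j (\<alpha>\<^bsub>I,J-{j}\<^esub>)\<close>, tested
  against smooth functions with compact support.
\<close>

definition dbar_distr ::
    "'a cspace \<Rightarrow> nat \<Rightarrow> ('a, 'e) vbundle \<Rightarrow> 'a set \<Rightarrow> nat \<Rightarrow> nat \<Rightarrow> ('a, 'e) form \<Rightarrow> ('a, 'e) form \<Rightarrow> bool" where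
  "dbar_distr X n E W p q \<alpha> \<beta> \<longleftrightarrow>
     locally_integrable_form X n E W p q \<alpha> \<and> locally_integrable_form X n E W p (Suc q) \<beta> \<and>
     (\<forall>V z \<psi>. \<forall>(T, \<tau>)\<in>vb_trivs E. \<forall>I\<in>indices n p. \<forall>J\<in>indices n (Suc q). \<forall>k<vb_rank E.
        chart X n V z \<and> V \<subseteq> W \<inter> T \<and> test_function n (z ` V) \<psi> \<longrightarrow>
        (LINT y:z ` V|lebC n. coef X V z \<tau> \<beta> I J k y * \<psi> y) =
        (-1) ^ p * (\<Sum>j\<in>J. (-1) ^ card {l\<in>J. l < j} *
           - (LINT y:z ` V|lebC n. coef X V z \<tau> \<alpha> I (J - {j}) k y * dzbar j \<psi> y)))"

section \<open>The sheaf \<open>S\<^sub>X(E,h)\<close>\<close>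

text \<open>Representatives of the sections over \<open>U\<close> of the sheaf \<open>\<D>\<^bsup>p,q\<^esup>\<close> of the pair \<open>(g, h)\<close>.\<close>

definition L2_forms ::
    "'a cspace \<Rightarrow> nat \<Rightarrow> 'a set \<Rightarrow> ('a, 'e) vbundle \<Rightarrow> ('a \<Rightarrow> 'a tangent \<Rightarrow> 'a tangent \<Rightarrow> complex) \<Rightarrow>
     ('a \<Rightarrow> 'e \<Rightarrow> ennreal) \<Rightarrow> nat \<Rightarrow> nat \<Rightarrow> 'a set \<Rightarrow> ('a, 'e) form set" where
  "L2_forms X n Xo E g h p q U = {\<alpha>. measurable_form X n E (U \<inter> Xo) p q \<alpha> \<and>
     square_integrable X n Xo g h p q U \<alpha> \<and>
     (\<exists>\<beta>. measurable_form X n E (U \<inter> Xo) p (Suc q) \<beta> \<and>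
        dbar_distr X n E (U \<inter> Xo) p q \<alpha> \<beta> \<and> square_integrable X n Xo g h p (Suc q) U \<beta>)}"

definition form_class ::
    "'a cspace \<Rightarrow> nat \<Rightarrow> ('a, 'e) vbundle \<Rightarrow> 'a set \<Rightarrow> nat \<Rightarrow> nat \<Rightarrow> ('a, 'e) form \<Rightarrow> ('a, 'e) form set" where
  "form_class X n E W p q \<alpha> = {\<beta>. measurable_form X n E W p q \<beta> \<and> ae_equal X n W \<alpha> \<beta>}"

text \<open>
  Data of a sheaf of \<open>\<O>\<close>-modules: sections, addition, multiplication by holomorphic functions and
  restriction from \<open>U\<close> to \<open>V\<close> (arguments in this order).
\<close>

record ('a, 's) module_sheaf =
  sections :: "'a set \<Rightarrow> 's set"
  sec_add :: "'a set \<Rightarrow> 's \<Rightarrow> 's \<Rightarrow> 's"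
  sec_scale :: "'a set \<Rightarrow> ('a \<Rightarrow> complex) \<Rightarrow> 's \<Rightarrow> 's"
  sec_restrict :: "'a set \<Rightarrow> 'a set \<Rightarrow> 's \<Rightarrow> 's"

text \<open>
  The kernel of \<open>dbar\<close> on \<open>\<D>\<^bsup>n,0\<^esup>\<close>. Forms that agree almost everywhere are identified, so a
  section is a class of forms.
\<close>

definition S_sheaf ::
    "'a cspace \<Rightarrow> nat \<Rightarrow> 'a set \<Rightarrow> ('a \<Rightarrow> 'a tangent \<Rightarrow> 'a tangent \<Rightarrow> complex) \<Rightarrow>
     ('a, 'e) vbundle \<Rightarrow> ('a \<Rightarrow> 'e \<Rightarrow> ennreal) \<Rightarrow> ('a, ('a, 'e) form set) module_sheaf" where
  "S_sheaf X n Xo g E h =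
     \<lparr>sections = (\<lambda>U. form_class X n E (U \<inter> Xo) n 0 `
        {\<alpha> \<in> L2_forms X n Xo E g h n 0 U.
           dbar_distr X n E (U \<inter> Xo) n 0 \<alpha> (mk_form X (U \<inter> Xo) n 1 (\<lambda>x vs ws. vb_zero E x))}),
      sec_add = (\<lambda>U c d. \<Union>\<alpha>\<in>c. \<Union>\<beta>\<in>d. form_class X n E (U \<inter> Xo) n 0
        (mk_form X (U \<inter> Xo) n 0 (\<lambda>x vs ws. vb_add E x (\<alpha> x vs ws) (\<beta> x vs ws)))),
      sec_scale = (\<lambda>U f c. \<Union>\<alpha>\<in>c. form_class X n E (U \<inter> Xo) n 0
        (mk_form X (U \<inter> Xo) n 0 (\<lambda>x vs ws. vb_scale E x (f x) (\<alpha> x vs ws)))),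
      sec_restrict = (\<lambda>U V c. \<Union>\<alpha>\<in>c. form_class X n E (V \<inter> Xo) n 0 (mk_form X (V \<inter> Xo) n 0 \<alpha>))\<rparr>"

definition direct_image ::
    "'b cspace \<Rightarrow> ('b \<Rightarrow> 'a) \<Rightarrow> ('b, 's) module_sheaf \<Rightarrow> ('a, 's) module_sheaf" where
  "direct_image Y f F =
     \<lparr>sections = (\<lambda>U. sections F (preim Y f U)),
      sec_add = (\<lambda>U. sec_add F (preim Y f U)),
      sec_scale = (\<lambda>U u. sec_scale F (preim Y f U) (u \<circ> f)),
      sec_restrict = (\<lambda>U V. sec_restrict F (preim Y f U) (preim Y f V))\<rparr>"

definition module_sheaf_iso ::
    "'a cspace \<Rightarrow> ('a, 's) module_sheaf \<Rightarrow> ('a, 't) module_sheaf \<Rightarrow> ('a set \<Rightarrow> 's \<Rightarrow> 't) \<Rightarrow> bool" where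
  "module_sheaf_iso X F G \<Phi> \<longleftrightarrow>
     (\<forall>U. openin (ctop X) U \<longrightarrow>
        bij_betw (\<Phi> U) (sections F U) (sections G U) \<and>
        (\<forall>s\<in>sections F U. \<forall>t\<in>sections F U.
           \<Phi> U (sec_add F U s t) = sec_add G U (\<Phi> U s) (\<Phi> U t)) \<and>
        (\<forall>f. \<forall>s\<in>sections F U. hol X U f \<longrightarrow>
           \<Phi> U (sec_scale F U f s) = sec_scale G U f (\<Phi> U s)) \<and>
        (\<forall>V. \<forall>s\<in>sections F U. openin (ctop X) V \<and> V \<subseteq> U \<longrightarrow>
           \<Phi> V (sec_restrict F U V s) = sec_restrict G U V (\<Phi> U s)))"

definition pullback_form ::
    "'b cspace \<Rightarrow> 'a cspace \<Rightarrow> ('b \<Rightarrow> 'a) \<Rightarrow> 'b set \<Rightarrow> nat \<Rightarrow> nat \<Rightarrow> ('a, 'e) form \<Rightarrow> ('b, 'e) form" where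
  "pullback_form Y X f W p q \<alpha> = mk_form Y W p q
     (\<lambda>y vs ws. \<alpha> (f y) (map (differential X f y) vs) (map (differential X f y) ws))"

text \<open>
  The pullback of forms along \<open>f\<close>, applied to the members of a class: the canonical
  identification of sections over \<open>U\<close> with sections over the preimage of \<open>U\<close>.
\<close>

definition pullback_sections ::
    "'b cspace \<Rightarrow> 'a cspace \<Rightarrow> ('b \<Rightarrow> 'a) \<Rightarrow> 'a set \<Rightarrow> nat \<Rightarrow> 'a set \<Rightarrow> ('a, 'e) form set \<Rightarrow> ('b, 'e) form set" where
  "pullback_sections Y X f Xo n U c = pullback_form Y X f (preim Y f U \<inter> preim Y f Xo) n 0 ` c"

end

theory Submission
  imports Defs "HOL-Complex_Analysis.Complex_Analysis"
begin

text \<open>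
  A section of \<open>S\<^sub>X(E,h)\<close> over \<open>U\<close> is a form on \<open>U \<inter> Xo\<close>, and \<open>\<pi>\<close> identifies \<open>Xo\<close> with its preimage. Hence
  pulling back forms is a bijection, with the pullback by the inverse map as its inverse, and it
  respects everything that is local on the manifold \<open>Xo\<close>: measurability, equality almost everywhere
  and the equation \<open>dbar \<alpha> = 0\<close>. In corresponding charts the coefficients of a form and of its
  pullback are equal functions (\<open>coef_pb\<close>).

  The integrability condition is different. It is imposed near all points of \<open>U\<close>, also outside \<open>Xo\<close>,
  and the metrics on the two sides are unrelated. Two facts deal with this.

  First, for a form of degree \<open>(n,0)\<close> the norm times the volume density does not depend on the metric:
  in a chart it is the squared norm of the value of the form on the coordinate frame
  (\<open>form_norm2_vol_density\<close>), because under a change of frame the form is multiplied by a determinant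
  (\<open>frame_change\<close>) and the Gram determinant by the inverse of its squared modulus. So the integrals
  over corresponding open sets agree (\<open>norm_integral_pb_le\<close>, for \<open>\<pi>\<close> and for its inverse).
  The frame in the definition of the norm is an arbitrary unitary frame of derivations; to compare it with
  the coordinate frame one has to know that the coordinate vectors span the space of derivations. This is
  \<open>tangent_vector_expansion\<close>, which comes from the Hadamard expansion of holomorphic functions of several
  variables (\<open>hadamard_expansion\<close>).

  Secondly, \<open>\<pi>\<close> is proper: a fibre is compact, so finitely many open sets over which the integral is
  finite cover it, and their union contains the preimage of a neighbourhood of the base point. By
  subadditivity of the integral the form is square integrable over that neighbourhood
  (\<open>square_integrable_pushforward\<close>). The other direction follows from the continuity of \<open>\<pi>\<close>.

  The sheaf of \<open>L\<^sup>2\<close> forms also asks for an \<open>L\<^sup>2\<close> derivative, of degree \<open>(n,1)\<close>, whose norm does depend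
  on the metric; but for sections of \<open>S\<^sub>X(E,h)\<close> the derivative is zero (\<open>dbar_closed_L2_forms\<close>).
\<close>

section \<open>Holomorphic functions of several variables\<close>

definition polydisc :: "nat \<Rightarrow> (nat \<Rightarrow> complex) \<Rightarrow> real \<Rightarrow> (nat \<Rightarrow> complex) set" where
  "polydisc N a r = (\<Pi>\<^sub>E i\<in>{..<N}. ball (a i) r)"

lemma topspace_Cn: "topspace (Cn N) = {..<N} \<rightarrow>\<^sub>E UNIV"
  by (simp add: Cn_def)

lemma fun_upd_in_Cn: "y \<in> topspace (Cn N) \<Longrightarrow> i < N \<Longrightarrow> y(i := t) \<in> topspace (Cn N)"
  by (auto simp: topspace_Cn PiE_iff extensional_def)

lemma polydisc_iff:
  "y \<in> polydisc N a r \<longleftrightarrow> y \<in> topspace (Cn N) \<and> (\<forall>i<N. dist (a i) (y i) < r)"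
  by (auto simp: polydisc_def topspace_Cn PiE_iff)

lemma openin_polydisc: "openin (Cn N) (polydisc N a r)"
  unfolding polydisc_def Cn_def by (subst openin_PiE) auto

lemma polydisc_centre: "a \<in> topspace (Cn N) \<Longrightarrow> 0 < r \<Longrightarrow> a \<in> polydisc N a r"
  by (simp add: polydisc_iff)

lemma openin_Cn_polydisc:
  assumes "openin (Cn N) B" "a \<in> B"
  shows "\<exists>r>0. polydisc N a r \<subseteq> B"
proof -
  obtain U where U: "\<forall>i\<in>{..<N}. open (U i)" "a \<in> Pi\<^sub>E {..<N} U" "Pi\<^sub>E {..<N} U \<subseteq> B"
    using assms unfolding Cn_def openin_product_topology_alt by auto
  have "\<forall>i\<in>{..<N}. \<exists>r>0. ball (a i) r \<subseteq> U i"
    using U by (meson PiE_mem open_contains_ball)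
  then obtain r where r: "\<forall>i\<in>{..<N}. r i > (0::real) \<and> ball (a i) (r i) \<subseteq> U i" by metis
  define m where "m = Min (insert 1 (r ` {..<N}))"
  have "m > 0" unfolding m_def using r by (subst Min_gr_iff) auto
  moreover have "m \<le> r i" if "i < N" for i unfolding m_def by (rule Min_le) (use that in auto)
  then have "polydisc N a m \<subseteq> Pi\<^sub>E {..<N} U"
    unfolding polydisc_def using r by (intro PiE_mono) (meson dual_order.trans lessThan_iff subset_ball)
  ultimately show ?thesis using U by blast
qed

lemma continuous_map_into_Cn:
  assumes "\<And>x. x \<in> topspace T \<Longrightarrow> f x \<in> topspace (Cn N)"
    and "\<And>i. i < N \<Longrightarrow> continuous_map T euclidean (\<lambda>x. f x i)"
  shows "continuous_map T (Cn N) f"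
  unfolding Cn_def continuous_map_componentwise using assms by (auto simp: topspace_Cn PiE_iff)

lemma continuous_map_Cn_coord: "i < N \<Longrightarrow> continuous_map (Cn N) euclidean (\<lambda>y. y i)"
  unfolding Cn_def using continuous_map_product_projection[of i "{..<N}" "\<lambda>_. euclidean"]
  by auto

lemma continuous_map_euclidean_eps:
  fixes f :: "'x \<Rightarrow> 'm::metric_space"
  assumes "\<And>x e. x \<in> topspace T \<Longrightarrow> e > 0 \<Longrightarrow>
    \<exists>U. openin T U \<and> x \<in> U \<and> (\<forall>y\<in>U. dist (f x) (f y) < e)"
  shows "continuous_map T euclidean f"
  unfolding continuous_map_eq_topcontinuous_at topcontinuous_at_def
proof (intro ballI conjI allI impI)
  fix x V assume x: "x \<in> topspace T" and V: "openin euclidean V \<and> f x \<in> V"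
  then obtain e where e: "e > 0" "ball (f x) e \<subseteq> V" by (auto simp: open_contains_ball)
  from assms[OF x e(1)] e(2) show "\<exists>U. openin T U \<and> x \<in> U \<and> (\<forall>y\<in>U. f y \<in> V)"
    by (meson mem_ball subsetD)
qed auto

lemma holo_slice:
  assumes "holo N D F" "i < N" "\<And>t. t \<in> T \<Longrightarrow> y(i := t) \<in> D"
  shows "(\<lambda>t. F (y(i := t))) holomorphic_on T"
  unfolding holomorphic_on_def
proof
  fix t assume "t \<in> T"
  then have "(\<lambda>s. F ((y(i := t))(i := s))) field_differentiable (at ((y(i := t)) i))"
    using assms unfolding holo_def by blast
  then show "(\<lambda>t. F (y(i := t))) field_differentiable (at t within T)"
    by (simp add: field_differentiable_at_within)
qed

lemma holo_subset: "holo N D F \<Longrightarrow> D' \<subseteq> D \<Longrightarrow> holo N D' F"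
  unfolding holo_def by (meson continuous_map_from_subtopology_mono subsetD)

lemma open_slice:
  assumes "openin (Cn N) D" "y \<in> topspace (Cn N)" "i < N"
  shows "open {t. y(i := t) \<in> D}"
proof -
  have "continuous_map euclidean (Cn N) (\<lambda>t. y(i := t))"
    by (rule continuous_map_into_Cn) (use assms fun_upd_in_Cn in auto)
  from openin_continuous_map_preimage[OF this assms(1)] show ?thesis by simp
qed

lemma eventually_slice:
  assumes "openin (Cn N) D" "y \<in> D" "i < N"
  shows "eventually (\<lambda>t. y(i := t) \<in> D) (nhds (y i))"
proof -
  have "y \<in> topspace (Cn N)" using assms openin_subset by blast
  from open_slice[OF assms(1) this assms(3)] show ?thesis
    unfolding eventually_nhds using assms by (intro exI[of _ "{t. y(i := t) \<in> D}"]) auto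
qed

lemma holo_cong:
  assumes "openin (Cn N) D" "\<And>y. y \<in> D \<Longrightarrow> F y = G y" "holo N D F"
  shows "holo N D G"
  unfolding holo_def
proof (intro conjI ballI allI impI)
  show "continuous_map (subtopology (Cn N) D) euclidean G"
    using assms continuous_map_eq[of "subtopology (Cn N) D" euclidean F G]
    by (auto simp: holo_def)
  fix y i assume y: "y \<in> D" and i: "i < N"
  have ev: "eventually (\<lambda>t. F (y(i := t)) = G (y(i := t))) (nhds (y i))"
    using eventually_slice[OF assms(1) y i] by eventually_elim (use assms in auto)
  have "(\<lambda>t. F (y(i := t))) field_differentiable (at (y i))"
    using assms y i by (auto simp: holo_def)
  then show "(\<lambda>t. G (y(i := t))) field_differentiable (at (y i))"
    unfolding field_differentiable_def
    using DERIV_cong_ev[OF refl ev refl] by blast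
qed

lemma holo_const: "holo N D (\<lambda>_. c)"
  by (simp add: holo_def)

lemma holo_coord: assumes "i < N" shows "holo N D (\<lambda>y. y i)"
  unfolding holo_def
proof (intro conjI ballI allI impI)
  show "continuous_map (subtopology (Cn N) D) euclidean (\<lambda>y. y i)"
    by (simp add: assms continuous_map_Cn_coord continuous_map_from_subtopology)
  fix y k show "(\<lambda>t. (y(k := t)) i) field_differentiable at (y k)"
    by (cases "k = i") (auto intro: derivative_intros)
qed

lemma holo_add: "holo N D F \<Longrightarrow> holo N D G \<Longrightarrow> holo N D (\<lambda>y. F y + G y)"
  unfolding holo_def by (auto intro!: continuous_map_add derivative_intros)

lemma continuous_map_mult_complex:
  fixes f g :: "'x \<Rightarrow> complex"
  assumes "continuous_map T euclidean f" "continuous_map T euclidean g"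
  shows "continuous_map T euclidean (\<lambda>x. f x * g x)"
  using assms by (simp add: continuous_map_atin limitin_canonical_iff tendsto_mult)

lemma holo_mult: "holo N D F \<Longrightarrow> holo N D G \<Longrightarrow> holo N D (\<lambda>y. F y * G y)"
  unfolding holo_def by (auto intro!: continuous_map_mult_complex derivative_intros)

text \<open>
  Compactness of \<open>C\<close> (the tube lemma) makes the continuity of \<open>F (y(i := t))\<close> in \<open>y\<close> uniform in
  \<open>t \<in> C\<close>. It serves twice: for the continuity of difference quotients and for their locally uniform
  convergence to a derivative.
\<close>

lemma uniform_slice_close:
  assumes P: "openin (Cn N) P" and F: "continuous_map (subtopology (Cn N) P) euclidean F"
    and y0: "y0 \<in> topspace (Cn N)" and i: "i < N" and C: "compact C"
    and sub: "\<And>t. t \<in> C \<Longrightarrow> y0(i := t) \<in> P" and e: "(e::real) > 0"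
  shows "\<exists>V. openin (Cn N) V \<and> y0 \<in> V \<and>
    (\<forall>y\<in>V. \<forall>t\<in>C. y(i := t) \<in> P \<and> dist (F (y0(i := t))) (F (y(i := t)) :: complex) < e)"
proof -
  let ?T = "prod_topology (Cn N) (euclidean :: complex topology)"
  let ?W0 = "{p \<in> topspace ?T. (fst p)(i := snd p) \<in> P \<and> y0(i := snd p) \<in> P}"
  have c1: "continuous_map ?T (Cn N) (\<lambda>p. (fst p)(i := snd p))"
  proof (rule continuous_map_into_Cn)
    fix k assume k: "k < N"
    show "continuous_map ?T euclidean (\<lambda>p. ((fst p)(i := snd p)) k)"
    proof (cases "k = i")
      case True then show ?thesis by (simp add: continuous_map_snd)
    next
      case False
      have "continuous_map ?T euclidean ((\<lambda>y. y k) \<circ> fst)"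
        by (rule continuous_map_compose[OF continuous_map_fst continuous_map_Cn_coord[OF k]])
      then show ?thesis using False by (simp add: o_def)
    qed
  qed (use i fun_upd_in_Cn in auto)
  have c2: "continuous_map ?T (Cn N) (\<lambda>p. y0(i := snd p))"
  proof (rule continuous_map_into_Cn)
    fix k assume k: "k < N"
    show "continuous_map ?T euclidean (\<lambda>p. (y0(i := snd p)) k)"
      by (cases "k = i") (simp_all add: continuous_map_snd)
  qed (use i y0 fun_upd_in_Cn in auto)
  have W0: "openin ?T ?W0"
    using openin_Int[OF openin_continuous_map_preimage[OF c1 P] openin_continuous_map_preimage[OF c2 P]]
    by (rule back_subst[of "openin ?T"]) auto
  have d1: "continuous_map (subtopology ?T ?W0) euclidean (\<lambda>p. F ((fst p)(i := snd p)))"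
  proof -
    have "continuous_map (subtopology ?T ?W0) (subtopology (Cn N) P) (\<lambda>p. (fst p)(i := snd p))"
      using c1 by (auto simp: continuous_map_in_subtopology continuous_map_from_subtopology)
    from continuous_map_compose[OF this F] show ?thesis by (simp add: o_def)
  qed
  have d2: "continuous_map (subtopology ?T ?W0) euclidean (\<lambda>p. F (y0(i := snd p)))"
  proof -
    have "continuous_map (subtopology ?T ?W0) (subtopology (Cn N) P) (\<lambda>p. y0(i := snd p))"
      using c2 by (auto simp: continuous_map_in_subtopology continuous_map_from_subtopology)
    from continuous_map_compose[OF this F] show ?thesis by (simp add: o_def)
  qed
  have d3: "continuous_map (subtopology ?T ?W0) euclidean
      (\<lambda>p. F (y0(i := snd p)) - F ((fst p)(i := snd p)))"
    by (rule continuous_map_diff[OF d2 d1])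
  have "openin (subtopology ?T ?W0)
     {p \<in> topspace (subtopology ?T ?W0). (F (y0(i := snd p)) - F ((fst p)(i := snd p))) \<in> ball 0 e}"
    by (rule openin_continuous_map_preimage[OF d3]) simp
  then have W: "openin ?T
     {p \<in> topspace (subtopology ?T ?W0). (F (y0(i := snd p)) - F ((fst p)(i := snd p))) \<in> ball 0 e}"
     (is "openin ?T ?W")
    using W0 openin_trans_full by blast
  have "{y0} \<times> C \<subseteq> ?W" using sub y0 e by auto
  from tube_lemma_right[OF W _ y0 this] C
  obtain U V where UV: "openin (Cn N) U" "y0 \<in> U" "C \<subseteq> V" "U \<times> V \<subseteq> ?W" by auto
  show ?thesis
  proof (intro exI[of _ U] conjI ballI)
    fix y t assume "y \<in> U" "t \<in> C"
    then have "(y, t) \<in> ?W" using UV by blast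
    then show "y(i := t) \<in> P" "dist (F (y0(i := t))) (F (y(i := t))) < e"
      by (auto simp: dist_norm norm_minus_commute)
  qed (use UV in auto)
qed

text \<open>
  The difference quotient in the \<open>i\<close>-th variable with base point \<open>a i\<close>, extended by the derivative
  across the hyperplane \<open>y i = a i\<close>.
\<close>

definition diff_quot ::
    "((nat \<Rightarrow> complex) \<Rightarrow> complex) \<Rightarrow> (nat \<Rightarrow> complex) \<Rightarrow> nat \<Rightarrow> (nat \<Rightarrow> complex) \<Rightarrow> complex" where
  "diff_quot F a i y = (if y i = a i then deriv (\<lambda>t. F (y(i := t))) (a i)
     else (F y - F (y(i := a i))) / (y i - a i))"

lemma diff_quot_slice:
  "diff_quot F a i (y(i := t)) = (if t = a i then deriv (\<lambda>t. F (y(i := t))) (a i)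
     else (F (y(i := t)) - F (y(i := a i))) / (t - a i))"
  by (simp add: diff_quot_def)

lemma polydisc_upd:
  "y \<in> polydisc N a r \<Longrightarrow> i < N \<Longrightarrow> y(i := t) \<in> polydisc N a r \<longleftrightarrow> t \<in> ball (a i) r"
  by (auto simp: polydisc_iff fun_upd_in_Cn)

lemma polydisc_radius_pos: "y \<in> polydisc N a r \<Longrightarrow> i < N \<Longrightarrow> 0 < r"
  by (meson le_less_trans polydisc_iff zero_le_dist)

lemma diff_quot_slice_holomorphic:
  assumes F: "holo N (polydisc N a r) F" and i: "i < N" and y: "y \<in> polydisc N a r"
  shows "(\<lambda>t. diff_quot F a i (y(i := t))) holomorphic_on ball (a i) r"
proof (rule pole_theorem_open_0)
  have h: "(\<lambda>t. F (y(i := t))) holomorphic_on ball (a i) r"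
    by (rule holo_slice[OF F i]) (simp add: polydisc_upd[OF y i])
  show "(\<lambda>t. F (y(i := t)) - F (y(i := a i))) holomorphic_on ball (a i) r"
    by (intro holomorphic_intros h)
  have "a i \<in> ball (a i) r" using polydisc_radius_pos[OF y i] by simp
  then have "(\<lambda>t. F (y(i := t))) field_differentiable at (a i)"
    using h holomorphic_on_imp_differentiable_at by blast
  then show "diff_quot F a i (y(i := a i)) = deriv (\<lambda>t. F (y(i := t)) - F (y(i := a i))) (a i)"
    by (simp add: diff_quot_slice deriv_diff)
qed (auto simp: diff_quot_slice)

text \<open>
  As a function of the \<open>i\<close>-th variable alone the quotient is holomorphic, so by the maximum modulus
  principle its dependence on the other variables is controlled by its values on a circle around
  \<open>a i\<close>, where the denominator has constant modulus.
\<close>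

lemma continuous_map_diff_quot:
  assumes F: "holo N (polydisc N a r) F" and i: "i < N"
  shows "continuous_map (subtopology (Cn N) (polydisc N a r)) euclidean (diff_quot F a i)"
proof (rule continuous_map_euclidean_eps)
  let ?P = "polydisc N a r"
  fix y0 and e :: real assume "y0 \<in> topspace (subtopology (Cn N) ?P)" and e: "e > 0"
  then have y0: "y0 \<in> ?P" "y0 \<in> topspace (Cn N)" by auto
  then have "dist (a i) (y0 i) < r" using i by (auto simp: polydisc_iff)
  \<comment> \<open>The radius of the circle: it encloses \<open>y0 i\<close> and stays inside the polydisc.\<close>
  then obtain \<rho> where \<rho>: "dist (a i) (y0 i) < \<rho>" "\<rho> < r" using dense by blast
  have \<rho>0: "\<rho> > 0" using \<rho>(1) by (rule le_less_trans[OF zero_le_dist])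
  let ?C = "sphere (a i) \<rho> \<union> {a i}"
  have C: "compact ?C" by (intro compact_Un) auto
  have subC: "y0(i := t) \<in> ?P" if "t \<in> ?C" for t
    using that \<rho> \<rho>0 by (auto simp: polydisc_upd[OF y0(1) i])
  have "e * \<rho> / 8 > 0" using e \<rho>0 by simp
  from uniform_slice_close[OF openin_polydisc _ y0(2) i C subC this] F
  obtain V where V: "openin (Cn N) V" "y0 \<in> V"
    "\<And>y t. y \<in> V \<Longrightarrow> t \<in> ?C \<Longrightarrow> dist (F (y0(i := t))) (F (y(i := t))) < e * \<rho> / 8"
    unfolding holo_def by metis
  let ?q = "\<lambda>y t. diff_quot F a i (y(i := t))"
  have close: "norm (?q y t - ?q y0 t) \<le> e / 4" if y: "y \<in> V" "y \<in> ?P" and t: "t \<in> cball (a i) \<rho>" for y t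
  proof (rule maximum_modulus_frontier[where S = "cball (a i) \<rho>" and f = "\<lambda>t. ?q y t - ?q y0 t" and \<xi> = t])
    have hol: "(\<lambda>t. ?q y t - ?q y0 t) holomorphic_on ball (a i) r"
      by (intro holomorphic_on_diff diff_quot_slice_holomorphic[OF F i] y y0)
    show "(\<lambda>t. ?q y t - ?q y0 t) holomorphic_on interior (cball (a i) \<rho>)"
      by (rule holomorphic_on_subset[OF hol]) (use \<rho> in auto)
    show "continuous_on (closure (cball (a i) \<rho>)) (\<lambda>t. ?q y t - ?q y0 t)"
      by (rule continuous_on_subset[OF holomorphic_on_imp_continuous_on[OF hol]]) (use \<rho> in auto)
    fix s assume "s \<in> frontier (cball (a i) \<rho>)"
    then have s: "dist (a i) s = \<rho>" using \<rho>0 by auto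
    then have ne: "s \<noteq> a i" using \<rho>0 by auto
    have n: "norm (s - a i) = \<rho>" using s by (simp add: dist_norm norm_minus_commute)
    let ?A = "F (y0(i := a i)) - F (y(i := a i))" and ?B = "F (y0(i := s)) - F (y(i := s))"
    have "?q y s - ?q y0 s = (?A - ?B) / (s - a i)"
      unfolding diff_quot_slice if_not_P[OF ne] diff_divide_distrib[symmetric] by (simp add: algebra_simps)
    then have "norm (?q y s - ?q y0 s) = norm (?A - ?B) / \<rho>"
      by (simp only: norm_divide n)
    also have "\<dots> \<le> (e * \<rho> / 8 + e * \<rho> / 8) / \<rho>"
    proof (rule divide_right_mono)
      have "norm ?A < e * \<rho> / 8" "norm ?B < e * \<rho> / 8"
        using V(3)[OF y(1), of "a i"] V(3)[OF y(1), of s] s by (auto simp flip: dist_norm)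
      then show "norm (?A - ?B) \<le> e * \<rho> / 8 + e * \<rho> / 8"
        using norm_triangle_ineq4[of ?A ?B] by linarith
    qed (use \<rho>0 in simp)
    also have "\<dots> = e / 4" using \<rho>0 by simp
    finally show "norm (?q y s - ?q y0 s) \<le> e / 4" .
  qed (use t in auto)
  have "isCont (?q y0) (y0 i)"
    using diff_quot_slice_holomorphic[OF F i y0(1)] \<rho>
    by (meson continuous_on_eq_continuous_at holomorphic_on_imp_continuous_on mem_ball open_ball order_less_trans)
  then obtain \<delta> where \<delta>: "\<delta> > 0" "\<And>t. dist t (y0 i) < \<delta> \<Longrightarrow> dist (?q y0 t) (?q y0 (y0 i)) < e / 2"
    using e unfolding continuous_at_eps_delta by (metis half_gt_zero)
  let ?U = "V \<inter> ?P \<inter> {y \<in> topspace (Cn N). y i \<in> ball (y0 i) \<delta> \<inter> ball (a i) \<rho>}"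
  have U: "openin (Cn N) ?U"
    by (intro openin_Int V openin_polydisc openin_continuous_map_preimage[OF continuous_map_Cn_coord[OF i]]) auto
  show "\<exists>U. openin (subtopology (Cn N) ?P) U \<and> y0 \<in> U \<and>
      (\<forall>y\<in>U. dist (diff_quot F a i y0) (diff_quot F a i y) < e)"
  proof (intro exI[of _ ?U] conjI ballI)
    show "openin (subtopology (Cn N) ?P) ?U"
      using U by (meson Int_lower2 le_inf_iff openin_subset_topspace_eq openin_subtopology_Int2 openin_subtopology openin_open_subtopology openin_polydisc inf_le1)
    show "y0 \<in> ?U" using V y0 \<delta> \<rho> by auto
    fix y assume y: "y \<in> ?U"
    have "norm (?q y (y i) - ?q y0 (y i)) \<le> e / 4" by (rule close) (use y in auto)
    moreover have "dist (?q y0 (y i)) (?q y0 (y0 i)) < e / 2"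
      by (rule \<delta>) (use y in \<open>auto simp: dist_commute\<close>)
    ultimately have "dist (?q y0 (y0 i)) (?q y (y i)) < e"
      using e dist_triangle[of "?q y0 (y0 i)" "?q y (y i)" "?q y0 (y i)"]
      by (simp add: dist_norm norm_minus_commute)
    then show "dist (diff_quot F a i y0) (diff_quot F a i y) < e" by simp
  qed
qed

lemma holo_diff_quot:
  assumes F: "holo N (polydisc N a r) F" and i: "i < N"
  shows "holo N (polydisc N a r) (diff_quot F a i)"
  unfolding holo_def
proof (intro conjI ballI allI impI)
  let ?P = "polydisc N a r" let ?Q = "diff_quot F a i"
  show cont: "continuous_map (subtopology (Cn N) ?P) euclidean ?Q"
    by (rule continuous_map_diff_quot[OF F i])
  fix y k assume y: "y \<in> ?P" and k: "k < N"
  have yt: "y \<in> topspace (Cn N)" using y by (simp add: polydisc_iff)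
  have ai: "a i \<in> ball (a i) r" and yk: "y k \<in> ball (a k) r" and yi: "y i \<in> ball (a i) r"
    using y i k polydisc_radius_pos[OF y i] by (auto simp: polydisc_iff)
  consider "k = i" | "k \<noteq> i" "y i \<noteq> a i" | "k \<noteq> i" "y i = a i" by blast
  then show "(\<lambda>t. ?Q (y(k := t))) field_differentiable at (y k)"
  proof cases
    case 1
    then show ?thesis
      using diff_quot_slice_holomorphic[OF F i y] yi holomorphic_on_imp_differentiable_at by blast
  next
    case 2
    have y': "y(i := a i) \<in> ?P" using ai by (simp add: polydisc_upd[OF y i])
    have "(\<lambda>t. F (y(k := t))) field_differentiable at (y k)"
      using F y k by (auto simp: holo_def)
    moreover have "(\<lambda>t. F ((y(i := a i))(k := t))) field_differentiable at ((y(i := a i)) k)"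
      using F y' k unfolding holo_def by blast
    ultimately have "(\<lambda>t. (F (y(k := t)) - F ((y(i := a i))(k := t))) / (y i - a i))
        field_differentiable at (y k)"
      using 2 by (intro derivative_intros) auto
    moreover have "(\<lambda>t. (F (y(k := t)) - F ((y(i := a i))(k := t))) / (y i - a i)) = (\<lambda>t. ?Q (y(k := t)))"
      using 2 by (auto simp: diff_quot_def fun_upd_twist)
    ultimately show ?thesis by simp
  next
    case 3
    define e where "e = (r - dist (a k) (y k)) / 2"
    have e: "e > 0" using yk by (simp add: e_def)
    have cb: "t \<in> ball (a k) r" if "t \<in> cball (y k) e" for t
      using that yk dist_triangle[of "a k" t "y k"] by (auto simp: e_def)
    \<comment> \<open>On the hyperplane the quotient is the uniform limit of its values off the hyperplane.\<close>
    have ul: "uniform_limit (cball (y k) e) (\<lambda>s t. ?Q ((y(i := s))(k := t)))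
        (\<lambda>t. ?Q (y(k := t))) (at (a i))"
      unfolding uniform_limit_iff
    proof (intro allI impI)
      fix \<epsilon> :: real assume \<epsilon>: "\<epsilon> > 0"
      have sub: "y(k := t) \<in> ?P" if "t \<in> cball (y k) e" for t
        using cb[OF that] by (simp add: polydisc_upd[OF y k])
      obtain V where V: "openin (Cn N) V" "y \<in> V" and V':
        "\<forall>x\<in>V. \<forall>t\<in>cball (y k) e. x(k := t) \<in> ?P \<and> dist (?Q (y(k := t))) (?Q (x(k := t))) < \<epsilon>"
        using uniform_slice_close[OF openin_polydisc cont yt k compact_cball[of "y k" e] sub \<epsilon>] by blast
      have "eventually (\<lambda>s. y(i := s) \<in> V) (at (a i))"
        using eventually_slice[OF V(1,2) i] 3 by (auto simp: eventually_at_filter elim: eventually_mono)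
      then show "\<forall>\<^sub>F s in at (a i). \<forall>t\<in>cball (y k) e. dist (?Q ((y(i := s))(k := t))) (?Q (y(k := t))) < \<epsilon>"
        by eventually_elim (use V' in \<open>metis dist_commute\<close>)
    qed
    have "eventually (\<lambda>s. s \<in> ball (a i) r) (at (a i))"
      using ai by (intro eventually_at_in_open'[of "ball (a i) r"]) auto
    moreover have "eventually (\<lambda>s. s \<noteq> a i) (at (a i))"
      by (simp add: eventually_at_filter)
    ultimately have ev: "\<forall>\<^sub>F s in at (a i). continuous_on (cball (y k) e) (\<lambda>t. ?Q ((y(i := s))(k := t))) \<and>
        (\<lambda>t. ?Q ((y(i := s))(k := t))) holomorphic_on ball (y k) e"
    proof eventually_elim
      case (elim s)
      have ys: "y(i := s) \<in> ?P" "y(i := a i) \<in> ?P"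
        using elim ai by (simp_all add: polydisc_upd[OF y i])
      have "(\<lambda>t. (F ((y(i := s))(k := t)) - F ((y(i := a i))(k := t))) / (s - a i)) holomorphic_on ball (a k) r"
        by (intro holomorphic_intros holo_slice[OF F k]) (use elim polydisc_upd[OF ys(1) k] polydisc_upd[OF ys(2) k] in auto)
      moreover have "(\<lambda>t. (F ((y(i := s))(k := t)) - F ((y(i := a i))(k := t))) / (s - a i)) =
          (\<lambda>t. ?Q ((y(i := s))(k := t)))"
        using elim 3 by (intro ext) (simp add: diff_quot_def fun_upd_twist[of i k])
      ultimately have h: "(\<lambda>t. ?Q ((y(i := s))(k := t))) holomorphic_on ball (a k) r" by simp
      have "cball (y k) e \<subseteq> ball (a k) r" "ball (y k) e \<subseteq> ball (a k) r"
        using cb ball_subset_cball by blast+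
      then show ?case
        using holomorphic_on_subset[OF h] continuous_on_subset[OF holomorphic_on_imp_continuous_on[OF h]]
        by blast
    qed
    have "(\<lambda>t. ?Q (y(k := t))) holomorphic_on ball (y k) e"
      by (rule holomorphic_uniform_limit[OF ev ul]) auto
    then show ?thesis using e by (meson centre_in_ball holomorphic_on_imp_differentiable_at open_ball)
  qed
qed

text \<open>
  Freezing the first coordinates at \<open>a\<close> gives the intermediate points at which the Hadamard expansion
  telescopes.
\<close>

lemma holo_freeze_coords:
  assumes F: "holo N (polydisc N a r) F"
  shows "holo N (polydisc N a r) (\<lambda>y. F (\<lambda>j. if j < i \<and> j < N then a j else y j))"
proof -
  let ?P = "polydisc N a r"
  let ?S = "\<lambda>y j. if j < i \<and> j < N then a j else y j"
  have SP: "?S y \<in> ?P" if "y \<in> ?P" for y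
    using that polydisc_radius_pos[OF that] unfolding polydisc_iff topspace_Cn
    by (auto simp: PiE_iff extensional_def)
  have "continuous_map (subtopology (Cn N) ?P) (Cn N) ?S"
  proof (rule continuous_map_into_Cn)
    fix k assume "k < N"
    then show "continuous_map (subtopology (Cn N) ?P) euclidean (\<lambda>x. ?S x k)"
      by (cases "k < i") (simp_all add: continuous_map_Cn_coord continuous_map_from_subtopology)
  qed (use SP polydisc_iff in auto)
  then have "continuous_map (subtopology (Cn N) ?P) (subtopology (Cn N) ?P) ?S"
    using SP by (auto simp: continuous_map_in_subtopology)
  then have c: "continuous_map (subtopology (Cn N) ?P) euclidean (\<lambda>y. F (?S y))"
    using continuous_map_compose F unfolding holo_def o_def by blast
  show ?thesis unfolding holo_def
  proof (intro conjI c ballI allI impI)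
    fix y k assume y: "y \<in> ?P" and k: "k < N"
    show "(\<lambda>t. F (?S (y(k := t)))) field_differentiable at (y k)"
    proof (cases "k < i")
      case True
      then have "?S (y(k := t)) = ?S y" for t using k by auto
      then show ?thesis by simp
    next
      case False
      then have eq: "?S (y(k := t)) = (?S y)(k := t)" for t by auto
      have "(\<lambda>t. F ((?S y)(k := t))) field_differentiable at (?S y k)"
        using F SP[OF y] k unfolding holo_def by blast
      then show ?thesis using False unfolding eq by simp
    qed
  qed
qed

text \<open>
  Passing from \<open>y\<close> to \<open>a\<close> one coordinate at a time writes \<open>F y - F a\<close> as a telescoping sum, whose
  \<open>i\<close>-th term is \<open>y i - a i\<close> times the difference quotient of \<open>F\<close> in the \<open>i\<close>-th variable, taken with
  the coordinates before \<open>i\<close> already frozen.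
\<close>

lemma hadamard_expansion:
  assumes B: "openin (Cn N) B" and F: "holo N B F" and a: "a \<in> B"
  shows "\<exists>B' G. openin (Cn N) B' \<and> a \<in> B' \<and> B' \<subseteq> B \<and> (\<forall>i<N. holo N B' (G i)) \<and>
     (\<forall>i<N. G i a = deriv (\<lambda>t. F (a(i := t))) (a i)) \<and>
     (\<forall>y\<in>B'. F y = F a + (\<Sum>i<N. (y i - a i) * G i y))"
proof -
  from openin_Cn_polydisc[OF B a] obtain r where r: "r > 0" "polydisc N a r \<subseteq> B" by blast
  let ?P = "polydisc N a r"
  have at: "a \<in> topspace (Cn N)" using a B openin_subset by blast
  have FP: "holo N ?P F" using F r holo_subset by blast
  define S where "S = (\<lambda>i y j. if j < i \<and> j < N then a j else y j :: complex)"
  define G where "G = (\<lambda>i y. diff_quot F a i (S i y))"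
  have h: "holo N ?P (G i)" if "i < N" for i
    unfolding G_def S_def by (rule holo_freeze_coords[OF holo_diff_quot[OF FP that]])
  have d: "G i a = deriv (\<lambda>t. F (a(i := t))) (a i)" if "i < N" for i
  proof -
    have "S i a = a" by (auto simp: S_def)
    then show ?thesis by (simp add: G_def diff_quot_def)
  qed
  have e: "F y = F a + (\<Sum>i<N. (y i - a i) * G i y)" if y: "y \<in> ?P" for y
  proof -
    have "(y i - a i) * G i y = F (S i y) - F (S (Suc i) y)" if "i < N" for i
    proof -
      have "S (Suc i) y = (S i y)(i := a i)" using that by (auto simp: S_def)
      moreover have "S i y i = y i" by (simp add: S_def)
      ultimately show ?thesis
        by (cases "y i = a i") (auto simp: G_def diff_quot_def fun_upd_idem)
    qed
    then have "(\<Sum>i<N. (y i - a i) * G i y) = (\<Sum>i<N. F (S i y) - F (S (Suc i) y))" by simp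
    also have "\<dots> = F (S 0 y) - F (S N y)" by (rule sum_lessThan_telescope')
    also have "S 0 y = y" by (simp add: S_def)
    also have "S N y = a"
    proof
      fix j show "S N y j = a j"
        using y at by (cases "j < N") (auto simp: S_def polydisc_iff topspace_Cn PiE_iff extensional_def)
    qed
    finally show ?thesis by simp
  qed
  show ?thesis
    by (intro exI[of _ ?P] exI[of _ G] conjI allI ballI impI h d e)
      (use r polydisc_centre[OF at r(1)] openin_polydisc[of N a r] in blast)+
qed

section \<open>Charts and tangent vectors\<close>

lemma chart_open: "chart X n V z \<Longrightarrow> openin (ctop X) V"
  by (simp add: chart_def local_model_def)

lemma chart_open_image: "chart X n V z \<Longrightarrow> openin (Cn n) (z ` V)"
  by (simp add: chart_def)

lemma chart_homeo:
  "chart X n V z \<Longrightarrow> homeomorphic_map (subtopology (ctop X) V) (subtopology (Cn n) (z ` V)) z"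
  by (simp add: chart_def local_model_def)

lemma chart_hol_iff:
  assumes "chart X n V z" "openin (ctop X) W" "W \<subseteq> V"
  shows "hol X W f \<longleftrightarrow> (\<forall>x\<in>W. \<exists>B F. openin (Cn n) B \<and> z x \<in> B \<and> holo n B F \<and>
              (\<forall>x'\<in>W. z x' \<in> B \<longrightarrow> f x' = F (z x')))"
  using assms unfolding chart_def local_model_def by blast

lemma chart_topspace: "chart X n V z \<Longrightarrow> topspace (subtopology (ctop X) V) = V"
  by (simp add: openin_subset[OF chart_open] Int_absorb1)

lemma chart_inj: assumes "chart X n V z" shows "inj_on z V"
  using homeomorphic_imp_injective_map[OF chart_homeo[OF assms]] chart_topspace[OF assms] by simp

lemma chart_image_open:
  assumes "chart X n V z" "openin (ctop X) W" "W \<subseteq> V"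
  shows "openin (Cn n) (z ` W)"
proof -
  have "openin (subtopology (ctop X) V) W"
    using assms by (simp add: chart_open openin_open_subtopology)
  then have "openin (subtopology (Cn n) (z ` V)) (z ` W)"
    using homeomorphic_imp_open_map[OF chart_homeo[OF assms(1)]] by (simp add: open_map_def)
  then show ?thesis using chart_open_image[OF assms(1)] openin_trans_full by blast
qed

lemma chart_vimage_open:
  assumes "chart X n V z" "openin (Cn n) S"
  shows "openin (ctop X) {x\<in>V. z x \<in> S}"
proof -
  have "continuous_map (subtopology (ctop X) V) (Cn n) z"
    using homeomorphic_imp_continuous_map[OF chart_homeo[OF assms(1)]]
    by (simp add: continuous_map_in_subtopology)
  from openin_continuous_map_preimage[OF this assms(2)]
  have "openin (subtopology (ctop X) V) {x\<in>V. z x \<in> S}" unfolding chart_topspace[OF assms(1)] .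
  then show ?thesis using chart_open[OF assms(1)] openin_trans_full by blast
qed

lemma chart_in_Cn: "chart X n V z \<Longrightarrow> x \<in> V \<Longrightarrow> z x \<in> topspace (Cn n)"
  using openin_subset[OF chart_open_image] by blast

lemma chart_restrict:
  assumes "chart X n V z" "openin (ctop X) W" "W \<subseteq> V"
  shows "chart X n W z"
proof -
  have im: "openin (Cn n) (z ` W)" by (rule chart_image_open[OF assms])
  have "homeomorphic_map (subtopology (subtopology (ctop X) V) W)
      (subtopology (subtopology (Cn n) (z ` V)) (z ` W)) z"
  proof (rule homeomorphic_map_subtopologies[OF chart_homeo[OF assms(1)]])
    show "z ` (topspace (subtopology (ctop X) V) \<inter> W) = topspace (subtopology (Cn n) (z ` V)) \<inter> z ` W"
      using assms(3) chart_in_Cn[OF assms(1)] chart_topspace[OF assms(1)] by auto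
  qed
  then have "homeomorphic_map (subtopology (ctop X) W) (subtopology (Cn n) (z ` W)) z"
    using assms(3) by (simp add: subtopology_subtopology Int_absorb1 image_mono)
  moreover have "\<exists>D \<F>. openin (Cn n) D \<and> finite \<F> \<and> (\<forall>F\<in>\<F>. holo n D F) \<and>
        z ` W = {y\<in>D. \<forall>F\<in>\<F>. F y = 0}"
    by (rule exI[of _ "z ` W"], rule exI[of _ "{}"]) (simp add: im)
  moreover have "\<forall>W' f. openin (ctop X) W' \<and> W' \<subseteq> W \<longrightarrow>
        (hol X W' f \<longleftrightarrow> (\<forall>x\<in>W'. \<exists>B F. openin (Cn n) B \<and> z x \<in> B \<and> holo n B F \<and>
              (\<forall>x'\<in>W'. z x' \<in> B \<longrightarrow> f x' = F (z x'))))"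
    using chart_hol_iff[OF assms(1)] assms(3) by (meson order_trans)
  ultimately show ?thesis unfolding chart_def local_model_def using assms(2) im by blast
qed

text \<open>
  Germs of the structure sheaf are turned into holomorphic functions on open subsets of \<open>\<complex>\<^sup>n\<close>, for
  which the results above are available.
\<close>

lemma hol_near_chart:
  assumes fs: "function_sheaf X" and ch: "chart X n V z" and x: "x \<in> V"
  shows "hol_near X x f \<longleftrightarrow>
    (\<exists>B. openin (Cn n) B \<and> z x \<in> B \<and> B \<subseteq> z ` V \<and> holo n B (\<lambda>y. f (inv_into V z y)))"
proof
  assume "hol_near X x f"
  then obtain U where U: "openin (ctop X) U" "x \<in> U" "hol X U f" by (auto simp: hol_near_def)
  have W: "openin (ctop X) (U \<inter> V)" using U chart_open[OF ch] by blast
  have "hol X (U \<inter> V) f" using fs U W unfolding function_sheaf_def by (meson Int_lower1)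
  then obtain B F where B: "openin (Cn n) B" "z x \<in> B" "holo n B F"
      "\<forall>x'\<in>U \<inter> V. z x' \<in> B \<longrightarrow> f x' = F (z x')"
    using chart_hol_iff[OF ch W] U x by blast
  have o: "openin (Cn n) (B \<inter> z ` (U \<inter> V))" using B chart_image_open[OF ch W] by blast
  have "holo n (B \<inter> z ` (U \<inter> V)) (\<lambda>y. f (inv_into V z y))"
  proof (rule holo_cong[OF o])
    show "holo n (B \<inter> z ` (U \<inter> V)) F" using B(3) holo_subset by blast
    fix y assume "y \<in> B \<inter> z ` (U \<inter> V)"
    then show "F y = f (inv_into V z y)"
      using B(4) chart_inj[OF ch] by (auto simp: inv_into_f_f)
  qed
  then show "\<exists>B. openin (Cn n) B \<and> z x \<in> B \<and> B \<subseteq> z ` V \<and> holo n B (\<lambda>y. f (inv_into V z y))"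
    using o B U x by (intro exI[of _ "B \<inter> z ` (U \<inter> V)"]) auto
next
  assume "\<exists>B. openin (Cn n) B \<and> z x \<in> B \<and> B \<subseteq> z ` V \<and> holo n B (\<lambda>y. f (inv_into V z y))"
  then obtain B where B: "openin (Cn n) B" "z x \<in> B" "holo n B (\<lambda>y. f (inv_into V z y))" by blast
  let ?W = "{x'\<in>V. z x' \<in> B}"
  have W: "openin (ctop X) ?W" "?W \<subseteq> V" using chart_vimage_open[OF ch B(1)] by auto
  have "\<forall>x'\<in>?W. z x' \<in> B \<longrightarrow> f x' = f (inv_into V z (z x'))"
    using chart_inj[OF ch] by (simp add: inv_into_f_f)
  then have "hol X ?W f" unfolding chart_hol_iff[OF ch W] using B by blast
  then show "hol_near X x f" unfolding hol_near_def using W B x by blast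
qed

lemma hol_near_pullback_coord:
  assumes fs: "function_sheaf X" and ch: "chart X n V z" and x: "x \<in> V"
    and B: "openin (Cn n) B" "z x \<in> B" "holo n B G"
  shows "hol_near X x (\<lambda>x'. G (z x'))"
  unfolding hol_near_chart[OF fs ch x]
proof (intro exI conjI)
  show o: "openin (Cn n) (B \<inter> z ` V)" using B chart_open_image[OF ch] by blast
  show "holo n (B \<inter> z ` V) (\<lambda>y. G (z (inv_into V z y)))"
    by (rule holo_cong[OF o, of G]) (auto intro: holo_subset[OF B(3)] simp: f_inv_into_f)
qed (use B x in auto)

lemma hol_near_const:
  assumes "function_sheaf X" "chart X n V z" "x \<in> V"
  shows "hol_near X x (\<lambda>_. c)"
  using hol_near_pullback_coord[OF assms chart_open_image[OF assms(2)] _ holo_const] assms(3) by blast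

lemma hol_near_coord:
  assumes "function_sheaf X" "chart X n V z" "x \<in> V" "i < n"
  shows "hol_near X x (\<lambda>x'. z x' i)"
  using hol_near_pullback_coord[OF assms(1-3) chart_open_image[OF assms(2)] _ holo_coord[OF assms(4)]] assms(3) by blast

lemma
  assumes fs: "function_sheaf X" and ch: "chart X n V z" and x: "x \<in> V"
    and f: "hol_near X x f" and g: "hol_near X x g"
  shows hol_near_add: "hol_near X x (\<lambda>y. f y + g y)"
    and hol_near_mult: "hol_near X x (\<lambda>y. f y * g y)"
proof -
  obtain B C where B: "openin (Cn n) B" "z x \<in> B" "B \<subseteq> z ` V" "holo n B (\<lambda>y. f (inv_into V z y))"
    and C: "openin (Cn n) C" "z x \<in> C" "C \<subseteq> z ` V" "holo n C (\<lambda>y. g (inv_into V z y))"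
    using f g unfolding hol_near_chart[OF fs ch x] by blast
  have "holo n (B \<inter> C) (\<lambda>y. f (inv_into V z y))" "holo n (B \<inter> C) (\<lambda>y. g (inv_into V z y))"
    using B C holo_subset by blast+
  moreover have "openin (Cn n) (B \<inter> C)" "z x \<in> B \<inter> C" "B \<inter> C \<subseteq> z ` V" using B C by auto
  ultimately show "hol_near X x (\<lambda>y. f y + g y)" "hol_near X x (\<lambda>y. f y * g y)"
    unfolding hol_near_chart[OF fs ch x]
    by (auto intro!: exI[of _ "B \<inter> C"] intro: holo_add holo_mult)
qed

lemma hol_near_cmult:
  assumes "function_sheaf X" "chart X n V z" "x \<in> V" "hol_near X x f"
  shows "hol_near X x (\<lambda>y. c * f y)"
  using hol_near_mult[OF assms(1-3) hol_near_const[OF assms(1-3)] assms(4)] .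

lemma chart_slice_eventually:
  assumes ch: "chart X n V z" and W: "openin (ctop X) W" "x \<in> W" "W \<subseteq> V" and i: "i < n"
  shows "\<forall>\<^sub>F t in nhds (z x i). inv_into V z ((z x)(i := t)) \<in> W \<and>
    z (inv_into V z ((z x)(i := t))) = (z x)(i := t)"
proof -
  have "\<forall>\<^sub>F t in nhds (z x i). (z x)(i := t) \<in> z ` W"
    by (rule eventually_slice[OF chart_image_open[OF ch W(1,3)] _ i]) (use W in auto)
  then show ?thesis
  proof eventually_elim
    case (elim t)
    then obtain w where w: "w \<in> W" "(z x)(i := t) = z w" by auto
    then have "inv_into V z (z w) = w" using chart_inj[OF ch] W by (auto intro: inv_into_f_f)
    then show ?case using w by simp
  qed
qed

lemma coord_slice_differentiable:
  assumes "function_sheaf X" "chart X n V z" "x \<in> V" "i < n" "hol_near X x f"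
  shows "(\<lambda>t. f (inv_into V z ((z x)(i := t)))) field_differentiable at (z x i)"
  using assms(4,5) unfolding hol_near_chart[OF assms(1-3)] holo_def by blast

lemma coord_vec_in_tangent_space:
  assumes fs: "function_sheaf X" and ch: "chart X n V z" and x: "x \<in> V" and i: "i < n"
  shows "coord_vec X V z x i \<in> tangent_space X x"
proof -
  have inv: "inv_into V z ((z x)(i := z x i)) = x"
    using chart_inj[OF ch] x by (simp add: inv_into_f_f)
  note diff = coord_slice_differentiable[OF fs ch x i]
  have germ: "coord_vec X V z x i f = coord_vec X V z x i g"
    if "hol_near X x f" "hol_near X x g" "openin (ctop X) U" "x \<in> U" "\<forall>y\<in>U. f y = g y" for f g U
  proof -
    have "\<forall>\<^sub>F t in nhds (z x i). f (inv_into V z ((z x)(i := t))) = g (inv_into V z ((z x)(i := t)))"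
      by (rule eventually_mono[OF chart_slice_eventually[OF ch _ _ _ i, of "U \<inter> V"]])
        (use that x chart_open[OF ch] in auto)
    then show ?thesis unfolding coord_vec_def using that(1,2) by (simp add: deriv_cong_ev)
  qed
  have comb: "coord_vec X V z x i (\<lambda>y. a * f y + b * g y) =
      a * coord_vec X V z x i f + b * coord_vec X V z x i g"
    if "hol_near X x f" "hol_near X x g" for f g a b
  proof -
    have "hol_near X x (\<lambda>y. a * f y + b * g y)"
      by (intro hol_near_add[OF fs ch x] hol_near_cmult[OF fs ch x] that)
    then show ?thesis unfolding coord_vec_def using that diff[OF that(1)] diff[OF that(2)]
      by (simp add: field_differentiable_mult deriv_mult)
  qed
  have prod: "coord_vec X V z x i (\<lambda>y. f y * g y) =
      coord_vec X V z x i f * g x + f x * coord_vec X V z x i g"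
    if "hol_near X x f" "hol_near X x g" for f g
    unfolding coord_vec_def using that hol_near_mult[OF fs ch x that] diff[OF that(1)] diff[OF that(2)] inv
    by (simp add: deriv_mult)
  show ?thesis
    unfolding tangent_space_def mem_Collect_eq
  proof (intro conjI allI impI, goal_cases)
    case (1 f) then show ?case by (simp add: coord_vec_def)
  next
    case (2 f g U) then show ?case by (intro germ[of f g U]) simp_all
  next
    case (3 f g a b) then show ?case by (intro comb) simp_all
  next
    case (4 f g) then show ?case by (intro prod) simp_all
  qed
qed

lemma tangent_spaceD:
  assumes "D \<in> tangent_space X x"
  shows "\<not> hol_near X x f \<Longrightarrow> D f = 0"
    and "hol_near X x f \<Longrightarrow> hol_near X x g \<Longrightarrow> openin (ctop X) U \<Longrightarrow> x \<in> U \<Longrightarrow>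
      (\<And>y. y \<in> U \<Longrightarrow> f y = g y) \<Longrightarrow> D f = D g"
    and "hol_near X x f \<Longrightarrow> hol_near X x g \<Longrightarrow> D (\<lambda>y. a * f y + b * g y) = a * D f + b * D g"
    and "hol_near X x f \<Longrightarrow> hol_near X x g \<Longrightarrow> D (\<lambda>y. f y * g y) = D f * g x + f x * D g"
  using assms unfolding tangent_space_def by blast+

lemma tangent_vector_const:
  assumes "function_sheaf X" "chart X n V z" "x \<in> V" "D \<in> tangent_space X x"
  shows "D (\<lambda>_. c) = 0"
proof -
  note h = hol_near_const[OF assms(1-3)]
  have "D (\<lambda>_. 1 * 1) = D (\<lambda>_. 1) * 1 + 1 * D (\<lambda>_. 1)"
    by (rule tangent_spaceD(4)[OF assms(4) h h])
  then have "D (\<lambda>_. 1) = 0" by simp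
  moreover have "D (\<lambda>_. c * 1 + 0 * 1) = c * D (\<lambda>_. 1) + 0 * D (\<lambda>_. 1)"
    by (rule tangent_spaceD(3)[OF assms(4) h h])
  ultimately show ?thesis by simp
qed

text \<open>
  A derivation kills constants. Applied to the Hadamard expansion of \<open>f\<close> at \<open>x\<close> it therefore leaves
  the terms \<open>D (z i) * G i\<close>, because the other factor \<open>z i - z i x\<close> vanishes at \<open>x\<close>, and \<open>G i\<close> takes the value
  of the partial derivative there. In particular the coordinate vectors span the tangent space, so
  every unitary frame is a matrix times the coordinate frame.
\<close>

lemma tangent_vector_expansion:
  assumes fs: "function_sheaf X" and ch: "chart X n V z" and x: "x \<in> V" and D: "D \<in> tangent_space X x"
  shows "D = (\<lambda>f. \<Sum>i<n. D (\<lambda>x'. z x' i) * coord_vec X V z x i f)"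
proof
  fix f :: "'a \<Rightarrow> complex"
  show "D f = (\<Sum>i<n. D (\<lambda>x'. z x' i) * coord_vec X V z x i f)"
  proof (cases "hol_near X x f")
    case False
    then show ?thesis using tangent_spaceD(1)[OF D] by (simp add: coord_vec_def)
  next
    case True
    then obtain B where B: "openin (Cn n) B" "z x \<in> B" "B \<subseteq> z ` V" "holo n B (\<lambda>y. f (inv_into V z y))"
      unfolding hol_near_chart[OF fs ch x] by blast
    obtain C G where C: "openin (Cn n) C" "z x \<in> C" "C \<subseteq> B" "\<forall>i<n. holo n C (G i)"
      and G0: "\<forall>i<n. G i (z x) = deriv (\<lambda>t. f (inv_into V z ((z x)(i := t)))) (z x i)"
      and G: "\<forall>y\<in>C. f (inv_into V z y) = f (inv_into V z (z x)) + (\<Sum>i<n. (y i - z x i) * G i y)"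
      using hadamard_expansion[OF B(1,4,2)] by (elim exE conjE) (rule that)
    have inv: "inv_into V z (z x') = x'" if "x' \<in> V" for x'
      using chart_inj[OF ch] that by (simp add: inv_into_f_f)
    have hG: "hol_near X x (\<lambda>x'. G i (z x'))" if "i < n" for i
      by (rule hol_near_pullback_coord[OF fs ch x C(1,2)]) (use C(4) that in blast)
    note hc = hol_near_const[OF fs ch x] and hz = hol_near_coord[OF fs ch x]
    let ?t = "\<lambda>i x'. (z x' i - z x i) * G i (z x')"
    let ?p = "\<lambda>k x'. f x + (\<Sum>i<k. ?t i x')"
    have hzi: "hol_near X x (\<lambda>x'. z x' i - z x i)" if "i < n" for i
      using hol_near_add[OF fs ch x hz[OF that] hc[of "- z x i"]] by simp
    have ht: "hol_near X x (?t i)" if "i < n" for i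
      by (rule hol_near_mult[OF fs ch x hzi[OF that] hG[OF that]])
    have Dt: "D (?t i) = D (\<lambda>x'. z x' i) * G i (z x)" if "i < n" for i
    proof -
      have "D (\<lambda>x'. 1 * z x' i + (- z x i) * 1) = 1 * D (\<lambda>x'. z x' i) + (- z x i) * D (\<lambda>_. 1)"
        by (rule tangent_spaceD(3)[OF D hz[OF that] hc])
      then have "D (\<lambda>x'. z x' i - z x i) = D (\<lambda>x'. z x' i)"
        using tangent_vector_const[OF fs ch x D, of 1] by simp
      then show ?thesis using tangent_spaceD(4)[OF D hzi[OF that] hG[OF that]] by simp
    qed
    have "hol_near X x (?p k) \<and> D (?p k) = (\<Sum>i<k. D (\<lambda>x'. z x' i) * G i (z x))" if "k \<le> n" for k
      using that
    proof (induction k)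
      case 0
      then show ?case using hc tangent_vector_const[OF fs ch x D] by simp
    next
      case (Suc k)
      then have IH: "hol_near X x (?p k)" "D (?p k) = (\<Sum>i<k. D (\<lambda>x'. z x' i) * G i (z x))" and k: "k < n"
        by auto
      have eq: "?p (Suc k) = (\<lambda>x'. 1 * ?p k x' + 1 * ?t k x')" by (simp add: add.assoc)
      have "hol_near X x (\<lambda>x'. 1 * ?p k x' + 1 * ?t k x')"
        by (intro hol_near_add[OF fs ch x] hol_near_cmult[OF fs ch x] IH ht k)
      moreover have "D (\<lambda>x'. 1 * ?p k x' + 1 * ?t k x') = 1 * D (?p k) + 1 * D (?t k)"
        by (rule tangent_spaceD(3)[OF D IH(1) ht[OF k]])
      ultimately show ?case unfolding eq using IH(2) Dt[OF k] by simp
    qed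
    then have p: "hol_near X x (?p n)" "D (?p n) = (\<Sum>i<n. D (\<lambda>x'. z x' i) * G i (z x))" by auto
    have "D f = D (?p n)"
    proof (rule tangent_spaceD(2)[OF D True p(1)])
      show "openin (ctop X) {x'\<in>V. z x' \<in> C}" by (rule chart_vimage_open[OF ch C(1)])
      fix y assume "y \<in> {x'\<in>V. z x' \<in> C}"
      then have "y \<in> V" "z y \<in> C" by auto
      then show "f y = ?p n y" using bspec[OF G, of "z y"] inv x by simp
    qed (use x C in auto)
    then show ?thesis unfolding p(2) using True G0 by (simp add: coord_vec_def)
  qed
qed

lemma coord_vec_coord:
  assumes fs: "function_sheaf X" and ch: "chart X n V z" and x: "x \<in> V" and i: "i < n" and j: "j < n"
  shows "coord_vec X V z x i (\<lambda>x'. z x' j) = (if i = j then 1 else 0)"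
proof -
  have "\<forall>\<^sub>F t in nhds (z x i). z (inv_into V z ((z x)(i := t))) j = ((z x)(i := t)) j"
    using chart_slice_eventually[OF ch chart_open[OF ch] x subset_refl i] by eventually_elim simp
  then have "deriv (\<lambda>t. z (inv_into V z ((z x)(i := t))) j) (z x i) = deriv (\<lambda>t. ((z x)(i := t)) j) (z x i)"
    by (rule deriv_cong_ev) simp
  then show ?thesis unfolding coord_vec_def using hol_near_coord[OF fs ch x j] by (cases "i = j") auto
qed

lemma tangent_space_zero: "(\<lambda>f. 0) \<in> tangent_space X x"
  by (simp add: tangent_space_def)

lemma tangent_space_tcomb:
  assumes "D \<in> tangent_space X x" "D' \<in> tangent_space X x"
  shows "tcomb a D b D' \<in> tangent_space X x"
  unfolding tangent_space_def mem_Collect_eq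
proof (intro conjI allI impI)
  fix f g U assume "hol_near X x f \<and> hol_near X x g \<and> openin (ctop X) U \<and> x \<in> U \<and> (\<forall>y\<in>U. f y = g y)"
  then have "D f = D g" "D' f = D' g"
    using tangent_spaceD(2)[OF assms(1), of f g U] tangent_spaceD(2)[OF assms(2), of f g U] by simp_all
  then show "tcomb a D b D' f = tcomb a D b D' g" by (simp add: tcomb_def)
qed (use tangent_spaceD(1,3,4)[OF assms(1)] tangent_spaceD(1,3,4)[OF assms(2)]
  in \<open>auto simp: tcomb_def algebra_simps\<close>)

lemma tangent_space_sum:
  assumes "\<And>i. i < k \<Longrightarrow> v i \<in> tangent_space X x"
  shows "(\<lambda>f. \<Sum>i<(k::nat). c i * v i f) \<in> tangent_space X x"
  using assms
proof (induction k)
  case 0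
  then show ?case by (simp add: tangent_space_zero)
next
  case (Suc k)
  have "(\<lambda>f. \<Sum>i<Suc k. c i * v i f) = tcomb 1 (\<lambda>f. \<Sum>i<k. c i * v i f) (c k) (v k)"
    by (auto simp: tcomb_def)
  then show ?case using Suc tangent_space_tcomb by fastforce
qed

lemma inv_into_subset:
  assumes "inj_on z V" "W \<subseteq> V" "y \<in> z ` W"
  shows "inv_into W z y = inv_into V z y"
  using assms by (metis (no_types, lifting) f_inv_into_f inj_on_subset inv_into_f_f inv_into_into subsetD)

lemma coord_vec_restrict:
  assumes ch: "chart X n V z" and W: "openin (ctop X) W" "W \<subseteq> V" and x: "x \<in> W" and i: "i < n"
  shows "coord_vec X W z x i = coord_vec X V z x i"
proof
  fix f :: "'a \<Rightarrow> complex"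
  have "\<forall>\<^sub>F t in nhds (z x i). f (inv_into W z ((z x)(i := t))) = f (inv_into V z ((z x)(i := t)))"
    using chart_slice_eventually[OF ch W(1) x W(2) i]
  proof eventually_elim
    case (elim t)
    then have "(z x)(i := t) \<in> z ` W" by (metis imageI)
    then show ?case using inv_into_subset[OF chart_inj[OF ch] W(2)] by simp
  qed
  then show "coord_vec X W z x i f = coord_vec X V z x i f"
    unfolding coord_vec_def by (simp add: deriv_cong_ev)
qed

section \<open>Alternating forms and determinants\<close>

text \<open>
  A form with its arguments given by a frame \<open>nat \<Rightarrow> tangent\<close>, of which the first \<open>n\<close> vectors count,
  instead of a list: replacing one argument is then a function update, and permuting the arguments is
  a composition.
\<close>

locale alternating_map =
  fixes T :: "'x tangent set" and n :: nat and F :: "(nat \<Rightarrow> 'x tangent) \<Rightarrow> complex"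
  assumes zero: "(\<lambda>f. 0) \<in> T"
    and comb: "u \<in> T \<Longrightarrow> v \<in> T \<Longrightarrow> tcomb a u b v \<in> T"
    and cong: "(\<And>i. i < n \<Longrightarrow> w' i = w i) \<Longrightarrow> F w' = F w"
    and lin: "(\<And>k. k < n \<Longrightarrow> w k \<in> T) \<Longrightarrow> i < n \<Longrightarrow> u \<in> T \<Longrightarrow> v \<in> T \<Longrightarrow>
      F (w(i := tcomb a u b v)) = a * F (w(i := u)) + b * F (w(i := v))"
    and alt: "(\<And>k. k < n \<Longrightarrow> w k \<in> T) \<Longrightarrow> i < n \<Longrightarrow> j < n \<Longrightarrow> i \<noteq> j \<Longrightarrow> w i = w j \<Longrightarrow> F w = 0"
begin

lemma sum_closed: "(\<And>j. j < k \<Longrightarrow> v j \<in> T) \<Longrightarrow> (\<lambda>f. \<Sum>j<(k::nat). c j * v j f) \<in> T"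
proof (induction k)
  case (Suc k)
  have "(\<lambda>f. \<Sum>j<Suc k. c j * v j f) = tcomb 1 (\<lambda>f. \<Sum>j<k. c j * v j f) (c k) (v k)"
    by (auto simp: tcomb_def)
  then show ?case using Suc comb[of "\<lambda>f. \<Sum>j<k. c j * v j f" "v k" 1 "c k"] by simp
qed (simp add: zero)

lemma lin_sum:
  assumes w: "\<And>k. k < n \<Longrightarrow> w k \<in> T" and i: "i < n"
  shows "(\<And>j. j < k \<Longrightarrow> v j \<in> T) \<Longrightarrow>
    F (w(i := (\<lambda>f. \<Sum>j<k. c j * v j f))) = (\<Sum>j<(k::nat). c j * F (w(i := v j)))"
proof (induction k)
  case 0
  have t: "tcomb 0 (\<lambda>f. 0) 0 (\<lambda>f. 0) = (\<lambda>f. 0)" by (simp add: tcomb_def)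
  have s: "(\<lambda>f. \<Sum>j<0. c j * v j f) = (\<lambda>f. 0)" by simp
  have "F (w(i := tcomb 0 (\<lambda>f. 0) 0 (\<lambda>f. 0))) = 0 * F (w(i := (\<lambda>f. 0))) + 0 * F (w(i := (\<lambda>f. 0)))"
    by (rule lin[OF _ i zero zero]) (rule w)
  then show ?case unfolding s t by (simp add: fun_upd_def)
next
  case (Suc k)
  have eq: "(\<lambda>f. \<Sum>j<Suc k. c j * v j f) = tcomb 1 (\<lambda>f. \<Sum>j<k. c j * v j f) (c k) (v k)"
    by (auto simp: tcomb_def)
  have "F (w(i := tcomb 1 (\<lambda>f. \<Sum>j<k. c j * v j f) (c k) (v k))) =
      1 * F (w(i := (\<lambda>f. \<Sum>j<k. c j * v j f))) + c k * F (w(i := v k))"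
    by (rule lin[OF w i]) (use Suc sum_closed[of k v c] in auto)
  then show ?case unfolding eq using Suc by (simp add: fun_upd_def)
qed

lemma transpose_neg:
  assumes w: "\<And>k. k < n \<Longrightarrow> w k \<in> T" and i: "i < n" and j: "j < n" and ij: "i \<noteq> j"
  shows "F (w \<circ> Transposition.transpose i j) = - F w"
proof -
  let ?G = "\<lambda>x y. F (w(i := x, j := y))"
  let ?s = "tcomb 1 (w i) 1 (w j)"
  have s: "?s \<in> T" by (intro comb w i j)
  have z: "?G x x = 0" if "x \<in> T" for x
    by (rule alt[OF _ i j ij]) (use w ij that in auto)
  have r: "?G x ?s = ?G x (w i) + ?G x (w j)" if "x \<in> T" for x
    using lin[of "w(i := x)" j "w i" "w j" 1 1] w i j that by auto
  have l: "?G ?s y = ?G (w i) y + ?G (w j) y" if "y \<in> T" for y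
  proof -
    have tw: "w(i := x, j := y) = w(j := y, i := x)" for x by (rule fun_upd_twist[OF ij])
    have "F (w(j := y, i := ?s)) = 1 * F (w(j := y, i := w i)) + 1 * F (w(j := y, i := w j))"
      by (rule lin) (use w i j that in auto)
    then show ?thesis unfolding tw mult_1 .
  qed
  have "0 = ?G ?s ?s" using z[OF s] by simp
  also have "\<dots> = ?G (w i) (w i) + ?G (w i) (w j) + (?G (w j) (w i) + ?G (w j) (w j))"
    unfolding l[OF s] r[OF w[OF i]] r[OF w[OF j]] ..
  also have "\<dots> = ?G (w i) (w j) + ?G (w j) (w i)"
    unfolding z[OF w[OF i]] z[OF w[OF j]] by simp
  also have "w(i := w i, j := w j) = w" by simp
  also have "w(i := w j, j := w i) = w \<circ> Transposition.transpose i j"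
    using ij by (auto simp: Transposition.transpose_def fun_eq_iff)
  finally show ?thesis by (simp add: eq_neg_iff_add_eq_0 add.commute comp_def)
qed

lemma permute:
  assumes p: "p permutes {0..<n}" and w: "\<And>k. k < n \<Longrightarrow> w k \<in> T"
  shows "F (w \<circ> p) = signof p * F w"
  using p finite_atLeastLessThan w
proof (induction arbitrary: w rule: permutes_induct)
  case (swap a b p)
  have "F ((w \<circ> Transposition.transpose a b) \<circ> p) = signof p * F (w \<circ> Transposition.transpose a b)"
    by (rule swap.IH) (use swap in \<open>auto simp: Transposition.transpose_def\<close>)
  also have "F (w \<circ> Transposition.transpose a b) = - F w"
    by (rule transpose_neg) (use swap in auto)
  also have "signof p * - F w = signof (Transposition.transpose a b \<circ> p) * F w"
    using swap.hyps
    by (simp add: sign_compose permutation_swap_id permutes_imp_permutation[of "{0..<n}"] sign_swap_id)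
  finally show ?case unfolding o_assoc .
qed simp_all

text \<open>
  Expansion of the first \<open>k\<close> arguments, by induction on \<open>k\<close>; a function \<open>\<phi>\<close> records which basis vector
  is chosen in each of them.
\<close>

lemma expand:
  assumes e: "\<And>i. i < n \<Longrightarrow> e i = (\<lambda>f. \<Sum>j<n. m i j * v j f)"
    and v: "\<And>j. j < n \<Longrightarrow> v j \<in> T"
  shows "k \<le> n \<Longrightarrow> (\<And>i. i < n \<Longrightarrow> w i \<in> T) \<Longrightarrow> F (\<lambda>i. if i < k then e i else w i) =
    (\<Sum>\<phi>\<in>{..<k} \<rightarrow>\<^sub>E {..<n}. (\<Prod>i<k. m i (\<phi> i)) * F (\<lambda>i. if i < k then v (\<phi> i) else w i))"
proof (induction k arbitrary: w)
  case (Suc k)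
  have k: "k < n" using Suc.prems by simp
  have ek: "e k = (\<lambda>f. \<Sum>j<n. m k j * v j f)" by (rule e[OF k])
  have ekT: "e k \<in> T" unfolding ek by (rule sum_closed[OF v])
  let ?H = "\<lambda>\<phi> j i. if i < k then v (\<phi> i) else (w(k := v j)) i"
  have "F (\<lambda>i. if i < Suc k then e i else w i) = F (\<lambda>i. if i < k then e i else (w(k := e k)) i)"
    by (rule arg_cong[of _ _ F]) (auto simp: less_Suc_eq)
  also have "\<dots> = (\<Sum>\<phi>\<in>{..<k} \<rightarrow>\<^sub>E {..<n}. (\<Prod>i<k. m i (\<phi> i)) *
      F (\<lambda>i. if i < k then v (\<phi> i) else (w(k := e k)) i))"
    by (rule Suc.IH) (use Suc.prems ekT in auto)
  also have "\<dots> = (\<Sum>\<phi>\<in>{..<k} \<rightarrow>\<^sub>E {..<n}. \<Sum>j<n. (\<Prod>i<k. m i (\<phi> i)) * (m k j * F (?H \<phi> j)))"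
  proof (rule sum.cong[OF refl])
    fix \<phi> assume \<phi>: "\<phi> \<in> {..<k} \<rightarrow>\<^sub>E {..<n}"
    let ?g = "\<lambda>i. if i < k then v (\<phi> i) else w i"
    have upd: "(\<lambda>i. if i < k then v (\<phi> i) else (w(k := u)) i) = ?g(k := u)" for u by auto
    have "F (?g(k := e k)) = (\<Sum>j<n. m k j * F (?g(k := v j)))"
      unfolding ek
    proof (rule lin_sum[OF _ k v])
      fix i assume "i < n" then show "?g i \<in> T"
        using \<phi> v Suc.prems by (cases "i < k") (auto simp: PiE_iff)
    qed
    then show "(\<Prod>i<k. m i (\<phi> i)) * F (\<lambda>i. if i < k then v (\<phi> i) else (w(k := e k)) i) =
        (\<Sum>j<n. (\<Prod>i<k. m i (\<phi> i)) * (m k j * F (?H \<phi> j)))"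
      unfolding upd by (simp add: sum_distrib_left)
  qed
  also have "\<dots> = (\<Sum>j<n. \<Sum>\<phi>\<in>{..<k} \<rightarrow>\<^sub>E {..<n}. (\<Prod>i<k. m i (\<phi> i)) * (m k j * F (?H \<phi> j)))"
    by (rule sum.swap)
  also have "\<dots> = (\<Sum>(j, \<phi>)\<in>{..<n} \<times> ({..<k} \<rightarrow>\<^sub>E {..<n}). (\<Prod>i<k. m i (\<phi> i)) * (m k j * F (?H \<phi> j)))"
    by (rule sum.cartesian_product)
  also have "\<dots> = (\<Sum>(j, \<phi>)\<in>{..<n} \<times> ({..<k} \<rightarrow>\<^sub>E {..<n}).
      (\<Prod>i<Suc k. m i ((\<phi>(k := j)) i)) * F (\<lambda>i. if i < Suc k then v ((\<phi>(k := j)) i) else w i))"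
  proof (rule sum.cong[OF refl], clarify)
    fix j \<phi>
    have "?H \<phi> j = (\<lambda>i. if i < Suc k then v ((\<phi>(k := j)) i) else w i)" by (auto simp: less_Suc_eq)
    then show "(\<Prod>i<k. m i (\<phi> i)) * (m k j * F (?H \<phi> j)) =
      (\<Prod>i<Suc k. m i ((\<phi>(k := j)) i)) * F (\<lambda>i. if i < Suc k then v ((\<phi>(k := j)) i) else w i)"
      by simp
  qed
  also have "\<dots> = (\<Sum>\<phi>\<in>(\<lambda>(j, \<phi>). \<phi>(k := j)) ` ({..<n} \<times> ({..<k} \<rightarrow>\<^sub>E {..<n})).
      (\<Prod>i<Suc k. m i (\<phi> i)) * F (\<lambda>i. if i < Suc k then v (\<phi> i) else w i))"
    by (subst sum.reindex[OF inj_combinator]) (auto simp: case_prod_unfold)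
  also have "(\<lambda>(j, \<phi>). \<phi>(k := j)) ` ({..<n} \<times> ({..<k} \<rightarrow>\<^sub>E {..<n})) = {..<Suc k} \<rightarrow>\<^sub>E {..<n}"
    unfolding lessThan_Suc PiE_insert_eq ..
  finally show ?case .
qed simp

text \<open>
  In the full multilinear expansion the index functions that are not injective contribute nothing,
  and a permutation contributes its sign. What remains is the Leibniz formula for the determinant.
\<close>

theorem frame_change:
  assumes e: "\<And>i. i < n \<Longrightarrow> e i = (\<lambda>f. \<Sum>j<n. m i j * v j f)"
    and v: "\<And>j. j < n \<Longrightarrow> v j \<in> T"
  shows "F e = Determinant.det (Matrix.mat n n (\<lambda>(i, j). m i j)) * F v"
proof -
  let ?P = "{p. p permutes {0..<n}}" and ?\<Phi> = "{..<n} \<rightarrow>\<^sub>E {..<n}"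
  let ?r = "\<lambda>p. restrict p {..<n}"
  let ?t = "\<lambda>\<phi>. (\<Prod>i<n. m i (\<phi> i)) * F (\<lambda>i. if i < n then v (\<phi> i) else v i)"
  have "F e = F (\<lambda>i. if i < n then e i else v i)" by (rule cong) simp
  also have "\<dots> = sum ?t ?\<Phi>" by (rule expand[OF e v order_refl v])
  also have "\<dots> = sum ?t (?r ` ?P)"
  proof (rule sum.mono_neutral_right)
    show "finite ?\<Phi>" by (intro finite_PiE) auto
    show "?r ` ?P \<subseteq> ?\<Phi>"
    proof (rule image_subsetI)
      fix p assume "p \<in> ?P"
      then have "p i < n \<longleftrightarrow> i < n" for i using permutes_in_image[of p "{0..<n}" i] by simp
      then show "?r p \<in> ?\<Phi>" by auto
    qed
    show "\<forall>\<phi>\<in>?\<Phi> - ?r ` ?P. ?t \<phi> = 0"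
    proof
      fix \<phi> assume \<phi>: "\<phi> \<in> ?\<Phi> - ?r ` ?P"
      have "\<not> inj_on \<phi> {..<n}"
      proof
        assume inj: "inj_on \<phi> {..<n}"
        let ?p = "\<lambda>i. if i < n then \<phi> i else i"
        have "bij_betw \<phi> {..<n} {..<n}"
          using inj \<phi> by (intro bij_betw_imageI endo_inj_surj) (auto simp: PiE_iff)
        then have "bij_betw ?p {0..<n} {0..<n}"
          by (subst bij_betw_cong[of _ _ \<phi>]) (auto simp: atLeast0LessThan)
        then have "?p \<in> ?P" by (intro CollectI bij_imp_permutes) simp_all
        then have "?r ?p \<in> ?r ` ?P" by (rule imageI)
        moreover have "?r ?p = \<phi>" using \<phi> by (auto simp: fun_eq_iff PiE_iff extensional_def)
        ultimately show False using \<phi> by simp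
      qed
      then obtain i j where "i < n" "j < n" "i \<noteq> j" "\<phi> i = \<phi> j" by (auto simp: inj_on_def)
      moreover have "v (\<phi> k) \<in> T" if "k < n" for k using v \<phi> that by (auto simp: PiE_iff)
      ultimately have "F (\<lambda>i. if i < n then v (\<phi> i) else v i) = 0" by (intro alt[of _ i j]) auto
      then show "?t \<phi> = 0" by simp
    qed
  qed
  also have "\<dots> = sum (?t \<circ> ?r) ?P"
  proof (rule sum.reindex, rule inj_onI)
    fix p q assume pq: "p \<in> ?P" "q \<in> ?P" "?r p = ?r q"
    show "p = q"
    proof
      fix i show "p i = q i"
        using pq(1,2) fun_cong[OF pq(3), of i] by (cases "i < n") (auto simp: permutes_def)
    qed
  qed
  also have "\<dots> = (\<Sum>p\<in>?P. (signof p * (\<Prod>i = 0..<n. m i (p i))) * F v)"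
  proof (rule sum.cong[OF refl])
    fix p assume "p \<in> ?P"
    then have p: "p permutes {0..<n}" by simp
    have "F (\<lambda>i. if i < n then v (?r p i) else v i) = F (v \<circ> p)" by (rule cong) simp
    also have "\<dots> = signof p * F v" by (rule permute[OF p v])
    finally show "(?t \<circ> ?r) p = (signof p * (\<Prod>i = 0..<n. m i (p i))) * F v"
      by (simp add: atLeast0LessThan mult_ac)
  qed
  also have "\<dots> = (\<Sum>p\<in>?P. signof p * (\<Prod>i = 0..<n. m i (p i))) * F v"
    by (simp add: sum_distrib_right)
  also have "(\<Sum>p\<in>?P. signof p * (\<Prod>i = 0..<n. m i (p i))) =
      Determinant.det (Matrix.mat n n (\<lambda>(i, j). m i j))"
  proof (subst det_def'[of _ n])
    show "(\<Sum>p\<in>?P. signof p * (\<Prod>i = 0..<n. m i (p i))) =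
        (\<Sum>p\<in>?P. signof p * (\<Prod>i = 0..<n. Matrix.mat n n (\<lambda>(i, j). m i j) $$ (i, p i)))"
    proof (intro sum.cong refl arg_cong2[where f = "(*)"] prod.cong)
      fix p i assume "p \<in> ?P" "i \<in> {0..<n}"
      then have "p i < n" using permutes_in_image[of p "{0..<n}" i] by simp
      then show "m i (p i) = Matrix.mat n n (\<lambda>(i, j). m i j) $$ (i, p i)"
        using \<open>i \<in> {0..<n}\<close> by simp
    qed
  qed simp
  finally show ?thesis .
qed

end

section \<open>The pointwise norm of a form of top holomorphic degree\<close>

text \<open>
  The part of the definition of a vector bundle that concerns a single fibre. It passes unchanged to
  the fibres of a pullback.
\<close>

definition linear_fibre :: "('a, 'e) vbundle \<Rightarrow> 'a \<Rightarrow> ('e \<Rightarrow> nat \<Rightarrow> complex) \<Rightarrow> bool" where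
  "linear_fibre E x t \<longleftrightarrow>
     bij_betw t (vb_fibre E x) (topspace (Cn (vb_rank E))) \<and>
     vb_zero E x \<in> vb_fibre E x \<and>
     (\<forall>u\<in>vb_fibre E x. \<forall>v\<in>vb_fibre E x. vb_add E x u v \<in> vb_fibre E x) \<and>
     (\<forall>c. \<forall>u\<in>vb_fibre E x. vb_scale E x c u \<in> vb_fibre E x) \<and>
     (\<forall>i<vb_rank E. t (vb_zero E x) i = 0) \<and>
     (\<forall>u\<in>vb_fibre E x. \<forall>v\<in>vb_fibre E x. \<forall>i<vb_rank E. t (vb_add E x u v) i = t u i + t v i) \<and>
     (\<forall>c. \<forall>u\<in>vb_fibre E x. \<forall>i<vb_rank E. t (vb_scale E x c u) i = c * t u i)"

lemma linear_fibreD: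
  assumes "linear_fibre E x t"
  shows "vb_zero E x \<in> vb_fibre E x"
    and "u \<in> vb_fibre E x \<Longrightarrow> v \<in> vb_fibre E x \<Longrightarrow> vb_add E x u v \<in> vb_fibre E x"
    and "u \<in> vb_fibre E x \<Longrightarrow> vb_scale E x c u \<in> vb_fibre E x"
    and "i < vb_rank E \<Longrightarrow> t (vb_zero E x) i = 0"
    and "u \<in> vb_fibre E x \<Longrightarrow> v \<in> vb_fibre E x \<Longrightarrow> i < vb_rank E \<Longrightarrow> t (vb_add E x u v) i = t u i + t v i"
    and "u \<in> vb_fibre E x \<Longrightarrow> i < vb_rank E \<Longrightarrow> t (vb_scale E x c u) i = c * t u i"
  using assms unfolding linear_fibre_def by simp_all

lemma linear_fibre_eqI:
  assumes t: "linear_fibre E x t" and u: "u \<in> vb_fibre E x" and v: "v \<in> vb_fibre E x"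
    and eq: "\<And>i. i < vb_rank E \<Longrightarrow> t u i = t v i"
  shows "u = v"
proof -
  have b: "bij_betw t (vb_fibre E x) (topspace (Cn (vb_rank E)))" using t by (simp add: linear_fibre_def)
  have "t u \<in> topspace (Cn (vb_rank E))" "t v \<in> topspace (Cn (vb_rank E))"
    using bij_betwE[OF b] u v by auto
  then have "t u = t v"
    using eq by (intro ext) (metis PiE_arb lessThan_iff topspace_Cn)
  then show ?thesis using bij_betw_imp_inj_on[OF b] u v by (auto dest: inj_onD)
qed

lemma holomorphic_vector_bundle_triv:
  assumes E: "holomorphic_vector_bundle X B E" and T: "(T, \<tau>) \<in> vb_trivs E"
  shows "openin (ctop X) T" "T \<subseteq> B" "x \<in> T \<Longrightarrow> linear_fibre E x (\<tau> x)"
proof -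
  note d = E[unfolded holomorphic_vector_bundle_def]
  have *: "openin (ctop X) T \<and> T \<subseteq> B \<and>
        (\<forall>x\<in>T. bij_betw (\<tau> x) (vb_fibre E x) (topspace (Cn (vb_rank E))) \<and>
           (\<forall>i<vb_rank E. \<tau> x (vb_zero E x) i = 0) \<and>
           (\<forall>u\<in>vb_fibre E x. \<forall>v\<in>vb_fibre E x. \<forall>i<vb_rank E.
              \<tau> x (vb_add E x u v) i = \<tau> x u i + \<tau> x v i) \<and>
           (\<forall>c. \<forall>u\<in>vb_fibre E x. \<forall>i<vb_rank E. \<tau> x (vb_scale E x c u) i = c * \<tau> x u i))"
    using bspec[OF conjunct1[OF conjunct2[OF conjunct2[OF d]]] T] by simp
  then show "openin (ctop X) T" and TB: "T \<subseteq> B" by simp_all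
  assume x: "x \<in> T"
  then have "x \<in> B" using TB by blast
  from * bspec[OF conjunct1[OF d] this] x show "linear_fibre E x (\<tau> x)"
    unfolding linear_fibre_def by simp
qed

lemma holomorphic_vector_bundle_covered:
  assumes E: "holomorphic_vector_bundle X B E" and x: "x \<in> B"
  obtains T \<tau> where "(T, \<tau>) \<in> vb_trivs E" "x \<in> T"
proof -
  note d = E[unfolded holomorphic_vector_bundle_def]
  have "\<exists>(T, \<tau>)\<in>vb_trivs E. x \<in> T" by (rule bspec[OF conjunct1[OF conjunct2[OF d]] x])
  then show thesis using that by auto
qed

lemma holomorphic_vector_bundle_fibre:
  assumes E: "holomorphic_vector_bundle X B E" and x: "x \<in> B"
  shows "\<exists>t. linear_fibre E x t"
  by (rule holomorphic_vector_bundle_covered[OF E x]) (blast intro: holomorphic_vector_bundle_triv(3)[OF E])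

lemma holomorphic_vector_bundle_base_open:
  assumes E: "holomorphic_vector_bundle X B E"
  shows "openin (ctop X) B"
proof (subst openin_subopen, intro ballI)
  fix x assume "x \<in> B"
  then obtain T \<tau> where T: "(T, \<tau>) \<in> vb_trivs E" "x \<in> T"
    by (rule holomorphic_vector_bundle_covered[OF E])
  then show "\<exists>T. openin (ctop X) T \<and> x \<in> T \<and> T \<subseteq> B"
    using holomorphic_vector_bundle_triv(1,2)[OF E T(1)] by blast
qed

text \<open>
  Homogeneity makes the determinant of a change of frame come out of the norm as \<open>|det|\<^sup>2\<close>. It holds
  also at the points where a singular metric is infinite.
\<close>

definition homogeneous_norm :: "('a, 'e) vbundle \<Rightarrow> ('a \<Rightarrow> 'e \<Rightarrow> ennreal) \<Rightarrow> 'a \<Rightarrow> bool" where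
  "homogeneous_norm E h x \<longleftrightarrow>
     (\<forall>c. \<forall>u\<in>vb_fibre E x. h x (vb_scale E x c u) = ennreal ((cmod c)\<^sup>2) * h x u)"

lemma homogeneous_norm_zero:
  assumes t: "linear_fibre E x t" and h: "homogeneous_norm E h x"
  shows "h x (vb_zero E x) = 0"
proof -
  have "vb_scale E x 0 (vb_zero E x) = vb_zero E x"
    by (rule linear_fibre_eqI[OF t]) (simp_all add: linear_fibreD[OF t])
  then have "h x (vb_zero E x) = ennreal ((cmod 0)\<^sup>2) * h x (vb_zero E x)"
    using h linear_fibreD(1)[OF t] unfolding homogeneous_norm_def by metis
  then show ?thesis by simp
qed

lemma singular_hermitian_metric_homogeneous:
  assumes E: "holomorphic_vector_bundle X B E" and h: "singular_hermitian_metric X n B E h" and x: "x \<in> B"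
  shows "homogeneous_norm E h x"
  unfolding homogeneous_norm_def
proof (intro allI ballI)
  fix c u assume u: "u \<in> vb_fibre E x"
  obtain t where t: "linear_fibre E x t" using holomorphic_vector_bundle_fibre[OF E x] by blast
  obtain \<phi> h0 where h0: "smooth_bundle_metric X n B E h0"
    and hh: "\<And>x v. x \<in> B \<Longrightarrow> v \<in> vb_fibre E x \<Longrightarrow> h x v = exp_minus (\<phi> x) * ennreal (Re (h0 x v v))"
    using h unfolding singular_hermitian_metric_def by blast
  have lin: "h0 x (vb_add E x (vb_scale E x a u) (vb_scale E x b v)) w = a * h0 x u w + b * h0 x v w"
    and sym: "h0 x v u = cnj (h0 x u v)"
    if "u \<in> vb_fibre E x" "v \<in> vb_fibre E x" "w \<in> vb_fibre E x" for u v w a b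
    using h0 x that unfolding smooth_bundle_metric_def by blast+
  let ?cu = "vb_scale E x c u"
  have cu: "?cu \<in> vb_fibre E x" by (rule linear_fibreD(3)[OF t u])
  have "vb_add E x ?cu (vb_scale E x 0 u) = ?cu"
    by (rule linear_fibre_eqI[OF t]) (simp_all add: linear_fibreD[OF t] u)
  then have sc: "h0 x ?cu w = c * h0 x u w" if "w \<in> vb_fibre E x" for w
    using lin[OF u u that, of c 0] by simp
  have real: "h0 x u u = complex_of_real (Re (h0 x u u))"
    using sym[OF u u u] by (metis Reals_cnj_iff of_real_Re)
  have "h0 x ?cu ?cu = c * h0 x u ?cu" by (rule sc[OF cu])
  also have "h0 x u ?cu = cnj (c * h0 x u u)" using sym[OF cu u u] sc[OF u] by simp
  also have "c * cnj (c * h0 x u u) = c * cnj c * cnj (h0 x u u)" by simp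
  also have "\<dots> = complex_of_real ((cmod c)\<^sup>2 * Re (h0 x u u))"
    by (subst real) (simp add: complex_norm_square[symmetric] del: of_real_power)
  finally have "Re (h0 x ?cu ?cu) = (cmod c)\<^sup>2 * Re (h0 x u u)" by simp
  then show "h x ?cu = ennreal ((cmod c)\<^sup>2) * h x u"
    using hh[OF x cu] hh[OF x u] by (simp add: ennreal_mult'' mult_ac)
qed

lemma is_formD:
  assumes "is_form X E W p q \<alpha>" "form_args X W p q x vs ws"
  shows "\<alpha> x vs ws \<in> vb_fibre E x"
    and "i < p \<Longrightarrow> u \<in> tangent_space X x \<Longrightarrow> v \<in> tangent_space X x \<Longrightarrow>
      \<alpha> x (vs[i := tcomb a u b v]) ws =
        vb_add E x (vb_scale E x a (\<alpha> x (vs[i := u]) ws)) (vb_scale E x b (\<alpha> x (vs[i := v]) ws))"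
    and "j < q \<Longrightarrow> u \<in> tangent_space X x \<Longrightarrow> v \<in> tangent_space X x \<Longrightarrow>
      \<alpha> x vs (ws[j := tcomb a u b v]) =
        vb_add E x (vb_scale E x (cnj a) (\<alpha> x vs (ws[j := u]))) (vb_scale E x (cnj b) (\<alpha> x vs (ws[j := v])))"
    and "\<not> distinct vs \<or> \<not> distinct ws \<Longrightarrow> \<alpha> x vs ws = vb_zero E x"
  using assms unfolding is_form_def by simp_all

lemma form_alternating_map:
  assumes \<alpha>: "is_form X E W n 0 \<alpha>" and x: "x \<in> W" and t: "linear_fibre E x t" and k: "k < vb_rank E"
  shows "alternating_map (tangent_space X x) n (\<lambda>w. t (\<alpha> x (map w [0..<n]) []) k)"
proof
  show "(\<lambda>f. 0) \<in> tangent_space X x" by (rule tangent_space_zero)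
  show "tcomb a u b v \<in> tangent_space X x"
    if "u \<in> tangent_space X x" "v \<in> tangent_space X x" for u v a b
    by (rule tangent_space_tcomb[OF that])
  show "t (\<alpha> x (map w' [0..<n]) []) k = t (\<alpha> x (map w [0..<n]) []) k"
    if "\<And>i. i < n \<Longrightarrow> w' i = w i" for w w'
  proof -
    have "map w' [0..<n] = map w [0..<n]" by (rule map_cong) (use that in auto)
    then show ?thesis by (simp only:)
  qed
next
  fix w i u v a b
  assume w: "\<And>k. k < n \<Longrightarrow> w k \<in> tangent_space X x" and i: "i < n"
    and u: "u \<in> tangent_space X x" and v: "v \<in> tangent_space X x"
  have upd: "map (w(i := y)) [0..<n] = (map w [0..<n])[i := y]" for y
    by (rule nth_equalityI) (auto simp: nth_list_update)
  have args: "form_args X W n 0 x (map w [0..<n]) []" if "\<And>k. k < n \<Longrightarrow> w k \<in> tangent_space X x" for w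
    using that x by (auto simp: form_args_def)
  have "\<alpha> x ((map w [0..<n])[i := tcomb a u b v]) [] =
      vb_add E x (vb_scale E x a (\<alpha> x ((map w [0..<n])[i := u]) []))
        (vb_scale E x b (\<alpha> x ((map w [0..<n])[i := v]) []))"
    by (rule is_formD(2)[OF \<alpha> _ i u v]) (rule args, rule w)
  moreover have "\<alpha> x (map (w(i := u)) [0..<n]) [] \<in> vb_fibre E x"
      "\<alpha> x (map (w(i := v)) [0..<n]) [] \<in> vb_fibre E x"
    using w u v by (auto intro!: is_formD(1)[OF \<alpha>] args)
  ultimately show "t (\<alpha> x (map (w(i := tcomb a u b v)) [0..<n]) []) k =
      a * t (\<alpha> x (map (w(i := u)) [0..<n]) []) k + b * t (\<alpha> x (map (w(i := v)) [0..<n]) []) k"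
    unfolding upd using linear_fibreD[OF t] k by simp
next
  fix w i j
  assume w: "\<And>k. k < n \<Longrightarrow> w k \<in> tangent_space X x" and ij: "i < n" "j < n" "i \<noteq> j" "w i = w j"
  have "form_args X W n 0 x (map w [0..<n]) []"
    using w x by (auto simp: form_args_def)
  moreover have "\<not> distinct (map w [0..<n])"
    using ij nth_eq_iff_index_eq[of "map w [0..<n]" i j] by auto
  ultimately have "\<alpha> x (map w [0..<n]) [] = vb_zero E x"
    using \<alpha> unfolding is_form_def by blast
  then show "t (\<alpha> x (map w [0..<n]) []) k = 0" using linear_fibreD(4)[OF t k] by simp
qed

lemma form_frame_change:
  assumes \<alpha>: "is_form X E W n 0 \<alpha>" and x: "x \<in> W" and t: "linear_fibre E x t"
    and e: "\<And>i. i < n \<Longrightarrow> e i = (\<lambda>f. \<Sum>j<n. m i j * v j f)" and eT: "\<And>i. i < n \<Longrightarrow> e i \<in> tangent_space X x"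
    and v: "\<And>j. j < n \<Longrightarrow> v j \<in> tangent_space X x"
  shows "\<alpha> x (map e [0..<n]) [] =
    vb_scale E x (Determinant.det (Matrix.mat n n (\<lambda>(i, j). m i j))) (\<alpha> x (map v [0..<n]) [])"
proof -
  have fib: "\<alpha> x (map w [0..<n]) [] \<in> vb_fibre E x" if "\<And>k. k < n \<Longrightarrow> w k \<in> tangent_space X x" for w
  proof -
    have "form_args X W n 0 x (map w [0..<n]) []" using that x by (auto simp: form_args_def)
    then show ?thesis using \<alpha> unfolding is_form_def by blast
  qed
  show ?thesis
  proof (rule linear_fibre_eqI[OF t])
    fix k assume k: "k < vb_rank E"
    interpret alternating_map "tangent_space X x" n "\<lambda>w. t (\<alpha> x (map w [0..<n]) []) k"
      by (rule form_alternating_map[OF \<alpha> x t k])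
    show "t (\<alpha> x (map e [0..<n]) []) k =
      t (vb_scale E x (Determinant.det (Matrix.mat n n (\<lambda>(i, j). m i j))) (\<alpha> x (map v [0..<n]) [])) k"
      using frame_change[OF e v] linear_fibreD(6)[OF t fib[of v] k] v by simp
  qed (use fib eT v linear_fibreD(3)[OF t] in auto)
qed

definition hermitian_form_on :: "'x tangent set \<Rightarrow> ('x tangent \<Rightarrow> 'x tangent \<Rightarrow> complex) \<Rightarrow> bool" where
  "hermitian_form_on T G \<longleftrightarrow> (\<forall>u\<in>T. \<forall>v\<in>T.
     (\<forall>w\<in>T. \<forall>a b. G (tcomb a u b v) w = a * G u w + b * G v w) \<and>
     G v u = cnj (G u v) \<and> (u \<noteq> (\<lambda>f. 0) \<longrightarrow> 0 < Re (G u u)))"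

lemma hermitian_metric_at:
  "hermitian_metric X n B g \<Longrightarrow> x \<in> B \<Longrightarrow> hermitian_form_on (tangent_space X x) (g x)"
  unfolding hermitian_metric_def hermitian_form_on_def by blast

lemma hermitian_form_onD:
  assumes "hermitian_form_on T G" "u \<in> T" "v \<in> T"
  shows "w \<in> T \<Longrightarrow> G (tcomb a u b v) w = a * G u w + b * G v w"
    and "G v u = cnj (G u v)" and "u \<noteq> (\<lambda>f. 0) \<Longrightarrow> 0 < Re (G u u)"
  using assms unfolding hermitian_form_on_def by blast+

lemma hermitian_form_sum:
  assumes G: "hermitian_form_on (tangent_space X x) G" and w: "w \<in> tangent_space X x"
  shows "(\<And>i. i < k \<Longrightarrow> v i \<in> tangent_space X x) \<Longrightarrow>
    G (\<lambda>f. \<Sum>i<(k::nat). c i * v i f) w = (\<Sum>i<k. c i * G (v i) w)"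
proof (induction k)
  case 0
  have "tcomb 0 (\<lambda>f. 0) 0 (\<lambda>f. 0) = (\<lambda>f :: 'a \<Rightarrow> complex. 0)" by (simp add: tcomb_def)
  then show ?case
    using hermitian_form_onD(1)[OF G tangent_space_zero tangent_space_zero w, of 0 0] by simp
next
  case (Suc k)
  have eq: "(\<lambda>f. \<Sum>i<Suc k. c i * v i f) = tcomb 1 (\<lambda>f. \<Sum>i<k. c i * v i f) (c k) (v k)"
    by (auto simp: tcomb_def)
  have "G (tcomb 1 (\<lambda>f. \<Sum>i<k. c i * v i f) (c k) (v k)) w =
      1 * G (\<lambda>f. \<Sum>i<k. c i * v i f) w + c k * G (v k) w"
    by (rule hermitian_form_onD(1)[OF G _ _ w]) (use Suc tangent_space_sum[of k v X x c] in auto)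
  then show ?case unfolding eq using Suc by simp
qed

lemma hermitian_form_sum2:
  assumes G: "hermitian_form_on (tangent_space X x) G" and w: "w \<in> tangent_space X x"
    and v: "\<And>i. i < k \<Longrightarrow> v i \<in> tangent_space X x"
  shows "G w (\<lambda>f. \<Sum>i<(k::nat). c i * v i f) = (\<Sum>i<k. cnj (c i) * G w (v i))"
proof -
  have s: "(\<lambda>f. \<Sum>i<k. c i * v i f) \<in> tangent_space X x" by (rule tangent_space_sum[OF v])
  have "G w (\<lambda>f. \<Sum>i<k. c i * v i f) = cnj (\<Sum>i<k. c i * G (v i) w)"
    using hermitian_form_onD(2)[OF G s w] hermitian_form_sum[OF G w v, where c = c] by simp
  also have "\<dots> = (\<Sum>i<k. cnj (c i) * G w (v i))"
    using hermitian_form_onD(2)[OF G v w] by (simp add: cnj_sum)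
  finally show ?thesis .
qed

text \<open>
  Gram--Schmidt orthonormalization of a system \<open>v\<close> with dual functions \<open>\<zeta>\<close>. The last clause keeps
  track of the span: combinations of the first \<open>k\<close> vectors of \<open>v\<close> satisfy it, and because of it the next
  orthogonalized vector takes the value \<open>1\<close> at \<open>\<zeta> k\<close> and hence is not zero.
\<close>

lemma orthonormal_system_exists:
  assumes G: "hermitian_form_on (tangent_space X x) G"
    and v: "\<And>i. i < n \<Longrightarrow> v i \<in> tangent_space X x"
    and dual: "\<And>i j. i < n \<Longrightarrow> j < n \<Longrightarrow> v i (\<zeta> j) = (if i = j then 1 else 0)"
  shows "k \<le> (n::nat) \<Longrightarrow> \<exists>e. (\<forall>i<k. e i \<in> tangent_space X x) \<and>
    (\<forall>i<k. \<forall>j<k. G (e i) (e j) = (if i = j then 1 else 0)) \<and>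
    (\<forall>i<k. \<forall>j<n. k \<le> j \<longrightarrow> e i (\<zeta> j) = 0)"
proof (induction k)
  case (Suc k)
  let ?T = "tangent_space X x"
  have k: "k < n" using Suc.prems by simp
  from Suc obtain e where eT: "\<And>i. i < k \<Longrightarrow> e i \<in> ?T"
    and on: "\<And>i j. i < k \<Longrightarrow> j < k \<Longrightarrow> G (e i) (e j) = (if i = j then 1 else 0)"
    and ez: "\<And>i j. i < k \<Longrightarrow> j < n \<Longrightarrow> k \<le> j \<Longrightarrow> e i (\<zeta> j) = 0"
    by (metis Suc_leD)
  define c where "c = (\<lambda>i. - G (v k) (e i))"
  define s where "s = (\<lambda>f. \<Sum>i<k. c i * e i f)"
  define u where "u = tcomb 1 (v k) 1 s"
  have sT: "s \<in> ?T" unfolding s_def by (rule tangent_space_sum[OF eT])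
  have uT: "u \<in> ?T" unfolding u_def by (intro tangent_space_tcomb v k sT)
  have ue: "G u (e j) = 0" if j: "j < k" for j
  proof -
    have "G u (e j) = 1 * G (v k) (e j) + 1 * G s (e j)"
      unfolding u_def by (rule hermitian_form_onD(1)[OF G v[OF k] sT eT[OF j]])
    also have "G s (e j) = (\<Sum>i<k. c i * G (e i) (e j))"
      unfolding s_def by (rule hermitian_form_sum[OF G eT[OF j] eT])
    also have "\<dots> = (\<Sum>i<k. if i = j then c i else 0)"
      by (intro sum.cong) (auto simp: on j)
    also have "\<dots> = c j" using j by (simp add: sum.delta)
    finally show ?thesis by (simp add: c_def)
  qed
  have uz: "u (\<zeta> j) = (if j = k then 1 else 0)" if "j < n" "k \<le> j" for j
    using ez that dual[OF k that(1)] by (simp add: u_def s_def tcomb_def)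
  then have "u \<noteq> (\<lambda>f. 0)" using k by (metis order_refl zero_neq_one)
  then have pos: "0 < Re (G u u)" by (rule hermitian_form_onD(3)[OF G uT uT])
  define R where "R = Re (G u u)"
  have real: "G u u = complex_of_real R"
    using hermitian_form_onD(2)[OF G uT uT] unfolding R_def by (metis Reals_cnj_iff of_real_Re)
  define r where "r = complex_of_real (1 / sqrt R)"
  define ek where "ek = tcomb r u 0 u"
  have ekT: "ek \<in> ?T" unfolding ek_def by (intro tangent_space_tcomb uT)
  have ekw: "G ek w = r * G u w" if "w \<in> ?T" for w
    using hermitian_form_onD(1)[OF G uT uT that, of r 0] by (simp add: ek_def)
  have "G ek ek = r * cnj (r * G u u)"
    using ekw[OF ekT] hermitian_form_onD(2)[OF G ekT uT] ekw[OF uT] by simp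
  also have "\<dots> = complex_of_real ((1 / sqrt R)\<^sup>2 * R)"
    by (simp only: r_def real complex_cnj_mult complex_cnj_complex_of_real of_real_mult
      power2_eq_square mult.assoc)
  also have "(1 / sqrt R)\<^sup>2 * R = 1" using pos by (simp add: power_divide R_def)
  finally have ekek: "G ek ek = 1" by simp
  have eke: "G ek (e j) = 0" "G (e j) ek = 0" if "j < k" for j
    using ekw[OF eT[OF that]] ue[OF that] hermitian_form_onD(2)[OF G ekT eT[OF that]] by simp_all
  show ?case
  proof (intro exI[of _ "e(k := ek)"] conjI allI impI)
    fix i j assume "i < Suc k" "j < Suc k"
    then show "G ((e(k := ek)) i) ((e(k := ek)) j) = (if i = j then 1 else 0)"
      using on eke ekek by (auto simp: less_Suc_eq)
  next
    fix i assume "i < Suc k"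
    then show "(e(k := ek)) i \<in> ?T" using eT ekT by (auto simp: less_Suc_eq)
  next
    fix i j assume "i < Suc k" "j < n" "Suc k \<le> j"
    then show "(e(k := ek)) i (\<zeta> j) = 0"
      using ez uz by (auto simp: less_Suc_eq ek_def tcomb_def)
  qed
qed simp

lemma unitary_frame_exists:
  assumes fs: "function_sheaf X" and ch: "chart X n V z" and x: "x \<in> V"
    and G: "hermitian_form_on (tangent_space X x) (g x)"
  shows "unitary_frame X n g x (SOME e. unitary_frame X n g x e)"
proof (rule someI_ex[where P = "unitary_frame X n g x"])
  have "\<exists>e. (\<forall>i<n. e i \<in> tangent_space X x) \<and>
    (\<forall>i<n. \<forall>j<n. g x (e i) (e j) = (if i = j then 1 else 0)) \<and>
    (\<forall>i<n. \<forall>j<n. n \<le> j \<longrightarrow> e i (\<lambda>x'. z x' j) = 0)"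
    by (rule orthonormal_system_exists[where G = "g x" and v = "coord_vec X V z x"
        and \<zeta> = "\<lambda>j x'. z x' j" and n = n and k = n, OF G])
      (use coord_vec_in_tangent_space[OF fs ch x] coord_vec_coord[OF fs ch x] in auto)
  then show "\<exists>e. unitary_frame X n g x e" unfolding unitary_frame_def by blast
qed

text \<open>
  If \<open>M\<close> expresses the unitary frame in terms of the coordinate frame and \<open>G\<close> is the Gram matrix of the
  latter, then \<open>M * G * M\<^sup>* = 1\<close>.
\<close>

lemma unitary_frame_gram_det:
  assumes fs: "function_sheaf X" and ch: "chart X n V z" and x: "x \<in> V"
    and G: "hermitian_form_on (tangent_space X x) (g x)" and e: "unitary_frame X n g x e"
  defines "d \<equiv> Determinant.det (Matrix.mat n n (\<lambda>(i, j). e i (\<lambda>x'. z x' j)))"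
  shows "Determinant.det (Matrix.mat n n (\<lambda>(i, j). g x (coord_vec X V z x i) (coord_vec X V z x j)))
    * complex_of_real ((cmod d)\<^sup>2) = 1"
proof -
  let ?v = "coord_vec X V z x"
  let ?m = "\<lambda>i j. e i (\<lambda>x'. z x' j)"
  let ?M = "Matrix.mat n n (\<lambda>(i, j). ?m i j)"
  let ?G = "Matrix.mat n n (\<lambda>(i, j). g x (?v i) (?v j))"
  let ?A = "map_mat cnj (transpose_mat ?M)"
  have vT: "?v i \<in> tangent_space X x" if "i < n" for i by (rule coord_vec_in_tangent_space[OF fs ch x that])
  have eT: "e i \<in> tangent_space X x" if "i < n" for i using e that by (simp add: unitary_frame_def)
  have ee: "e i = (\<lambda>f. \<Sum>k<n. ?m i k * ?v k f)" if "i < n" for i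
    by (rule tangent_vector_expansion[OF fs ch x eT[OF that]])
  have "?M * ?G * ?A = 1\<^sub>m n"
  proof (rule eq_matI)
    fix i j assume "i < dim_row (1\<^sub>m n)" "j < dim_col (1\<^sub>m n :: complex mat)"
    then have i: "i < n" and j: "j < n" by simp_all
    have "(?M * ?G * ?A) $$ (i, j) = (\<Sum>l<n. (\<Sum>k<n. ?m i k * g x (?v k) (?v l)) * cnj (?m j l))"
      using i j by (simp add: scalar_prod_def atLeast0LessThan)
    also have "\<dots> = (\<Sum>l<n. cnj (?m j l) * g x (e i) (?v l))"
    proof (rule sum.cong[OF refl])
      fix l assume "l \<in> {..<n}"
      then have "g x (\<lambda>f. \<Sum>k<n. ?m i k * ?v k f) (?v l) = (\<Sum>k<n. ?m i k * g x (?v k) (?v l))"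
        by (intro hermitian_form_sum[OF G] vT) auto
      then show "(\<Sum>k<n. ?m i k * g x (?v k) (?v l)) * cnj (?m j l) = cnj (?m j l) * g x (e i) (?v l)"
        using ee[OF i] by (simp add: mult.commute)
    qed
    also have "\<dots> = g x (e i) (\<lambda>f. \<Sum>l<n. ?m j l * ?v l f)"
      by (rule hermitian_form_sum2[OF G eT[OF i] vT, symmetric])
    also have "\<dots> = g x (e i) (e j)" using ee[OF j] by simp
    also have "\<dots> = 1\<^sub>m n $$ (i, j)" using e i j by (simp add: unitary_frame_def)
    finally show "(?M * ?G * ?A) $$ (i, j) = 1\<^sub>m n $$ (i, j)" .
  qed simp_all
  then have "Determinant.det (?M * ?G * ?A) = 1" by simp
  moreover have "Determinant.det (?M * ?G * ?A) = Determinant.det ?M * Determinant.det ?G * Determinant.det ?A"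
  proof -
    have "Determinant.det (?M * ?G * ?A) = Determinant.det (?M * ?G) * Determinant.det ?A"
      by (rule det_mult[of _ n]) auto
    moreover have "Determinant.det (?M * ?G) = Determinant.det ?M * Determinant.det ?G"
      by (rule det_mult[of _ n]) auto
    ultimately show ?thesis by simp
  qed
  moreover have "Determinant.det ?A = cnj d"
  proof -
    interpret c: comm_ring_hom cnj by unfold_locales auto
    show ?thesis unfolding c.hom_det d_def by (subst det_transpose[of _ n]) simp_all
  qed
  ultimately have "Determinant.det ?G * (d * cnj d) = 1" by (simp add: d_def mult_ac)
  then show ?thesis by (simp only: complex_norm_square)
qed

lemma indices_top: "indices n n = {{..<n}}"
  by (auto simp: indices_def dest: card_subset_eq[rotated])

lemma indices_0: "indices n 0 = {{}}"
  by (auto simp: indices_def dest: finite_subset)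

text \<open>
  The norm of an \<open>(n,0)\<close>-form scales by \<open>|det|\<^sup>2\<close> under a change of frame and the volume density
  by its inverse, hence their product can be read off in the coordinate frame: the metric \<open>g\<close>
  cancels.
\<close>

lemma form_norm2_vol_density:
  assumes fs: "function_sheaf X" and ch: "chart X n V z" and x: "x \<in> V" "x \<in> W"
    and G: "hermitian_form_on (tangent_space X x) (g x)"
    and \<alpha>: "is_form X E W n 0 \<alpha>" and t: "linear_fibre E x t" and h: "homogeneous_norm E h x"
  shows "form_norm2 X n g h n 0 \<alpha> x * vol_density X n g V z x =
    h x (\<alpha> x (map (coord_vec X V z x) [0..<n]) [])"
proof -
  define e where "e = (SOME e. unitary_frame X n g x e)"
  have e: "unitary_frame X n g x e" unfolding e_def by (rule unitary_frame_exists[where g = g, OF fs ch x(1) G])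
  let ?v = "coord_vec X V z x"
  define d where "d = Determinant.det (Matrix.mat n n (\<lambda>(i, j). e i (\<lambda>x'. z x' j)))"
  let ?g = "Determinant.det (Matrix.mat n n (\<lambda>(i, j). g x (?v i) (?v j)))"
  have vT: "?v i \<in> tangent_space X x" if "i < n" for i by (rule coord_vec_in_tangent_space[OF fs ch x(1) that])
  have eT: "e i \<in> tangent_space X x" if "i < n" for i using e that by (simp add: unitary_frame_def)
  have gd: "?g * complex_of_real ((cmod d)\<^sup>2) = 1"
    unfolding d_def by (rule unitary_frame_gram_det[where g = g, OF fs ch x(1) G e])
  then have d0: "(cmod d)\<^sup>2 > 0" by (auto simp: zero_less_power2)
  have "?g = complex_of_real (1 / (cmod d)\<^sup>2)"
    using gd d0 by (simp add: field_simps)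
  then have vol: "vol_density X n g V z x = ennreal (1 / (cmod d)\<^sup>2)"
    by (simp only: vol_density_def Re_complex_of_real)
  have "form_norm2 X n g h n 0 \<alpha> x = h x (\<alpha> x (map e [0..<n]) [])"
    by (simp add: form_norm2_def Let_def indices_top indices_0 e_def lessThan_atLeast0)
  also have "\<alpha> x (map e [0..<n]) [] = vb_scale E x d (\<alpha> x (map ?v [0..<n]) [])"
    unfolding d_def
    by (rule form_frame_change[OF \<alpha> x(2) t tangent_vector_expansion[OF fs ch x(1) eT] eT vT])
  also have "h x \<dots> = ennreal ((cmod d)\<^sup>2) * h x (\<alpha> x (map ?v [0..<n]) [])"
  proof -
    have "form_args X W n 0 x (map ?v [0..<n]) []" using vT x by (auto simp: form_args_def)
    then have "\<alpha> x (map ?v [0..<n]) [] \<in> vb_fibre E x" using \<alpha> unfolding is_form_def by blast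
    then show ?thesis using h unfolding homogeneous_norm_def by blast
  qed
  finally have "form_norm2 X n g h n 0 \<alpha> x * vol_density X n g V z x =
      (ennreal ((cmod d)\<^sup>2) * ennreal (1 / (cmod d)\<^sup>2)) * h x (\<alpha> x (map ?v [0..<n]) [])"
    unfolding vol by (simp add: mult_ac)
  also have "ennreal ((cmod d)\<^sup>2) * ennreal (1 / (cmod d)\<^sup>2) = 1"
    using d0 by (subst ennreal_mult[symmetric]) auto
  finally show ?thesis by simp
qed

lemma form_norm2_zero_form:
  assumes fs: "function_sheaf X" and ch: "chart X n V z" and x: "x \<in> V" "x \<in> W"
    and G: "hermitian_form_on (tangent_space X x) (g x)"
    and t: "linear_fibre E x t" and h: "homogeneous_norm E h x"
  shows "form_norm2 X n g h p q (mk_form X W p q (\<lambda>x vs ws. vb_zero E x)) x = 0"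
proof -
  define e where "e = (SOME e. unitary_frame X n g x e)"
  have e: "unitary_frame X n g x e" unfolding e_def by (rule unitary_frame_exists[where g = g, OF fs ch x(1) G])
  have args: "form_args X W p q x (map e (sorted_list_of_set I)) (map e (sorted_list_of_set J))"
    if "I \<in> indices n p" "J \<in> indices n q" for I J
  proof -
    have "finite I" "finite J" using that by (auto simp: indices_def intro: finite_subset)
    then show ?thesis
      using that x e by (auto simp: form_args_def indices_def unitary_frame_def)
  qed
  show ?thesis
    unfolding form_norm2_def Let_def e_def[symmetric]
    using args homogeneous_norm_zero[OF t h] by (simp add: mk_form_def)
qed

section \<open>Integration over the regular part\<close>

text \<open>
  An open set is a union of open boxes with sides from a countable basis of \<open>\<complex>\<close>, hence a countable
  union of such boxes.
\<close>

lemma openin_Cn_sets: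
  assumes S: "openin (Cn N) S"
  shows "S \<in> sets (lebC N)"
proof -
  obtain \<B> :: "complex set set" where \<B>: "countable \<B>" "topological_basis \<B>"
    using ex_countable_basis by blast
  let ?C = "{U \<in> {..<N} \<rightarrow>\<^sub>E \<B>. Pi\<^sub>E {..<N} U \<subseteq> S}"
  have "countable ?C"
    by (rule countable_subset[OF _ countable_PiE[of "{..<N}" "\<lambda>_. \<B>"]]) (use \<B> in auto)
  moreover have "S = (\<Union>U\<in>?C. Pi\<^sub>E {..<N} U)"
  proof (intro equalityI subsetI)
    fix y assume y: "y \<in> S"
    obtain U where U: "\<forall>i\<in>{..<N}. open (U i)" "y \<in> Pi\<^sub>E {..<N} U" "Pi\<^sub>E {..<N} U \<subseteq> S"
      using S y unfolding Cn_def openin_product_topology_alt by auto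
    have "\<forall>i\<in>{..<N}. \<exists>B\<in>\<B>. y i \<in> B \<and> B \<subseteq> U i"
      using U \<B>(2) by (meson PiE_mem topological_basisE)
    then obtain B where B: "\<forall>i\<in>{..<N}. B i \<in> \<B> \<and> y i \<in> B i \<and> B i \<subseteq> U i" by metis
    let ?B = "restrict B {..<N}"
    have "Pi\<^sub>E {..<N} ?B \<subseteq> Pi\<^sub>E {..<N} U" by (rule PiE_mono) (use B in auto)
    then have "?B \<in> ?C" using B U by auto
    moreover have "y \<in> Pi\<^sub>E {..<N} ?B" using B U(2) by (auto simp: PiE_iff)
    ultimately show "y \<in> (\<Union>U\<in>?C. Pi\<^sub>E {..<N} U)" by blast
  qed auto
  moreover have "Pi\<^sub>E {..<N} U \<in> sets (PiM {..<N} (\<lambda>_. lborel))" if "U \<in> ?C" for U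
  proof (rule sets_PiM_I_finite)
    fix i assume "i \<in> {..<N}"
    then have "U i \<in> \<B>" using that by (auto simp: PiE_iff)
    then show "U i \<in> sets lborel" using \<B>(2) by (simp add: topological_basis_open)
  qed simp
  ultimately have "S \<in> sets (PiM {..<N} (\<lambda>_. lborel))"
    by (metis (no_types, lifting) sets.countable_UN'')
  then show ?thesis unfolding lebC_def by (rule sets_completionI_sets)
qed

text \<open>
  The integral is a supremum over simple functions, and a simple function below \<open>f\<close> on \<open>A \<union> B\<close> is a
  sum of one supported on \<open>A\<close> and one supported on \<open>B\<close>; hence the inequality holds for arbitrary
  integrands. The norm density of a form is an integrand whose measurability is not clear, because it is
  built from arbitrarily chosen frames.
\<close>

lemma nn_integral_Un_le:
  assumes A: "A \<in> sets M" and B: "B \<in> sets M" and AB: "A \<inter> B = {}"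
  shows "(\<integral>\<^sup>+y\<in>A \<union> B. f y \<partial>M) \<le> (\<integral>\<^sup>+y\<in>A. f y \<partial>M) + (\<integral>\<^sup>+y\<in>B. f y \<partial>M)"
  unfolding nn_integral_def[of M "\<lambda>y. f y * indicator (A \<union> B) y"]
proof (rule SUP_least)
  fix s assume "s \<in> {s. simple_function M s \<and> s \<le> (\<lambda>y. f y * indicator (A \<union> B) y)}"
  then have s: "simple_function M s" and le: "\<And>y. s y \<le> f y * indicator (A \<union> B) y"
    by (auto simp: le_fun_def)
  have eq: "s y = s y * indicator A y + s y * indicator B y" for y
    using le[of y] AB by (auto simp: indicator_def)
  have m: "s \<in> borel_measurable M" by (rule borel_measurable_simple_function[OF s])
  have "integral\<^sup>S M s = (\<integral>\<^sup>+y. s y \<partial>M)" by (rule nn_integral_eq_simple_integral[OF s, symmetric])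
  also have "\<dots> = (\<integral>\<^sup>+y. s y * indicator A y + s y * indicator B y \<partial>M)" using eq by simp
  also have "\<dots> = (\<integral>\<^sup>+y\<in>A. s y \<partial>M) + (\<integral>\<^sup>+y\<in>B. s y \<partial>M)"
    by (rule nn_integral_add) (use m A B in auto)
  also have "\<dots> \<le> (\<integral>\<^sup>+y\<in>A. f y \<partial>M) + (\<integral>\<^sup>+y\<in>B. f y \<partial>M)"
  proof (intro add_mono nn_integral_mono)
    fix y show "s y * indicator A y \<le> f y * indicator A y" "s y * indicator B y \<le> f y * indicator B y"
      using le[of y] by (auto simp: indicator_def)
  qed
  finally show "integral\<^sup>S M s \<le> (\<integral>\<^sup>+y\<in>A. f y \<partial>M) + (\<integral>\<^sup>+y\<in>B. f y \<partial>M)" .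
qed

lemma vol_density_restrict:
  assumes "chart X n V z" "openin (ctop X) W" "W \<subseteq> V" "x \<in> W"
  shows "vol_density X n g W z x = vol_density X n g V z x"
proof -
  have "Matrix.mat n n (\<lambda>(i, j). g x (coord_vec X W z x i) (coord_vec X W z x j)) =
      Matrix.mat n n (\<lambda>(i, j). g x (coord_vec X V z x i) (coord_vec X V z x j))"
    by (rule eq_matI) (simp_all add: coord_vec_restrict[OF assms])
  then show ?thesis by (simp add: vol_density_def)
qed

text \<open>
  The families in the definition of the integral are sets of triples. With an index set, pieces can be
  transformed one by one without keeping track of coinciding triples: different indices give
  the same triple only if the piece is empty, and then it contributes \<open>0\<close>.
\<close>

lemma manifold_nn_integral_upper:
  assumes J: "finite J" and disj: "disjoint_family_on P J"
    and ch: "\<And>j. j \<in> J \<Longrightarrow> chart X n (V j) (z j)" and B: "\<And>j. j \<in> J \<Longrightarrow> V j \<subseteq> B"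
    and P: "\<And>j. j \<in> J \<Longrightarrow> P j \<subseteq> V j" and m: "\<And>j. j \<in> J \<Longrightarrow> z j ` P j \<in> sets (lebC n)"
  shows "(\<Sum>j\<in>J. \<integral>\<^sup>+y\<in>z j ` P j. f (inv_into (V j) (z j) y) *
      vol_density X n g (V j) (z j) (inv_into (V j) (z j) y) \<partial>lebC n) \<le> manifold_nn_integral X n g B f"
proof -
  define F where "F = (\<lambda>(P, V, z). \<integral>\<^sup>+y\<in>z ` P. f (inv_into V z y) *
      vol_density X n g V z (inv_into V z y) \<partial>lebC n)"
  define t where "t = (\<lambda>j. (P j, V j, z j))"
  let ?J = "{j\<in>J. P j \<noteq> {}}"
  have inj: "inj_on t ?J"
  proof (rule inj_onI)
    fix i j assume ij: "i \<in> ?J" "j \<in> ?J" "t i = t j"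
    then have "P i = P j" by (simp add: t_def)
    then show "i = j" using disj ij by (auto simp: disjoint_family_on_def)
  qed
  have "(\<Sum>j\<in>J. F (t j)) = (\<Sum>j\<in>?J. F (t j))"
  proof (rule sum.mono_neutral_right[OF J])
    show "\<forall>i\<in>J - ?J. F (t i) = 0" by (simp add: F_def t_def)
  qed auto
  also have "\<dots> = sum F (t ` ?J)" by (simp add: sum.reindex[OF inj])
  also have "\<dots> \<le> manifold_nn_integral X n g B f"
    unfolding manifold_nn_integral_def F_def
  proof (rule SUP_upper, intro CollectI conjI)
    show "finite (t ` ?J)" using J by simp
    show "disjoint_family_on fst (t ` ?J)"
      unfolding disjoint_family_on_def
    proof (intro ballI impI)
      fix a b assume "a \<in> t ` ?J" "b \<in> t ` ?J" "a \<noteq> b"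
      then obtain i j where ij: "i \<in> J" "j \<in> J" "a = t i" "b = t j" by blast
      then have "i \<noteq> j" using \<open>a \<noteq> b\<close> by blast
      then show "fst a \<inter> fst b = {}"
        using disj ij by (simp add: t_def disjoint_family_on_def)
    qed
    show "\<forall>(P, V, z)\<in>t ` ?J. chart X n V z \<and> V \<subseteq> B \<and> P \<subseteq> V \<and> z ` P \<in> sets (lebC n)"
      using ch B P m by (auto simp: t_def)
  qed
  finally show ?thesis by (simp add: F_def t_def)
qed

text \<open>
  Each piece of \<open>B\<close> is cut into its part inside \<open>W1\<close> and the rest, which lies in \<open>W2\<close>, and the domains of
  the charts are shrunk accordingly.
\<close>

lemma manifold_nn_integral_Un_le:
  assumes W1: "openin (ctop X) W1" and W2: "openin (ctop X) W2" and B: "B \<subseteq> W1 \<union> W2"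
  shows "manifold_nn_integral X n g B f \<le>
    manifold_nn_integral X n g (B \<inter> W1) f + manifold_nn_integral X n g (B \<inter> W2) f"
  unfolding manifold_nn_integral_def[of X n g B]
proof (rule SUP_least)
  let ?I = "\<lambda>P V z. \<integral>\<^sup>+y\<in>z ` P. f (inv_into V z y) * vol_density X n g V z (inv_into V z y) \<partial>lebC n"
  fix \<P> assume "\<P> \<in> {\<P>. finite \<P> \<and> disjoint_family_on fst \<P> \<and>
          (\<forall>(P, V, z)\<in>\<P>. chart X n V z \<and> V \<subseteq> B \<and> P \<subseteq> V \<and> z ` P \<in> sets (lebC n))}"
  then have fin: "finite \<P>" and disj: "disjoint_family_on fst \<P>"
    and p: "\<And>P V z. (P, V, z) \<in> \<P> \<Longrightarrow> chart X n V z \<and> V \<subseteq> B \<and> P \<subseteq> V \<and> z ` P \<in> sets (lebC n)"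
    by auto
  let ?P = "\<lambda>j. fst j" and ?V = "\<lambda>j. fst (snd j)" and ?z = "\<lambda>j. snd (snd j)"
  have pj: "chart X n (?V j) (?z j)" "?V j \<subseteq> B" "?P j \<subseteq> ?V j" "?z j ` ?P j \<in> sets (lebC n)" if "j \<in> \<P>" for j
    using p[of "?P j" "?V j" "?z j"] that by auto
  have meas: "?z j ` (?P j \<inter> W1) \<in> sets (lebC n)" "?z j ` (?P j - W1) \<in> sets (lebC n)" if j: "j \<in> \<P>" for j
  proof -
    have o: "openin (ctop X) (?V j \<inter> W1)" using chart_open[OF pj(1)[OF j]] W1 by blast
    have s: "?z j ` (?V j \<inter> W1) \<in> sets (lebC n)"
      by (intro openin_Cn_sets chart_image_open[OF pj(1)[OF j] o]) simp
    have "?z j ` (?P j \<inter> W1) = ?z j ` ?P j \<inter> ?z j ` (?V j \<inter> W1)"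
      "?z j ` (?P j - W1) = ?z j ` ?P j - ?z j ` (?V j \<inter> W1)"
      using chart_inj[OF pj(1)[OF j]] pj(3)[OF j] unfolding inj_on_def by blast+
    then show "?z j ` (?P j \<inter> W1) \<in> sets (lebC n)" "?z j ` (?P j - W1) \<in> sets (lebC n)"
      using s pj(4)[OF j] by simp_all
  qed
  have restr: "?I Q (?V j) (?z j) = ?I Q (?V j \<inter> W) (?z j)"
    if j: "j \<in> \<P>" and W: "openin (ctop X) W" and Q: "Q \<subseteq> ?V j \<inter> W" for j W Q
  proof (rule nn_integral_cong)
    fix y
    have o: "openin (ctop X) (?V j \<inter> W)" using chart_open[OF pj(1)[OF j]] W by blast
    show "f (inv_into (?V j) (?z j) y) * vol_density X n g (?V j) (?z j) (inv_into (?V j) (?z j) y) *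
        indicator (?z j ` Q) y =
      f (inv_into (?V j \<inter> W) (?z j) y) *
        vol_density X n g (?V j \<inter> W) (?z j) (inv_into (?V j \<inter> W) (?z j) y) * indicator (?z j ` Q) y"
    proof (cases "y \<in> ?z j ` Q")
      case True
      then have y: "y \<in> ?z j ` (?V j \<inter> W)" using Q by blast
      have "inv_into (?V j \<inter> W) (?z j) y = inv_into (?V j) (?z j) y"
        by (rule inv_into_subset[OF chart_inj[OF pj(1)[OF j]] _ y]) simp
      moreover have "inv_into (?V j \<inter> W) (?z j) y \<in> ?V j \<inter> W" by (rule inv_into_into[OF y])
      ultimately show ?thesis
        using vol_density_restrict[OF pj(1)[OF j] o Int_lower1, of _ g] by simp
    qed simp
  qed
  have ch: "chart X n (?V j \<inter> W) (?z j)" if "j \<in> \<P>" "openin (ctop X) W" for j W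
    by (rule chart_restrict[OF pj(1)[OF that(1)]]) (use chart_open[OF pj(1)[OF that(1)]] that(2) in auto)
  have "(\<Sum>(P, V, z)\<in>\<P>. ?I P V z) = (\<Sum>j\<in>\<P>. ?I (?P j) (?V j) (?z j))"
    by (simp add: case_prod_unfold)
  also have "\<dots> \<le> (\<Sum>j\<in>\<P>. ?I (?P j \<inter> W1) (?V j \<inter> W1) (?z j) + ?I (?P j - W1) (?V j \<inter> W2) (?z j))"
  proof (rule sum_mono)
    fix j assume j: "j \<in> \<P>"
    have eq: "?z j ` ?P j = ?z j ` (?P j \<inter> W1) \<union> ?z j ` (?P j - W1)" by blast
    have dj: "?z j ` (?P j \<inter> W1) \<inter> ?z j ` (?P j - W1) = {}"
      using chart_inj[OF pj(1)[OF j]] pj(3)[OF j] unfolding inj_on_def by blast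
    have "?I (?P j) (?V j) (?z j) \<le> ?I (?P j \<inter> W1) (?V j) (?z j) + ?I (?P j - W1) (?V j) (?z j)"
      unfolding eq by (rule nn_integral_Un_le[OF meas[OF j] dj])
    also have "?I (?P j \<inter> W1) (?V j) (?z j) = ?I (?P j \<inter> W1) (?V j \<inter> W1) (?z j)"
      by (rule restr[OF j W1]) (use pj(3)[OF j] in blast)
    also have "?I (?P j - W1) (?V j) (?z j) = ?I (?P j - W1) (?V j \<inter> W2) (?z j)"
      by (rule restr[OF j W2]) (use pj(2,3)[OF j] B in blast)
    finally show "?I (?P j) (?V j) (?z j) \<le>
      ?I (?P j \<inter> W1) (?V j \<inter> W1) (?z j) + ?I (?P j - W1) (?V j \<inter> W2) (?z j)" .
  qed
  also have "\<dots> = (\<Sum>j\<in>\<P>. ?I (?P j \<inter> W1) (?V j \<inter> W1) (?z j)) + (\<Sum>j\<in>\<P>. ?I (?P j - W1) (?V j \<inter> W2) (?z j))"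
    by (rule sum.distrib)
  also have "\<dots> \<le> manifold_nn_integral X n g (B \<inter> W1) f + manifold_nn_integral X n g (B \<inter> W2) f"
  proof (intro add_mono manifold_nn_integral_upper fin)
    show "disjoint_family_on (\<lambda>j. ?P j \<inter> W1) \<P>" "disjoint_family_on (\<lambda>j. ?P j - W1) \<P>"
      using disj unfolding disjoint_family_on_def by blast+
    fix j assume j: "j \<in> \<P>"
    show "chart X n (?V j \<inter> W1) (?z j)" "chart X n (?V j \<inter> W2) (?z j)"
      using ch[OF j W1] ch[OF j W2] by auto
    show "?V j \<inter> W1 \<subseteq> B \<inter> W1" "?V j \<inter> W2 \<subseteq> B \<inter> W2" using pj(2)[OF j] by auto
    show "?P j \<inter> W1 \<subseteq> ?V j \<inter> W1" using pj(3)[OF j] by blast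
    show "?P j - W1 \<subseteq> ?V j \<inter> W2" using pj(2,3)[OF j] B by blast
    show "?z j ` (?P j \<inter> W1) \<in> sets (lebC n)" "?z j ` (?P j - W1) \<in> sets (lebC n)"
      by (rule meas[OF j])+
  qed
  finally show "(\<Sum>(P, V, z)\<in>\<P>. ?I P V z) \<le>
    manifold_nn_integral X n g (B \<inter> W1) f + manifold_nn_integral X n g (B \<inter> W2) f" .
qed

lemma manifold_nn_integral_UN_finite:
  assumes I: "finite I" and W: "\<And>i. i \<in> I \<Longrightarrow> openin (ctop X) (W i)"
    and fin: "\<And>i. i \<in> I \<Longrightarrow> manifold_nn_integral X n g (B \<inter> W i) f < \<infinity>"
  shows "manifold_nn_integral X n g (B \<inter> (\<Union>i\<in>I. W i)) f < \<infinity>"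
  using I W fin
proof (induction I)
  case empty
  have "manifold_nn_integral X n g {} f = 0"
    unfolding manifold_nn_integral_def
    by (intro antisym SUP_least) (auto intro!: sum.neutral)
  then show ?case by simp
next
  case (insert i I)
  let ?U = "\<Union>i\<in>I. W i"
  have "manifold_nn_integral X n g (B \<inter> (W i \<union> ?U)) f \<le>
      manifold_nn_integral X n g (B \<inter> (W i \<union> ?U) \<inter> W i) f + manifold_nn_integral X n g (B \<inter> (W i \<union> ?U) \<inter> ?U) f"
    by (rule manifold_nn_integral_Un_le) (use insert.prems in auto)
  also have "B \<inter> (W i \<union> ?U) \<inter> W i = B \<inter> W i" by blast
  also have "B \<inter> (W i \<union> ?U) \<inter> ?U = B \<inter> ?U" by blast
  also have "manifold_nn_integral X n g (B \<inter> W i) f + manifold_nn_integral X n g (B \<inter> ?U) f < \<infinity>"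
    using insert by (simp add: less_top)
  finally show ?case by simp
qed

lemma manifold_nn_integral_mono_set:
  "B \<subseteq> B' \<Longrightarrow> manifold_nn_integral X n g B f \<le> manifold_nn_integral X n g B' f"
  unfolding manifold_nn_integral_def
  by (rule SUP_subset_mono[OF Collect_mono order_refl]) (fastforce simp: case_prod_unfold)

lemma manifold_nn_integral_zero:
  assumes "\<And>x V z. chart X n V z \<Longrightarrow> x \<in> V \<Longrightarrow> V \<subseteq> B \<Longrightarrow> f x = 0"
  shows "manifold_nn_integral X n g B f = 0"
proof -
  have "(\<integral>\<^sup>+y\<in>z ` P. f (inv_into V z y) * vol_density X n g V z (inv_into V z y) \<partial>lebC n) = 0"
    if c: "chart X n V z" "V \<subseteq> B" "P \<subseteq> V" for P V z
  proof -
    have "f (inv_into V z y) * vol_density X n g V z (inv_into V z y) * indicator (z ` P) y = 0" for y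
    proof (cases "y \<in> z ` P")
      case True
      then have "inv_into V z y \<in> V" using c(3) by (intro inv_into_into) blast
      then have "f (inv_into V z y) = 0" using assms[OF c(1) _ c(2)] by blast
      then show ?thesis by simp
    qed simp
    then show ?thesis by (simp only: nn_integral_const mult_zero_left)
  qed
  then show ?thesis
    unfolding manifold_nn_integral_def by (intro antisym SUP_least) (auto intro!: sum.neutral)
qed

section \<open>Transport along a biholomorphism of open subsets\<close>

text \<open>
  An isomorphism of an open subset \<open>B\<close> of \<open>Y\<close> with an open subset \<open>A\<close> of \<open>X\<close>. The two sides enter
  symmetrically, here and in the extensions of this locale below: a statement is proved in one
  direction only, and \<open>reverse\<close> and its variants give it for the inverse map. The open
  subset of \<open>X\<close> that corresponds to \<open>V \<subseteq> B\<close> is written \<open>A \<inter> g -` V\<close>.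
\<close>

locale open_biholomorphism =
  fixes X :: "'a cspace" and Y :: "'b cspace" and A :: "'a set" and B :: "'b set"
    and f :: "'b \<Rightarrow> 'a" and g :: "'a \<Rightarrow> 'b"
  assumes sheaf_X: "function_sheaf X" and sheaf_Y: "function_sheaf Y"
    and A_open: "openin (ctop X) A" and B_open: "openin (ctop Y) B"
    and f_in: "y \<in> B \<Longrightarrow> f y \<in> A" and g_in: "x \<in> A \<Longrightarrow> g x \<in> B"
    and g_f: "y \<in> B \<Longrightarrow> g (f y) = y" and f_g: "x \<in> A \<Longrightarrow> f (g x) = x"
    and open_f: "openin (ctop X) U \<Longrightarrow> U \<subseteq> A \<Longrightarrow> openin (ctop Y) (B \<inter> f -` U)"
    and open_g: "openin (ctop Y) V \<Longrightarrow> V \<subseteq> B \<Longrightarrow> openin (ctop X) (A \<inter> g -` V)"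
    and hol_f: "openin (ctop X) U \<Longrightarrow> U \<subseteq> A \<Longrightarrow> hol X U u \<Longrightarrow> hol Y (B \<inter> f -` U) (u \<circ> f)"
    and hol_g: "openin (ctop Y) V \<Longrightarrow> V \<subseteq> B \<Longrightarrow> hol Y V v \<Longrightarrow> hol X (A \<inter> g -` V) (v \<circ> g)"
begin

lemma reverse: "open_biholomorphism Y X B A g f"
  by unfold_locales
    (fact sheaf_X sheaf_Y A_open B_open f_in g_in g_f f_g open_f open_g hol_f hol_g)+

lemma vimage_vimage: "V \<subseteq> B \<Longrightarrow> B \<inter> f -` (A \<inter> g -` V) = V"
  using f_in g_f by auto

lemma vimage_eq_image: "U \<subseteq> A \<Longrightarrow> B \<inter> f -` U = g ` U"
  using g_in f_g g_f by (force simp: image_iff)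

lemma image_vimage:
  assumes "V \<subseteq> B"
  shows "g ` (A \<inter> g -` V) = V"
proof
  show "V \<subseteq> g ` (A \<inter> g -` V)"
  proof
    fix y assume "y \<in> V"
    then have "g (f y) = y" "f y \<in> A \<inter> g -` V" using assms f_in g_f by auto
    then show "y \<in> g ` (A \<inter> g -` V)" by (metis imageI)
  qed
qed auto

lemma chart_image: "V \<subseteq> B \<Longrightarrow> (z \<circ> g) ` (A \<inter> g -` V) = z ` V"
  by (metis image_comp image_vimage)

lemma continuous_f:
  assumes "V \<subseteq> B"
  shows "continuous_map (subtopology (ctop Y) V) (subtopology (ctop X) (A \<inter> g -` V)) f"
proof -
  have "continuous_map (subtopology (ctop Y) V) (ctop X) f"
    unfolding continuous_map_def
  proof (intro conjI allI impI)
    show "f \<in> topspace (subtopology (ctop Y) V) \<rightarrow> topspace (ctop X)"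
      using assms f_in openin_subset[OF A_open] by auto
    fix U assume U: "openin (ctop X) U"
    have "openin (ctop Y) (B \<inter> f -` (U \<inter> A))" using U A_open by (intro open_f) auto
    then have "openin (subtopology (ctop Y) V) (V \<inter> (B \<inter> f -` (U \<inter> A)))"
      by (rule openin_subtopology_Int2)
    moreover have "V \<inter> (B \<inter> f -` (U \<inter> A)) = {y \<in> topspace (subtopology (ctop Y) V). f y \<in> U}"
      using assms f_in openin_subset[OF B_open] by auto
    ultimately show "openin (subtopology (ctop Y) V) {y \<in> topspace (subtopology (ctop Y) V). f y \<in> U}"
      by simp
  qed
  moreover have "f y \<in> A \<inter> g -` V" if "y \<in> V" for y using that assms f_in g_f by auto
  ultimately show ?thesis by (auto simp: continuous_map_in_subtopology)
qed

lemma hol_pullback_iff: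
  assumes "openin (ctop Y) V" "V \<subseteq> B"
  shows "hol Y V v \<longleftrightarrow> hol X (A \<inter> g -` V) (v \<circ> g)"
proof
  assume "hol X (A \<inter> g -` V) (v \<circ> g)"
  then have "hol Y (B \<inter> f -` (A \<inter> g -` V)) ((v \<circ> g) \<circ> f)"
    by (intro hol_f open_g assms) auto
  then have "hol Y V ((v \<circ> g) \<circ> f)" by (simp only: vimage_vimage[OF assms(2)])
  moreover have "\<forall>y\<in>V. ((v \<circ> g) \<circ> f) y = v y" using assms(2) g_f by auto
  ultimately show "hol Y V v" using sheaf_Y assms(1) unfolding function_sheaf_def by blast
qed (rule hol_g[OF assms])

lemma hol_near_pullback:
  assumes y: "y \<in> B" and u: "hol_near X (f y) u"
  shows "hol_near Y y (u \<circ> f)"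
proof -
  obtain U where U: "openin (ctop X) U" "f y \<in> U" "hol X U u" using u by (auto simp: hol_near_def)
  have o: "openin (ctop X) (U \<inter> A)" using U A_open by blast
  have "hol X (U \<inter> A) u" using sheaf_X U o unfolding function_sheaf_def by (meson Int_lower1)
  then have "hol Y (B \<inter> f -` (U \<inter> A)) (u \<circ> f)" by (intro hol_f o) auto
  moreover have "openin (ctop Y) (B \<inter> f -` (U \<inter> A))" by (intro open_f o) auto
  ultimately show ?thesis unfolding hol_near_def using y U(2) f_in by blast
qed

lemma chart_pushforward:
  assumes ch: "chart Y n V z" and V: "V \<subseteq> B"
  shows "chart X n (A \<inter> g -` V) (z \<circ> g)"
proof -
  interpret rev: open_biholomorphism Y X B A g f by (rule reverse)
  let ?V = "A \<inter> g -` V"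
  have im: "(z \<circ> g) ` ?V = z ` V" by (rule chart_image[OF V])
  have o: "openin (ctop X) ?V" by (rule open_g[OF chart_open[OF ch] V])
  have "homeomorphic_maps (subtopology (ctop X) ?V) (subtopology (ctop Y) V) g f"
    unfolding homeomorphic_maps_def
  proof (intro conjI ballI)
    show "continuous_map (subtopology (ctop X) ?V) (subtopology (ctop Y) V) g"
      using rev.continuous_f[of ?V] vimage_vimage[OF V] by simp
    show "continuous_map (subtopology (ctop Y) V) (subtopology (ctop X) ?V) f"
      by (rule continuous_f[OF V])
  qed (use f_g g_f V in auto)
  then have "homeomorphic_map (subtopology (ctop X) ?V) (subtopology (ctop Y) V) g"
    by (rule homeomorphic_maps_imp_map)
  from homeomorphic_map_compose[OF this chart_homeo[OF ch]]
  have hm: "homeomorphic_map (subtopology (ctop X) ?V) (subtopology (Cn n) ((z \<circ> g) ` ?V)) (z \<circ> g)"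
    unfolding im .
  have oi: "openin (Cn n) ((z \<circ> g) ` ?V)" unfolding im by (rule chart_open_image[OF ch])
  have "hol X W u \<longleftrightarrow> (\<forall>x\<in>W. \<exists>C F. openin (Cn n) C \<and> (z \<circ> g) x \<in> C \<and> holo n C F \<and>
      (\<forall>x'\<in>W. (z \<circ> g) x' \<in> C \<longrightarrow> u x' = F ((z \<circ> g) x')))"
    if W: "openin (ctop X) W" "W \<subseteq> ?V" for W u
  proof -
    have WA: "W \<subseteq> A" using W by blast
    let ?W = "B \<inter> f -` W"
    have eq: "?W = g ` W" by (rule vimage_eq_image[OF WA])
    have oW: "openin (ctop Y) ?W" by (rule open_f[OF W(1) WA])
    have sub: "?W \<subseteq> V" unfolding eq using W(2) by auto
    have "hol X W u \<longleftrightarrow> hol Y ?W (u \<circ> f)" by (rule rev.hol_pullback_iff[OF W(1) WA])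
    also have "\<dots> \<longleftrightarrow> (\<forall>y\<in>?W. \<exists>C F. openin (Cn n) C \<and> z y \<in> C \<and> holo n C F \<and>
              (\<forall>y'\<in>?W. z y' \<in> C \<longrightarrow> (u \<circ> f) y' = F (z y')))"
      by (rule chart_hol_iff[OF ch oW sub])
    also have "\<dots> \<longleftrightarrow> (\<forall>x\<in>W. \<exists>C F. openin (Cn n) C \<and> z (g x) \<in> C \<and> holo n C F \<and>
              (\<forall>x'\<in>W. z (g x') \<in> C \<longrightarrow> u (f (g x')) = F (z (g x'))))"
      unfolding eq by simp
    also have "\<dots> \<longleftrightarrow> (\<forall>x\<in>W. \<exists>C F. openin (Cn n) C \<and> (z \<circ> g) x \<in> C \<and> holo n C F \<and>
      (\<forall>x'\<in>W. (z \<circ> g) x' \<in> C \<longrightarrow> u x' = F ((z \<circ> g) x')))"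
    proof -
      have "u (f (g x')) = u x'" if "x' \<in> W" for x' using f_g WA that by auto
      then show ?thesis by simp
    qed
    finally show ?thesis .
  qed
  moreover have "\<exists>D \<F>. openin (Cn n) D \<and> finite \<F> \<and> (\<forall>F\<in>\<F>. holo n D F) \<and>
        (z \<circ> g) ` ?V = {y\<in>D. \<forall>F\<in>\<F>. F y = 0}"
    using oi by (intro exI[of _ "(z \<circ> g) ` ?V"] exI[of _ "{}"]) simp
  ultimately show ?thesis unfolding chart_def local_model_def using o hm oi by blast
qed

lemma regular_pushforward:
  assumes "B \<subseteq> regular_points Y"
  shows "A \<subseteq> regular_points X"
proof
  fix x assume x: "x \<in> A"
  then obtain n V z where ch: "chart Y n V z" "g x \<in> V"
    using assms g_in unfolding regular_points_def by blast
  have "chart Y n (V \<inter> B) z"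
    by (rule chart_restrict[OF ch(1)]) (use chart_open[OF ch(1)] B_open in auto)
  from chart_pushforward[OF this] have "chart X n (A \<inter> g -` (V \<inter> B)) (z \<circ> g)" by simp
  moreover have "x \<in> A \<inter> g -` (V \<inter> B)" using x ch g_in by auto
  ultimately show "x \<in> regular_points X" unfolding regular_points_def by blast
qed

end

locale regular_biholomorphism = open_biholomorphism +
  assumes A_regular: "A \<subseteq> regular_points X"
begin

lemma reverse_regular: "regular_biholomorphism Y X B A g f"
proof -
  interpret rev: open_biholomorphism Y X B A g f by (rule reverse)
  show ?thesis by unfold_locales (rule rev.regular_pushforward[OF A_regular])
qed

lemma hol_near_pullback_iff:
  assumes y: "y \<in> B"
  shows "hol_near Y y v \<longleftrightarrow> hol_near X (f y) (v \<circ> g)"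
proof
  interpret rev: open_biholomorphism Y X B A g f by (rule reverse)
  show "hol_near Y y v \<Longrightarrow> hol_near X (f y) (v \<circ> g)"
    by (rule rev.hol_near_pullback) (simp_all add: y f_in g_f)
  assume "hol_near X (f y) (v \<circ> g)"
  then have "hol_near Y y ((v \<circ> g) \<circ> f)" by (rule hol_near_pullback[OF y])
  then obtain U where U: "openin (ctop Y) U" "y \<in> U" "hol Y U ((v \<circ> g) \<circ> f)" by (auto simp: hol_near_def)
  have o: "openin (ctop Y) (U \<inter> B)" using U B_open by blast
  have "hol Y (U \<inter> B) ((v \<circ> g) \<circ> f)" using sheaf_Y U o unfolding function_sheaf_def by (meson Int_lower1)
  moreover have "\<forall>y\<in>U \<inter> B. ((v \<circ> g) \<circ> f) y = v y" using g_f by auto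
  ultimately have "hol Y (U \<inter> B) v" using sheaf_Y o unfolding function_sheaf_def by blast
  then show "hol_near Y y v" unfolding hol_near_def using o U y by blast
qed

abbreviation df :: "'b \<Rightarrow> 'b tangent \<Rightarrow> 'a tangent" where
  "df \<equiv> differential X f"

lemma differential_in_tangent_space:
  assumes y: "y \<in> B" and D: "D \<in> tangent_space Y y"
  shows "df y D \<in> tangent_space X (f y)"
proof -
  obtain n V z where ch: "chart X n V z" "f y \<in> V"
    using A_regular f_in[OF y] unfolding regular_points_def by blast
  note near = hol_near_pullback[OF y]
  show ?thesis
    unfolding tangent_space_def mem_Collect_eq
  proof (intro conjI allI impI, goal_cases)
    case (1 u) then show ?case by (simp add: differential_def)
  next
    case (2 u v U)
    have "D (u \<circ> f) = D (v \<circ> f)"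
    proof (rule tangent_spaceD(2)[OF D])
      show "openin (ctop Y) (B \<inter> f -` (U \<inter> A))" using 2 A_open by (intro open_f) auto
    qed (use 2 y f_in near in auto)
    then show ?case using 2 by (simp add: differential_def)
  next
    case (3 u v a b)
    have "hol_near X (f y) (\<lambda>x. a * u x + b * v x)"
      using 3 by (intro hol_near_add[OF sheaf_X ch] hol_near_cmult[OF sheaf_X ch]) auto
    then show ?case
      using 3 tangent_spaceD(3)[OF D near near, of u v a b] by (simp add: differential_def comp_def)
  next
    case (4 u v)
    have "hol_near X (f y) (\<lambda>x. u x * v x)"
      using 4 by (intro hol_near_mult[OF sheaf_X ch]) auto
    then show ?case
      using 4 tangent_spaceD(4)[OF D near near, of u v] by (simp add: differential_def comp_def)
  qed
qed

lemma differential_inverse: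
  assumes y: "y \<in> B" and D: "D \<in> tangent_space Y y"
  shows "differential Y g (f y) (df y D) = D"
proof
  fix v
  show "differential Y g (f y) (df y D) v = D v"
  proof (cases "hol_near Y y v")
    case True
    then have n: "hol_near X (f y) (v \<circ> g)" using hol_near_pullback_iff[OF y] by blast
    have "D ((v \<circ> g) \<circ> f) = D v"
      by (rule tangent_spaceD(2)[OF D hol_near_pullback[OF y n] True B_open y]) (simp add: g_f)
    then show ?thesis using True n by (simp add: differential_def g_f[OF y])
  next
    case False
    then show ?thesis using tangent_spaceD(1)[OF D False] by (simp add: differential_def g_f[OF y])
  qed
qed

lemma differential_tcomb: "df y (tcomb a D b D') = tcomb a (df y D) b (df y D')"
  by (auto simp: differential_def tcomb_def fun_eq_iff)

lemma inv_chart_pushforward: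
  assumes ch: "chart Y n V z" and V: "V \<subseteq> B" and w: "w \<in> z ` V"
  shows "inv_into (A \<inter> g -` V) (z \<circ> g) w = f (inv_into V z w)"
proof (rule inv_into_f_eq)
  show "inj_on (z \<circ> g) (A \<inter> g -` V)" by (rule chart_inj[OF chart_pushforward[OF ch V]])
  have iv: "inv_into V z w \<in> V" using w by (rule inv_into_into)
  then show "f (inv_into V z w) \<in> A \<inter> g -` V" using V f_in g_f by auto
  show "(z \<circ> g) (f (inv_into V z w)) = w" using iv V g_f f_inv_into_f[OF w] by auto
qed

text \<open>
  The chart \<open>(V, z)\<close> of \<open>Y\<close> and its transport to \<open>X\<close> have the same coordinates, so the coordinate vectors
  are the same partial derivatives. With it the coefficients of a form and of its pullback are
  literally equal functions on the image of the chart.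
\<close>

lemma differential_coord_vec:
  assumes ch: "chart Y n V z" and V: "V \<subseteq> B" and y: "y \<in> V" and i: "i < n"
  shows "df y (coord_vec Y V z y i) = coord_vec X (A \<inter> g -` V) (z \<circ> g) (f y) i"
proof
  fix u
  have yB: "y \<in> B" using V y by blast
  show "df y (coord_vec Y V z y i) u = coord_vec X (A \<inter> g -` V) (z \<circ> g) (f y) i u"
  proof (cases "hol_near X (f y) u")
    case True
    have "\<forall>\<^sub>F t in nhds (z y i). (u \<circ> f) (inv_into V z ((z y)(i := t))) =
        u (inv_into (A \<inter> g -` V) (z \<circ> g) ((z y)(i := t)))"
      using chart_slice_eventually[OF ch chart_open[OF ch] y order_refl i]
    proof eventually_elim
      case (elim t)
      then have "(z y)(i := t) \<in> z ` V" by (metis imageI)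
      then show ?case by (simp add: inv_chart_pushforward[OF ch V])
    qed
    then show ?thesis
      using True hol_near_pullback[OF yB True]
      by (simp add: differential_def coord_vec_def g_f[OF yB] deriv_cong_ev)
  next
    case False
    then show ?thesis by (simp add: differential_def coord_vec_def)
  qed
qed

end

text \<open>
  Two bundles with the same fibres over corresponding points, and with the same trivializations up to
  transport. This is the relation of a bundle to its pullback, in a form that is symmetric in the two
  bundles.
\<close>

locale bundle_biholomorphism = regular_biholomorphism X Y A B f g
  for X :: "'a cspace" and Y :: "'b cspace" and A B f g +
  fixes E :: "('a, 'e) vbundle" and E' :: "('b, 'e) vbundle"
  assumes rank: "vb_rank E' = vb_rank E"
    and fibre: "y \<in> B \<Longrightarrow> vb_fibre E' y = vb_fibre E (f y)"
    and zero: "y \<in> B \<Longrightarrow> vb_zero E' y = vb_zero E (f y)"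
    and add: "y \<in> B \<Longrightarrow> vb_add E' y = vb_add E (f y)"
    and scale: "y \<in> B \<Longrightarrow> vb_scale E' y = vb_scale E (f y)"
    and trivs: "(T, \<tau>) \<in> vb_trivs E' \<Longrightarrow>
      \<exists>S \<sigma>. (S, \<sigma>) \<in> vb_trivs E \<and> S \<subseteq> A \<and> T = B \<inter> f -` S \<and> (\<forall>y\<in>T. \<tau> y = \<sigma> (f y))"
    and trivs': "(S, \<sigma>) \<in> vb_trivs E \<Longrightarrow>
      \<exists>T \<tau>. (T, \<tau>) \<in> vb_trivs E' \<and> T \<subseteq> B \<and> S = A \<inter> g -` T \<and> (\<forall>x\<in>S. \<sigma> x = \<tau> (g x))"
    and linear: "x \<in> A \<Longrightarrow> \<exists>t. linear_fibre E x t"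
begin

lemma linear': "y \<in> B \<Longrightarrow> \<exists>t. linear_fibre E' y t"
  using linear[OF f_in, of y] unfolding linear_fibre_def
  by (simp add: rank fibre zero add scale)

lemma reverse_bundle: "bundle_biholomorphism Y X B A g f E' E"
proof -
  interpret rev: regular_biholomorphism Y X B A g f by (rule reverse_regular)
  show ?thesis
    by unfold_locales
      (use rank fibre zero add scale trivs trivs' linear' g_in f_g in \<open>simp_all\<close>)
qed

abbreviation pb :: "'b set \<Rightarrow> nat \<Rightarrow> nat \<Rightarrow> ('a, 'e) form \<Rightarrow> ('b, 'e) form" where
  "pb \<equiv> pullback_form Y X f"

context
  fixes W W' assumes W: "W \<subseteq> A" and W': "W' = B \<inter> f -` W"
begin

lemma W'_image: "W = A \<inter> g -` W'"
  using W g_in f_g unfolding W' by auto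

lemma pb_args:
  assumes "form_args Y W' p q y vs ws"
  shows "form_args X W p q (f y) (map (df y) vs) (map (df y) ws)"
  using assms differential_in_tangent_space W' unfolding form_args_def by auto

lemma pb_apply:
  "form_args Y W' p q y vs ws \<Longrightarrow> pb W' p q \<alpha> y vs ws = \<alpha> (f y) (map (df y) vs) (map (df y) ws)"
  by (simp add: pullback_form_def mk_form_def)

lemma mk_form_pb: "mk_form Y W' p q (pb W' p q \<alpha>) = pb W' p q \<alpha>"
  by (simp add: pullback_form_def mk_form_def fun_eq_iff)

lemma pb_is_form:
  assumes \<alpha>: "is_form X E W p q \<alpha>"
  shows "is_form Y E' W' p q (pb W' p q \<alpha>)"
  unfolding is_form_def
proof (intro conjI mk_form_pb allI impI ballI)
  fix y vs ws assume a: "form_args Y W' p q y vs ws"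
  note F = is_formD[OF \<alpha> pb_args[OF a]]
  have y: "y \<in> B" using a W' by (auto simp: form_args_def)
  show "pb W' p q \<alpha> y vs ws \<in> vb_fibre E' y"
    using F(1) by (simp add: pb_apply[OF a] fibre[OF y])
  show "pb W' p q \<alpha> y vs ws = vb_zero E' y" if "\<not> distinct vs \<or> \<not> distinct ws"
  proof -
    have "\<not> distinct (map (df y) vs) \<or> \<not> distinct (map (df y) ws)"
      using that by (auto simp: distinct_map)
    then show ?thesis using F(4) by (simp add: pb_apply[OF a] zero[OF y])
  qed
  fix i u v c d assume u: "u \<in> tangent_space Y y" and v: "v \<in> tangent_space Y y"
  note du = differential_in_tangent_space[OF y u] and dv = differential_in_tangent_space[OF y v]
  have av: "form_args Y W' p q y (vs[i := w]) ws" "form_args Y W' p q y vs (ws[i := w])"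
    if "w \<in> tangent_space Y y" for w
    using a that set_update_subset_insert[of vs i w] set_update_subset_insert[of ws i w]
    unfolding form_args_def by auto
  show "pb W' p q \<alpha> y (vs[i := tcomb c u d v]) ws =
      vb_add E' y (vb_scale E' y c (pb W' p q \<alpha> y (vs[i := u]) ws))
        (vb_scale E' y d (pb W' p q \<alpha> y (vs[i := v]) ws))" if i: "i < p"
    using F(2)[OF i du dv] av u v tangent_space_tcomb[OF u v]
    by (simp add: pb_apply map_update differential_tcomb add[OF y] scale[OF y])
  show "pb W' p q \<alpha> y vs (ws[i := tcomb c u d v]) =
      vb_add E' y (vb_scale E' y (cnj c) (pb W' p q \<alpha> y vs (ws[i := u])))
        (vb_scale E' y (cnj d) (pb W' p q \<alpha> y vs (ws[i := v])))" if i: "i < q"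
    using F(3)[OF i du dv] av u v tangent_space_tcomb[OF u v]
    by (simp add: pb_apply map_update differential_tcomb add[OF y] scale[OF y])
qed

lemma pb_inverse:
  assumes \<alpha>: "mk_form X W p q \<alpha> = \<alpha>"
  shows "pullback_form X Y g W p q (pb W' p q \<alpha>) = \<alpha>"
proof (intro ext)
  interpret rev: regular_biholomorphism Y X B A g f by (rule reverse_regular)
  fix x vs ws
  show "pullback_form X Y g W p q (pb W' p q \<alpha>) x vs ws = \<alpha> x vs ws"
  proof (cases "form_args X W p q x vs ws")
    case True
    then have x: "x \<in> A" and ts: "set vs \<subseteq> tangent_space X x" "set ws \<subseteq> tangent_space X x"
      using W by (auto simp: form_args_def)
    have args: "form_args Y W' p q (g x) (map (rev.df x) vs) (map (rev.df x) ws)"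
      using True rev.differential_in_tangent_space[OF x] W'_image x unfolding form_args_def by auto
    have id: "map (df (g x)) (map (rev.df x) us) = us" if "set us \<subseteq> tangent_space X x" for us
      unfolding map_map by (rule map_idI) (use rev.differential_inverse[OF x] that in auto)
    have "pullback_form X Y g W p q (pb W' p q \<alpha>) x vs ws =
        pb W' p q \<alpha> (g x) (map (rev.df x) vs) (map (rev.df x) ws)"
      using True by (simp add: pullback_form_def mk_form_def)
    also have "\<dots> = \<alpha> x vs ws"
      unfolding pb_apply[OF args] id[OF ts(1)] id[OF ts(2)] f_g[OF x] ..
    finally show ?thesis .
  next
    case False
    then show ?thesis using fun_cong[OF fun_cong[OF fun_cong[OF \<alpha>]], of x vs ws]
      by (simp add: pullback_form_def mk_form_def)
  qed
qed

lemma chart_sub: "V \<subseteq> W' \<Longrightarrow> V \<subseteq> B" "V \<subseteq> W' \<Longrightarrow> A \<inter> g -` V \<subseteq> W"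
  using W' W'_image by blast+

lemma coef_pb:
  assumes ch: "chart Y n V z" and V: "V \<subseteq> W'" and I: "I \<in> indices n p" and J: "J \<in> indices n q"
    and \<tau>: "\<And>y. y \<in> V \<Longrightarrow> \<tau> y = \<sigma> (f y)" and w: "w \<in> z ` V"
  shows "coef Y V z \<tau> (pb W' p q \<alpha>) I J k w = coef X (A \<inter> g -` V) (z \<circ> g) \<sigma> \<alpha> I J k w"
proof -
  let ?y = "inv_into V z w"
  have y: "?y \<in> V" using w by (rule inv_into_into)
  have VB: "V \<subseteq> B" by (rule chart_sub[OF V])
  have fin: "finite I" "finite J" using I J by (auto simp: indices_def intro: finite_subset)
  have lt: "i < n" if "i \<in> I \<or> i \<in> J" for i using that I J by (auto simp: indices_def)
  have args: "form_args Y W' p q ?y (map (coord_vec Y V z ?y) (sorted_list_of_set I))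
      (map (coord_vec Y V z ?y) (sorted_list_of_set J))"
    using y V I J fin lt coord_vec_in_tangent_space[OF sheaf_Y ch y]
    by (auto simp: form_args_def indices_def)
  have m: "map (df ?y) (map (coord_vec Y V z ?y) (sorted_list_of_set K)) =
      map (coord_vec X (A \<inter> g -` V) (z \<circ> g) (f ?y)) (sorted_list_of_set K)" if "K = I \<or> K = J" for K
    using that fin lt differential_coord_vec[OF ch VB y] by auto
  show ?thesis
    unfolding coef_def Let_def pb_apply[OF args] inv_chart_pushforward[OF ch VB w] \<tau>[OF y]
      m[OF disjI1[OF refl]] m[OF disjI2[OF refl]] ..
qed

lemma triv_pullback:
  assumes T: "(T, \<tau>) \<in> vb_trivs E'" and V: "V \<subseteq> W' \<inter> T"
  obtains S \<sigma> where "(S, \<sigma>) \<in> vb_trivs E" "A \<inter> g -` V \<subseteq> W \<inter> S" "\<And>y. y \<in> V \<Longrightarrow> \<tau> y = \<sigma> (f y)"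
proof -
  obtain S \<sigma> where S: "(S, \<sigma>) \<in> vb_trivs E" "T = B \<inter> f -` S" "\<forall>y\<in>T. \<tau> y = \<sigma> (f y)"
    using trivs[OF T] by blast
  have "A \<inter> g -` V \<subseteq> W \<inter> S"
  proof
    fix x assume x: "x \<in> A \<inter> g -` V"
    then have "f (g x) \<in> W" "f (g x) \<in> S" using V S(2) W' by auto
    then show "x \<in> W \<inter> S" using f_g x by auto
  qed
  then show thesis using that S V by blast
qed

lemma measurable_form_pb:
  assumes \<alpha>: "measurable_form X n E W p q \<alpha>"
  shows "measurable_form Y n E' W' p q (pb W' p q \<alpha>)"
  unfolding measurable_form_def
proof (intro conjI pb_is_form allI ballI impI, goal_cases)
  case 1 show ?case using \<alpha> by (simp add: measurable_form_def)
next
  case (2 V z t)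
  obtain T \<tau> where t: "t = (T, \<tau>)" by force
  show ?case unfolding t prod.case
  proof (intro ballI allI impI)
    fix I J k assume IJ: "I \<in> indices n p" "J \<in> indices n q" and k: "k < vb_rank E'"
      and V: "chart Y n V z \<and> V \<subseteq> W' \<inter> T"
    obtain S \<sigma> where S: "(S, \<sigma>) \<in> vb_trivs E" "A \<inter> g -` V \<subseteq> W \<inter> S" "\<And>y. y \<in> V \<Longrightarrow> \<tau> y = \<sigma> (f y)"
      using triv_pullback[of T \<tau> V] 2 V t by blast
    have VB: "V \<subseteq> B" using V chart_sub(1)[of V] by auto
    have "coef X (A \<inter> g -` V) (z \<circ> g) \<sigma> \<alpha> I J k
        \<in> borel_measurable (restrict_space (lebC n) ((z \<circ> g) ` (A \<inter> g -` V)))"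
    proof -
      have "\<forall>(T, \<tau>)\<in>vb_trivs E. \<forall>I\<in>indices n p. \<forall>J\<in>indices n q. \<forall>k<vb_rank E.
        chart X n (A \<inter> g -` V) (z \<circ> g) \<and> A \<inter> g -` V \<subseteq> W \<inter> T \<longrightarrow>
        coef X (A \<inter> g -` V) (z \<circ> g) \<tau> \<alpha> I J k
          \<in> borel_measurable (restrict_space (lebC n) ((z \<circ> g) ` (A \<inter> g -` V)))"
        by (rule spec[OF spec[OF conjunct2[OF \<alpha>[unfolded measurable_form_def]], of "A \<inter> g -` V"], of "z \<circ> g"])
      from bspec[OF this S(1)] show ?thesis
        using S(2) IJ k chart_pushforward[of n V z] V VB rank by simp
    qed
    then have "coef X (A \<inter> g -` V) (z \<circ> g) \<sigma> \<alpha> I J k \<in> borel_measurable (restrict_space (lebC n) (z ` V))"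
      unfolding chart_image[OF VB] .
    moreover have "coef Y V z \<tau> (pb W' p q \<alpha>) I J k w = coef X (A \<inter> g -` V) (z \<circ> g) \<sigma> \<alpha> I J k w"
      if "w \<in> space (restrict_space (lebC n) (z ` V))" for w
      by (rule coef_pb) (use V IJ S that in \<open>auto simp: space_restrict_space\<close>)
    ultimately show "coef Y V z \<tau> (pb W' p q \<alpha>) I J k \<in> borel_measurable (restrict_space (lebC n) (z ` V))"
      using measurable_cong by blast
  qed
qed

lemma ae_equal_pb:
  assumes eq: "ae_equal X n W \<alpha> \<beta>"
  shows "ae_equal Y n W' (pb W' p q \<alpha>) (pb W' p q \<beta>)"
  unfolding ae_equal_def
proof (intro allI impI)
  fix V z assume V: "chart Y n V z \<and> V \<subseteq> W'"
  have VB: "V \<subseteq> B" using V chart_sub(1) by blast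
  have "AE w in lebC n. w \<in> (z \<circ> g) ` (A \<inter> g -` V) \<longrightarrow>
      \<alpha> (inv_into (A \<inter> g -` V) (z \<circ> g) w) = \<beta> (inv_into (A \<inter> g -` V) (z \<circ> g) w)"
    using eq V chart_pushforward[of n V z] VB chart_sub(2)[of V] unfolding ae_equal_def by blast
  then show "AE w in lebC n. w \<in> z ` V \<longrightarrow> pb W' p q \<alpha> (inv_into V z w) = pb W' p q \<beta> (inv_into V z w)"
  proof eventually_elim
    case (elim w)
    then show ?case
      unfolding chart_image[OF VB]
      using V inv_chart_pushforward[of n V z w] VB
      by (auto simp: pullback_form_def mk_form_def fun_eq_iff)
  qed
qed

lemma locally_integrable_form_pb:
  assumes \<alpha>: "locally_integrable_form X n E W p q \<alpha>"
  shows "locally_integrable_form Y n E' W' p q (pb W' p q \<alpha>)"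
  unfolding locally_integrable_form_def
proof (intro allI ballI, goal_cases)
  case (1 V z K t)
  obtain T \<tau> where t: "t = (T, \<tau>)" by force
  show ?case unfolding t prod.case
  proof (intro ballI allI impI)
    fix I J k assume IJ: "I \<in> indices n p" "J \<in> indices n q" and k: "k < vb_rank E'"
      and V: "chart Y n V z \<and> V \<subseteq> W' \<inter> T \<and> compactin (Cn n) K \<and> K \<subseteq> z ` V"
    obtain S \<sigma> where S: "(S, \<sigma>) \<in> vb_trivs E" "A \<inter> g -` V \<subseteq> W \<inter> S" "\<And>y. y \<in> V \<Longrightarrow> \<tau> y = \<sigma> (f y)"
      using triv_pullback[of T \<tau> V] 1 V t by blast
    have VB: "V \<subseteq> B" using V chart_sub(1)[of V] by auto
    have "K \<subseteq> (z \<circ> g) ` (A \<inter> g -` V)" unfolding chart_image[OF VB] using V by blast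
    then have int: "set_integrable (lebC n) K (coef X (A \<inter> g -` V) (z \<circ> g) \<sigma> \<alpha> I J k)"
    proof -
      have "\<forall>(T, \<tau>)\<in>vb_trivs E. \<forall>I\<in>indices n p. \<forall>J\<in>indices n q. \<forall>k<vb_rank E.
        chart X n (A \<inter> g -` V) (z \<circ> g) \<and> A \<inter> g -` V \<subseteq> W \<inter> T \<and> compactin (Cn n) K \<and>
          K \<subseteq> (z \<circ> g) ` (A \<inter> g -` V) \<longrightarrow>
        set_integrable (lebC n) K (coef X (A \<inter> g -` V) (z \<circ> g) \<tau> \<alpha> I J k)"
        by (rule spec[OF spec[OF spec[OF \<alpha>[unfolded locally_integrable_form_def], of "A \<inter> g -` V"], of "z \<circ> g"], of K])
      from bspec[OF this S(1)] show ?thesis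
        using \<open>K \<subseteq> (z \<circ> g) ` (A \<inter> g -` V)\<close> S(2) IJ k chart_pushforward[of n V z] V VB rank by simp
    qed
    have eq: "indicator K w *\<^sub>R coef Y V z \<tau> (pb W' p q \<alpha>) I J k w =
        indicator K w *\<^sub>R coef X (A \<inter> g -` V) (z \<circ> g) \<sigma> \<alpha> I J k w" for w
    proof (cases "w \<in> K")
      case True
      have "coef Y V z \<tau> (pb W' p q \<alpha>) I J k w = coef X (A \<inter> g -` V) (z \<circ> g) \<sigma> \<alpha> I J k w"
        by (rule coef_pb) (use V IJ S True in auto)
      then show ?thesis by simp
    qed simp
    show "set_integrable (lebC n) K (coef Y V z \<tau> (pb W' p q \<alpha>) I J k)"
      unfolding set_integrable_def eq by (rule int[unfolded set_integrable_def])
  qed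
qed

lemma dbar_distr_pb:
  assumes d: "dbar_distr X n E W p q \<alpha> \<beta>"
  shows "dbar_distr Y n E' W' p q (pb W' p q \<alpha>) (pb W' p (Suc q) \<beta>)"
  unfolding dbar_distr_def
proof (intro conjI allI ballI, goal_cases)
  case 1 show ?case using d by (intro locally_integrable_form_pb) (simp add: dbar_distr_def)
next
  case 2 show ?case using d by (intro locally_integrable_form_pb) (simp add: dbar_distr_def)
next
  case (3 V z \<psi> t)
  obtain T \<tau> where t: "t = (T, \<tau>)" by force
  show ?case unfolding t prod.case
  proof (intro ballI allI impI)
    fix I J k assume IJ: "I \<in> indices n p" "J \<in> indices n (Suc q)" and k: "k < vb_rank E'"
      and V: "chart Y n V z \<and> V \<subseteq> W' \<inter> T \<and> test_function n (z ` V) \<psi>"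
    obtain S \<sigma> where S: "(S, \<sigma>) \<in> vb_trivs E" "A \<inter> g -` V \<subseteq> W \<inter> S" "\<And>y. y \<in> V \<Longrightarrow> \<tau> y = \<sigma> (f y)"
      using triv_pullback[of T \<tau> V] 3 V t by blast
    have VB: "V \<subseteq> B" using V chart_sub(1)[of V] by auto
    have ch: "chart X n (A \<inter> g -` V) (z \<circ> g)" using chart_pushforward V VB by blast
    let ?a = "coef X (A \<inter> g -` V) (z \<circ> g) \<sigma> \<alpha>" and ?b = "coef X (A \<inter> g -` V) (z \<circ> g) \<sigma> \<beta>"
    have im: "(z \<circ> g) ` (A \<inter> g -` V) = z ` V" by (rule chart_image[OF VB])
    have eq: "(LINT y:(z \<circ> g) ` (A \<inter> g -` V)|lebC n. ?b I J k y * \<psi> y) =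
        (-1) ^ p * (\<Sum>j\<in>J. (-1) ^ card {l\<in>J. l < j} *
           - (LINT y:(z \<circ> g) ` (A \<inter> g -` V)|lebC n. ?a I (J - {j}) k y * dzbar j \<psi> y))"
    proof -
      have t': "test_function n ((z \<circ> g) ` (A \<inter> g -` V)) \<psi>" unfolding im using V by blast
      have "\<forall>(T, \<tau>)\<in>vb_trivs E. \<forall>I\<in>indices n p. \<forall>J\<in>indices n (Suc q). \<forall>k<vb_rank E.
        chart X n (A \<inter> g -` V) (z \<circ> g) \<and> A \<inter> g -` V \<subseteq> W \<inter> T \<and>
          test_function n ((z \<circ> g) ` (A \<inter> g -` V)) \<psi> \<longrightarrow>
        (LINT y:(z \<circ> g) ` (A \<inter> g -` V)|lebC n. coef X (A \<inter> g -` V) (z \<circ> g) \<tau> \<beta> I J k y * \<psi> y) =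
        (-1) ^ p * (\<Sum>j\<in>J. (-1) ^ card {l\<in>J. l < j} *
           - (LINT y:(z \<circ> g) ` (A \<inter> g -` V)|lebC n. coef X (A \<inter> g -` V) (z \<circ> g) \<tau> \<alpha> I (J - {j}) k y * dzbar j \<psi> y))"
        by (rule spec[OF spec[OF spec[OF conjunct2[OF conjunct2[OF d[unfolded dbar_distr_def]]],
          of "A \<inter> g -` V"], of "z \<circ> g"], of \<psi>])
      from bspec[OF this S(1)] show ?thesis using IJ k rank ch S(2) t' by simp
    qed
    have b: "(LINT y:z ` V|lebC n. coef Y V z \<tau> (pb W' p (Suc q) \<beta>) I J k y * \<psi> y) =
        (LINT y:z ` V|lebC n. ?b I J k y * \<psi> y)"
      unfolding set_lebesgue_integral_def
    proof (rule Bochner_Integration.integral_cong[OF refl])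
      fix w
      have "coef Y V z \<tau> (pb W' p (Suc q) \<beta>) I J k w = ?b I J k w" if "w \<in> z ` V"
        by (rule coef_pb) (use V IJ S that in auto)
      then show "indicat_real (z ` V) w *\<^sub>R (coef Y V z \<tau> (pb W' p (Suc q) \<beta>) I J k w * \<psi> w) =
          indicat_real (z ` V) w *\<^sub>R (?b I J k w * \<psi> w)" by (cases "w \<in> z ` V") auto
    qed
    have a: "(LINT y:z ` V|lebC n. coef Y V z \<tau> (pb W' p q \<alpha>) I (J - {j}) k y * dzbar j \<psi> y) =
        (LINT y:z ` V|lebC n. ?a I (J - {j}) k y * dzbar j \<psi> y)" if j: "j \<in> J" for j
      unfolding set_lebesgue_integral_def
    proof (rule Bochner_Integration.integral_cong[OF refl])
      fix w
      have "finite J" using IJ by (auto simp: indices_def intro: finite_subset)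
      then have "J - {j} \<in> indices n q" using IJ j by (auto simp: indices_def)
      then have "coef Y V z \<tau> (pb W' p q \<alpha>) I (J - {j}) k w = ?a I (J - {j}) k w" if "w \<in> z ` V"
        by (intro coef_pb) (use V IJ S that in auto)
      then show "indicat_real (z ` V) w *\<^sub>R (coef Y V z \<tau> (pb W' p q \<alpha>) I (J - {j}) k w * dzbar j \<psi> w) =
          indicat_real (z ` V) w *\<^sub>R (?a I (J - {j}) k w * dzbar j \<psi> w)" by (cases "w \<in> z ` V") auto
    qed
    show "(LINT y:z ` V|lebC n. coef Y V z \<tau> (pb W' p (Suc q) \<beta>) I J k y * \<psi> y) =
        (-1) ^ p * (\<Sum>j\<in>J. (-1) ^ card {l\<in>J. l < j} *
           - (LINT y:z ` V|lebC n. coef Y V z \<tau> (pb W' p q \<alpha>) I (J - {j}) k y * dzbar j \<psi> y))"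
      unfolding b using eq a unfolding im by simp
  qed
qed

lemma pb_zero:
  "pb W' p q (mk_form X W p q (\<lambda>x vs ws. vb_zero E x)) = mk_form Y W' p q (\<lambda>y vs ws. vb_zero E' y)"
proof (intro ext)
  fix y vs ws
  show "pb W' p q (mk_form X W p q (\<lambda>x vs ws. vb_zero E x)) y vs ws = mk_form Y W' p q (\<lambda>y vs ws. vb_zero E' y) y vs ws"
  proof (cases "form_args Y W' p q y vs ws")
    case True
    then have "y \<in> B" using W' by (auto simp: form_args_def)
    then show ?thesis using True pb_args[OF True] by (simp add: pb_apply mk_form_def zero)
  qed (simp add: pullback_form_def mk_form_def)
qed

text \<open>
  In corresponding charts both norm densities are equal to the squared norm of the value of the form
  on the coordinate frame, which does not involve the metrics \<open>kX\<close> and \<open>kY\<close>. A family of pieces on \<open>Y\<close> is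
  carried over to \<open>X\<close>; the opposite inequality is the same statement for the inverse map.
\<close>

lemma norm_integral_pb_le:
  assumes kX: "\<And>x. x \<in> A \<Longrightarrow> hermitian_form_on (tangent_space X x) (kX x)"
    and kY: "\<And>y. y \<in> B \<Longrightarrow> hermitian_form_on (tangent_space Y y) (kY y)"
    and h: "\<And>x. x \<in> A \<Longrightarrow> homogeneous_norm E h x" and h': "\<And>y. y \<in> B \<Longrightarrow> h' y = h (f y)"
    and \<alpha>: "is_form X E W n 0 \<alpha>" and U: "U \<subseteq> W"
  shows "manifold_nn_integral Y n kY (B \<inter> f -` U) (form_norm2 Y n kY h' n 0 (pb W' n 0 \<alpha>)) \<le>
    manifold_nn_integral X n kX U (form_norm2 X n kX h n 0 \<alpha>)"
  unfolding manifold_nn_integral_def[of Y]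
proof (rule SUP_least)
  let ?\<beta> = "pb W' n 0 \<alpha>"
  fix \<P> assume "\<P> \<in> {\<P>. finite \<P> \<and> disjoint_family_on fst \<P> \<and>
          (\<forall>(P, V, z)\<in>\<P>. chart Y n V z \<and> V \<subseteq> B \<inter> f -` U \<and> P \<subseteq> V \<and> z ` P \<in> sets (lebC n))}"
  then have fin: "finite \<P>" and disj: "disjoint_family_on fst \<P>"
    and p: "\<And>P V z. (P, V, z) \<in> \<P> \<Longrightarrow> chart Y n V z \<and> V \<subseteq> B \<inter> f -` U \<and> P \<subseteq> V \<and> z ` P \<in> sets (lebC n)"
    by auto
  let ?P = "\<lambda>j. fst j" and ?V = "\<lambda>j. fst (snd j)" and ?z = "\<lambda>j. snd (snd j)"
  have pj: "chart Y n (?V j) (?z j)" "?V j \<subseteq> B" "?V j \<subseteq> f -` U" "?P j \<subseteq> ?V j" "?z j ` ?P j \<in> sets (lebC n)"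
    if "j \<in> \<P>" for j using p[of "?P j" "?V j" "?z j"] that by auto
  let ?Q = "\<lambda>j. A \<inter> g -` ?P j" and ?U = "\<lambda>j. A \<inter> g -` ?V j" and ?w = "\<lambda>j. ?z j \<circ> g"
  have "(\<Sum>(P, V, z)\<in>\<P>. \<integral>\<^sup>+y\<in>z ` P. form_norm2 Y n kY h' n 0 ?\<beta> (inv_into V z y) *
        vol_density Y n kY V z (inv_into V z y) \<partial>lebC n) =
      (\<Sum>j\<in>\<P>. \<integral>\<^sup>+y\<in>?z j ` ?P j. form_norm2 Y n kY h' n 0 ?\<beta> (inv_into (?V j) (?z j) y) *
        vol_density Y n kY (?V j) (?z j) (inv_into (?V j) (?z j) y) \<partial>lebC n)"
    by (simp add: case_prod_unfold)
  also have "\<dots> = (\<Sum>j\<in>\<P>. \<integral>\<^sup>+y\<in>?w j ` ?Q j. form_norm2 X n kX h n 0 \<alpha> (inv_into (?U j) (?w j) y) *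
        vol_density X n kX (?U j) (?w j) (inv_into (?U j) (?w j) y) \<partial>lebC n)"
  proof (rule sum.cong[OF refl], rule nn_integral_cong)
    fix j y assume j: "j \<in> \<P>"
    have chY: "chart Y n (?V j) (?z j)" and VB: "?V j \<subseteq> B" using pj[OF j] by auto
    have chX: "chart X n (?U j) (?w j)" by (rule chart_pushforward[OF chY VB])
    have im: "?w j ` ?Q j = ?z j ` ?P j" by (rule chart_image) (use pj[OF j] in auto)
    show "form_norm2 Y n kY h' n 0 ?\<beta> (inv_into (?V j) (?z j) y) *
        vol_density Y n kY (?V j) (?z j) (inv_into (?V j) (?z j) y) * indicator (?z j ` ?P j) y =
      form_norm2 X n kX h n 0 \<alpha> (inv_into (?U j) (?w j) y) *
        vol_density X n kX (?U j) (?w j) (inv_into (?U j) (?w j) y) * indicator (?w j ` ?Q j) y"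
    proof (cases "y \<in> ?z j ` ?P j")
      case True
      then have yV: "y \<in> ?z j ` ?V j" using pj(4)[OF j] by blast
      let ?y = "inv_into (?V j) (?z j) y"
      have yi: "?y \<in> ?V j" by (rule inv_into_into[OF yV])
      have inv: "inv_into (?U j) (?w j) y = f ?y" by (rule inv_chart_pushforward[OF chY VB yV])
      have yB: "?y \<in> B" and fy: "f ?y \<in> U" "f ?y \<in> A" using yi pj[OF j] f_in by auto
      have yW: "?y \<in> W'" "f ?y \<in> W" using yB fy U W' by auto
      have fyU: "f ?y \<in> ?U j" using fy yi yB g_f by auto
      obtain t where t: "linear_fibre E (f ?y) t" using linear fy by blast
      obtain t' where t': "linear_fibre E' ?y t'" using linear' yB by blast
      have hom': "homogeneous_norm E' h' ?y"
        using h[OF fy(2)] unfolding homogeneous_norm_def by (simp add: fibre[OF yB] scale[OF yB] h'[OF yB])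
      have "form_norm2 Y n kY h' n 0 ?\<beta> ?y * vol_density Y n kY (?V j) (?z j) ?y =
          h' ?y (?\<beta> ?y (map (coord_vec Y (?V j) (?z j) ?y) [0..<n]) [])"
        by (rule form_norm2_vol_density[where g = kY, OF sheaf_Y chY yi yW(1) kY[OF yB] pb_is_form[OF \<alpha>] t' hom'])
      also have "\<dots> = h (f ?y) (\<alpha> (f ?y) (map (coord_vec X (?U j) (?w j) (f ?y)) [0..<n]) [])"
      proof -
        have args: "form_args Y W' n 0 ?y (map (coord_vec Y (?V j) (?z j) ?y) [0..<n]) []"
          using yW coord_vec_in_tangent_space[OF sheaf_Y chY yi] by (auto simp: form_args_def)
        have m: "map (df ?y) (map (coord_vec Y (?V j) (?z j) ?y) [0..<n]) =
            map (coord_vec X (?U j) (?w j) (f ?y)) [0..<n]"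
          using differential_coord_vec[OF chY VB yi] by simp
        show ?thesis unfolding pb_apply[OF args] h'[OF yB] m by simp
      qed
      also have "\<dots> = form_norm2 X n kX h n 0 \<alpha> (f ?y) * vol_density X n kX (?U j) (?w j) (f ?y)"
        by (rule form_norm2_vol_density[where g = kX, OF sheaf_X chX fyU yW(2) kX[OF fy(2)] \<alpha> t h[OF fy(2)], symmetric])
      finally show ?thesis unfolding im inv by simp
    next
      case False
      then show ?thesis unfolding im by simp
    qed
  qed
  also have "\<dots> \<le> manifold_nn_integral X n kX U (form_norm2 X n kX h n 0 \<alpha>)"
  proof (rule manifold_nn_integral_upper[OF fin])
    show "disjoint_family_on ?Q \<P>" using disj unfolding disjoint_family_on_def by blast
    fix j assume j: "j \<in> \<P>"
    show "chart X n (?U j) (?w j)" by (rule chart_pushforward[OF pj(1,2)[OF j]])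
    show "?U j \<subseteq> U" using pj(3)[OF j] f_g by auto
    show "?Q j \<subseteq> ?U j" using pj(4)[OF j] by blast
    have "?w j ` ?Q j = ?z j ` ?P j" by (rule chart_image) (use pj[OF j] in auto)
    then show "?w j ` ?Q j \<in> sets (lebC n)" using pj(5)[OF j] by simp
  qed
  finally show "(\<Sum>(P, V, z)\<in>\<P>. \<integral>\<^sup>+y\<in>z ` P. form_norm2 Y n kY h' n 0 ?\<beta> (inv_into V z y) *
        vol_density Y n kY V z (inv_into V z y) \<partial>lebC n) \<le>
    manifold_nn_integral X n kX U (form_norm2 X n kX h n 0 \<alpha>)" .
qed

end

end

section \<open>Comparison of the sheaves\<close>

lemma measurable_zero_form:
  assumes E: "holomorphic_vector_bundle X A E" and fs: "function_sheaf X" and W: "W \<subseteq> A"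
  shows "measurable_form X n E W p q (mk_form X W p q (\<lambda>x vs ws. vb_zero E x))"
proof -
  let ?Z = "mk_form X W p q (\<lambda>x vs ws. vb_zero E x)"
  have Z: "?Z x vs ws = vb_zero E x" if "form_args X W p q x vs ws" for x vs ws
    using that by (simp add: mk_form_def)
  have "is_form X E W p q ?Z"
    unfolding is_form_def
  proof (intro conjI allI impI ballI)
    show "mk_form X W p q ?Z = ?Z" by (simp add: mk_form_def fun_eq_iff)
    fix x vs ws assume a: "form_args X W p q x vs ws"
    then have "x \<in> A" using W by (auto simp: form_args_def)
    then obtain t where t: "linear_fibre E x t" using holomorphic_vector_bundle_fibre[OF E] by blast
    note L = linear_fibreD[OF t]
    have z: "vb_add E x (vb_scale E x a (vb_zero E x)) (vb_scale E x b (vb_zero E x)) = vb_zero E x" for a b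
      by (rule linear_fibre_eqI[OF t]) (simp_all add: L)
    show "?Z x vs ws \<in> vb_fibre E x" using L(1) Z[OF a] by simp
    show "?Z x vs ws = vb_zero E x" by (rule Z[OF a])
    fix i u v c d assume u: "u \<in> tangent_space X x" and v: "v \<in> tangent_space X x"
    have av: "form_args X W p q x (vs[i := w]) ws" "form_args X W p q x vs (ws[i := w])"
      if "w \<in> tangent_space X x" for w
      using a that set_update_subset_insert[of vs i w] set_update_subset_insert[of ws i w]
      unfolding form_args_def by auto
    note Zs = Z[OF av(1)[OF u]] Z[OF av(1)[OF v]] Z[OF av(1)[OF tangent_space_tcomb[OF u v]]]
      Z[OF av(2)[OF u]] Z[OF av(2)[OF v]] Z[OF av(2)[OF tangent_space_tcomb[OF u v]]]
    show "?Z x (vs[i := tcomb c u d v]) ws =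
        vb_add E x (vb_scale E x c (?Z x (vs[i := u]) ws)) (vb_scale E x d (?Z x (vs[i := v]) ws))"
      by (simp only: Zs z)
    show "?Z x vs (ws[i := tcomb c u d v]) =
        vb_add E x (vb_scale E x (cnj c) (?Z x vs (ws[i := u]))) (vb_scale E x (cnj d) (?Z x vs (ws[i := v])))"
      by (simp only: Zs z)
  qed
  moreover have "coef X V z \<tau> ?Z I J k \<in> borel_measurable (restrict_space (lebC n) (z ` V))"
    if T: "(T, \<tau>) \<in> vb_trivs E" and IJ: "I \<in> indices n p" "J \<in> indices n q" and k: "k < vb_rank E"
      and ch: "chart X n V z" and V: "V \<subseteq> W \<inter> T" for T \<tau> I J k V z
  proof -
    have "coef X V z \<tau> ?Z I J k w = 0" if "w \<in> space (restrict_space (lebC n) (z ` V))" for w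
    proof -
      have "w \<in> z ` V" using that by (simp add: space_restrict_space)
      then have y: "inv_into V z w \<in> V" by (rule inv_into_into)
      have fin: "finite I" "finite J" using IJ by (auto simp: indices_def intro: finite_subset)
      have lt: "i < n" if "i \<in> I \<or> i \<in> J" for i using that IJ by (auto simp: indices_def)
      have "form_args X W p q (inv_into V z w)
          (map (coord_vec X V z (inv_into V z w)) (sorted_list_of_set I))
          (map (coord_vec X V z (inv_into V z w)) (sorted_list_of_set J))"
        using y V IJ fin lt coord_vec_in_tangent_space[OF fs ch y]
        by (auto simp: form_args_def indices_def)
      moreover have "linear_fibre E (inv_into V z w) (\<tau> (inv_into V z w))"
        by (rule holomorphic_vector_bundle_triv(3)[OF E T]) (use y V in blast)
      ultimately show ?thesis
        unfolding coef_def Let_def using Z linear_fibreD(4)[OF _ k] by simp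
    qed
    then show ?thesis using measurable_cong[of _ "coef X V z \<tau> ?Z I J k" "\<lambda>_. 0"] by simp
  qed
  ultimately show ?thesis unfolding measurable_form_def by blast
qed

text \<open>
  The norm of the derivative depends on the metric, and so does the space of \<open>L\<^sup>2\<close> forms with
  \<open>L\<^sup>2\<close> derivative. On the kernel of \<open>dbar\<close> the condition on the derivative disappears: the zero form
  can serve as the derivative, and its norm vanishes for every metric.
\<close>

lemma dbar_closed_L2_forms:
  assumes fs: "function_sheaf X" and k: "\<And>x. x \<in> A \<Longrightarrow> hermitian_form_on (tangent_space X x) (k x)"
    and E: "\<And>x. x \<in> A \<Longrightarrow> \<exists>t. linear_fibre E x t"
    and h: "\<And>x. x \<in> A \<Longrightarrow> homogeneous_norm E h x"
    and U: "openin (ctop X) U"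
    and Z: "measurable_form X n E (U \<inter> A) p (Suc q) Z"
    and Z_def: "Z = mk_form X (U \<inter> A) p (Suc q) (\<lambda>x vs ws. vb_zero E x)"
  shows "{\<alpha> \<in> L2_forms X n A E k h p q U. dbar_distr X n E (U \<inter> A) p q \<alpha> Z} =
    {\<alpha>. measurable_form X n E (U \<inter> A) p q \<alpha> \<and> square_integrable X n A k h p q U \<alpha> \<and>
       dbar_distr X n E (U \<inter> A) p q \<alpha> Z}"
proof -
  have zero: "manifold_nn_integral X n k (U \<inter> A) (form_norm2 X n k h p (Suc q) Z) = 0"
  proof (rule manifold_nn_integral_zero)
    fix x V z assume ch: "chart X n V z" and x: "x \<in> V" and V: "V \<subseteq> U \<inter> A"
    then have xA: "x \<in> A" "x \<in> U \<inter> A" by auto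
    obtain t where t: "linear_fibre E x t" using E xA by blast
    show "form_norm2 X n k h p (Suc q) Z x = 0"
      unfolding Z_def
      by (rule form_norm2_zero_form[where g = k, OF fs ch x xA(2) k[OF xA(1)] t h[OF xA(1)]])
  qed
  have "square_integrable X n A k h p (Suc q) U Z"
    unfolding square_integrable_def
  proof
    fix x assume "x \<in> U"
    then show "\<exists>V. openin (ctop X) V \<and> x \<in> V \<and> V \<subseteq> U \<and>
        manifold_nn_integral X n k (V \<inter> A) (form_norm2 X n k h p (Suc q) Z) < \<infinity>"
      using zero U by (intro exI[of _ U]) simp
  qed
  then show ?thesis unfolding L2_forms_def using Z by blast
qed

lemma form_class_empty: "form_class X n E {} p q \<alpha> = {\<lambda>_ _ _. undefined}"
proof -
  have "measurable_form X n E {} p q \<beta> \<longleftrightarrow> \<beta> = (\<lambda>_ _ _. undefined)" for \<beta>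
  proof -
    have "is_form X E {} p q \<beta> \<longleftrightarrow> \<beta> = (\<lambda>_ _ _. undefined)"
      by (auto simp: is_form_def mk_form_def form_args_def fun_eq_iff)
    moreover have "u \<in> borel_measurable (restrict_space M {})" for u :: "'x \<Rightarrow> complex" and M
      by (auto simp: measurable_def space_restrict_space)
    ultimately show ?thesis by (auto simp: measurable_form_def)
  qed
  then show ?thesis by (auto simp: form_class_def ae_equal_def)
qed

lemma manifold_nn_integral_empty: "manifold_nn_integral X n g {} f = 0"
proof (rule manifold_nn_integral_zero)
  fix x V assume "x \<in> V" "V \<subseteq> ({} :: 'a set)"
  then show "f x = 0" by blast
qed

lemma dbar_distr_empty: "dbar_distr X n E {} p q \<alpha> \<beta>"
proof -
  have "locally_integrable_form X n E {} p q \<alpha>" for q \<alpha>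
    by (auto simp: locally_integrable_form_def set_integrable_def)
  then show ?thesis by (auto simp: dbar_distr_def set_lebesgue_integral_def)
qed

text \<open>
  Over the empty set there is a single form, whatever its degree. This settles the case of an empty
  \<open>Xo\<close>, in which the dimensions of the two spaces are unrelated.
\<close>

lemma S_sheaf_empty:
  "S_sheaf X n {} g E h = S_sheaf X m {} g E h"
proof -
  have si: "square_integrable X n {} g h p q U \<alpha> \<longleftrightarrow>
      (\<forall>x\<in>U. \<exists>V. openin (ctop X) V \<and> x \<in> V \<and> V \<subseteq> U)" for n p q U and \<alpha> :: "('a, 'b) form"
    by (simp add: square_integrable_def manifold_nn_integral_empty)
  have mf: "measurable_form X n E {} p q (\<lambda>_ _ _. undefined)" for n p q
    using form_class_empty[of X n E p q "\<lambda>_ _ _. undefined"] by (auto simp: form_class_def)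
  have L: "{\<alpha> \<in> L2_forms X n {} E g h n 0 U. dbar_distr X n E (U \<inter> {}) n 0 \<alpha> Z} = {} \<longleftrightarrow>
      \<not> (\<forall>x\<in>U. \<exists>V. openin (ctop X) V \<and> x \<in> V \<and> V \<subseteq> U)" for n U and Z :: "('a, 'b) form"
    unfolding L2_forms_def Int_empty_right si using mf[of n n 0] mf[of n n "Suc 0"]
    by (auto simp: dbar_distr_empty)
  have sec: "form_class X n E (U \<inter> {}) n 0 `
        {\<alpha> \<in> L2_forms X n {} E g h n 0 U. dbar_distr X n E (U \<inter> {}) n 0 \<alpha> Z} =
      (if \<forall>x\<in>U. \<exists>V. openin (ctop X) V \<and> x \<in> V \<and> V \<subseteq> U then {{\<lambda>_ _ _. undefined}} else {})"
    for n U and Z :: "('a, 'b) form"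
    using L[of n U Z] unfolding Int_empty_right form_class_empty by auto
  show ?thesis unfolding S_sheaf_def sec unfolding Int_empty_right form_class_empty ..
qed

context bundle_biholomorphism
begin

context
  fixes W W' assumes W: "W \<subseteq> A" and W': "W' = B \<inter> f -` W"
begin

lemma pb_mk_form:
  "pb W' p q (mk_form X W p q \<alpha>) =
    mk_form Y W' p q (\<lambda>y vs ws. \<alpha> (f y) (map (df y) vs) (map (df y) ws))"
proof (intro ext)
  fix y vs ws
  show "pb W' p q (mk_form X W p q \<alpha>) y vs ws =
      mk_form Y W' p q (\<lambda>y vs ws. \<alpha> (f y) (map (df y) vs) (map (df y) ws)) y vs ws"
    using pb_args[OF W W', of p q y vs ws] by (simp add: pullback_form_def mk_form_def)
qed

lemma pb_form_class:
  assumes \<gamma>: "mk_form X W p q \<gamma> = \<gamma>"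
  shows "pb W' p q ` form_class X n E W p q \<gamma> = form_class Y n E' W' p q (pb W' p q \<gamma>)"
proof
  interpret rev: bundle_biholomorphism Y X B A g f E' E by (rule reverse_bundle)
  have W'B: "W' \<subseteq> B" unfolding W' by blast
  note Wi = W'_image[OF W W']
  show "pb W' p q ` form_class X n E W p q \<gamma> \<subseteq> form_class Y n E' W' p q (pb W' p q \<gamma>)"
    unfolding form_class_def using measurable_form_pb[OF W W'] ae_equal_pb[OF W W'] by blast
  show "form_class Y n E' W' p q (pb W' p q \<gamma>) \<subseteq> pb W' p q ` form_class X n E W p q \<gamma>"
  proof
    fix \<beta> assume "\<beta> \<in> form_class Y n E' W' p q (pb W' p q \<gamma>)"
    then have m: "measurable_form Y n E' W' p q \<beta>" and ae: "ae_equal Y n W' (pb W' p q \<gamma>) \<beta>"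
      by (auto simp: form_class_def)
    have "measurable_form X n E W p q (rev.pb W p q \<beta>)" by (rule rev.measurable_form_pb[OF W'B Wi m])
    moreover have "ae_equal X n W \<gamma> (rev.pb W p q \<beta>)"
      using rev.ae_equal_pb[OF W'B Wi ae, of p q] pb_inverse[OF W W' \<gamma>] by simp
    moreover have "pb W' p q (rev.pb W p q \<beta>) = \<beta>"
      by (rule rev.pb_inverse[OF W'B Wi]) (use m in \<open>simp add: measurable_form_def is_form_def\<close>)
    ultimately show "\<beta> \<in> pb W' p q ` form_class X n E W p q \<gamma>"
      unfolding form_class_def by (metis (mono_tags, lifting) image_eqI mem_Collect_eq)
  qed
qed

end

end

text \<open>
  Here the spaces outside \<open>A\<close> and \<open>B\<close> come in: \<open>f\<close> is defined on all of \<open>Y\<close>, and \<open>B\<close> is the full preimage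
  of \<open>A\<close>. Nothing relates the metrics \<open>kX\<close> and \<open>kY\<close> to each other.
\<close>

locale proper_modification = bundle_biholomorphism X Y A B f g E E'
  for X :: "'a cspace" and Y :: "'b cspace" and A B f g
    and E :: "('a, 'e) vbundle" and E' :: "('b, 'e) vbundle" +
  fixes n :: nat and kX kY and h :: "'a \<Rightarrow> 'e \<Rightarrow> ennreal" and h' :: "'b \<Rightarrow> 'e \<Rightarrow> ennreal"
  assumes continuous: "continuous_map (ctop Y) (ctop X) f"
    and proper: "proper_map (ctop Y) (ctop X) f"
    and B_eq: "B = preim Y f A"
    and kX: "\<And>x. x \<in> A \<Longrightarrow> hermitian_form_on (tangent_space X x) (kX x)"
    and kY: "\<And>y. y \<in> B \<Longrightarrow> hermitian_form_on (tangent_space Y y) (kY y)"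
    and hX: "\<And>x. x \<in> A \<Longrightarrow> homogeneous_norm E h x"
    and h': "\<And>y. y \<in> B \<Longrightarrow> h' y = h (f y)"
    and zero_measurable: "\<And>W p q. W \<subseteq> A \<Longrightarrow>
      measurable_form X n E W p q (mk_form X W p q (\<lambda>x vs ws. vb_zero E x))"
begin

lemma hY: "y \<in> B \<Longrightarrow> homogeneous_norm E' h' y"
  using hX[OF f_in, of y] unfolding homogeneous_norm_def by (simp add: fibre scale h')

lemma preim_Int: "preim Y f U \<inter> B = B \<inter> f -` (U \<inter> A)"
  unfolding B_eq preim_def by auto

lemma preim_open: "openin (ctop X) U \<Longrightarrow> openin (ctop Y) (preim Y f U)"
  unfolding preim_def by (rule openin_continuous_map_preimage[OF continuous])

text \<open>
  The complement of \<open>O'\<close> has a closed image that misses \<open>x\<close>.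
\<close>

lemma tube:
  assumes O: "openin (ctop Y) O'" and x: "x \<in> topspace (ctop X)" and sub: "preim Y f {x} \<subseteq> O'"
  shows "\<exists>V. openin (ctop X) V \<and> x \<in> V \<and> preim Y f V \<subseteq> O'"
proof -
  let ?C = "f ` (topspace (ctop Y) - O')"
  have "closed_map (ctop Y) (ctop X) f" using proper by (simp add: proper_map_def)
  then have "closedin (ctop X) ?C" using O unfolding closed_map_def by blast
  then have "openin (ctop X) (topspace (ctop X) - ?C)" by blast
  moreover have "x \<in> topspace (ctop X) - ?C" using x sub by (auto simp: preim_def)
  moreover have "preim Y f (topspace (ctop X) - ?C) \<subseteq> O'" by (auto simp: preim_def)
  ultimately show ?thesis by blast
qed

context
  fixes U assumes U: "openin (ctop X) U"
begin

abbreviation "W \<equiv> U \<inter> A"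
abbreviation "W' \<equiv> preim Y f U \<inter> B"
abbreviation "pbU \<equiv> pb W' n 0"

lemma W_sub: "W \<subseteq> A" by blast
lemma W'_eq: "W' = B \<inter> f -` W" by (rule preim_Int)
lemma W'_sub: "W' \<subseteq> B" by blast

text \<open>
  By continuity, a neighbourhood of \<open>f y\<close> on which the integral is finite pulls back to one of \<open>y\<close>.
\<close>

lemma square_integrable_pullback:
  assumes \<alpha>: "is_form X E W n 0 \<alpha>" and sq: "square_integrable X n A kX h n 0 U \<alpha>"
  shows "square_integrable Y n B kY h' n 0 (preim Y f U) (pbU \<alpha>)"
  unfolding square_integrable_def
proof
  fix y assume "y \<in> preim Y f U"
  then have y: "y \<in> topspace (ctop Y)" "f y \<in> U" by (auto simp: preim_def)
  then obtain V where V: "openin (ctop X) V" "f y \<in> V" "V \<subseteq> U"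
    and fin: "manifold_nn_integral X n kX (V \<inter> A) (form_norm2 X n kX h n 0 \<alpha>) < \<infinity>"
    using sq unfolding square_integrable_def by blast
  have "manifold_nn_integral Y n kY (B \<inter> f -` (V \<inter> A)) (form_norm2 Y n kY h' n 0 (pbU \<alpha>)) \<le>
      manifold_nn_integral X n kX (V \<inter> A) (form_norm2 X n kX h n 0 \<alpha>)"
    by (rule norm_integral_pb_le[OF W_sub W'_eq kX kY hX h' \<alpha>]) (use V in auto)
  then have "manifold_nn_integral Y n kY (preim Y f V \<inter> B) (form_norm2 Y n kY h' n 0 (pbU \<alpha>)) < \<infinity>"
    unfolding preim_Int using fin by (rule le_less_trans)
  then show "\<exists>V. openin (ctop Y) V \<and> y \<in> V \<and> V \<subseteq> preim Y f U \<and>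
      manifold_nn_integral Y n kY (V \<inter> B) (form_norm2 Y n kY h' n 0 (pbU \<alpha>)) < \<infinity>"
    using preim_open[OF V(1)] y V by (intro exI[of _ "preim Y f V"]) (auto simp: preim_def)
qed

text \<open>
  The fibre over \<open>x\<close> is compact, hence covered by finitely many open sets over which the integral is
  finite, and by \<open>tube\<close> their union contains the preimage of a neighbourhood of \<open>x\<close>. If the fibre is
  empty, the neighbourhood has empty preimage and therefore does not meet \<open>A\<close>.
\<close>

lemma square_integrable_pushforward:
  assumes \<alpha>: "is_form X E W n 0 \<alpha>"
    and sq: "square_integrable Y n B kY h' n 0 (preim Y f U) (pbU \<alpha>)"
  shows "square_integrable X n A kX h n 0 U \<alpha>"
  unfolding square_integrable_def
proof
  interpret rev: bundle_biholomorphism Y X B A g f E' E by (rule reverse_bundle)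
  let ?M = "\<lambda>S. manifold_nn_integral Y n kY S (form_norm2 Y n kY h' n 0 (pbU \<alpha>))"
  fix x assume xU: "x \<in> U"
  then have x: "x \<in> topspace (ctop X)" using U openin_subset by blast
  let ?K = "preim Y f {x}"
  have "compactin (ctop Y) {y \<in> topspace (ctop Y). f y = x}"
    using proper x by (simp add: proper_map_def)
  then have K: "compactin (ctop Y) ?K" by (simp add: preim_def)
  let ?\<O> = "{V. openin (ctop Y) V \<and> ?M (V \<inter> B) < \<infinity>}"
  have "?K \<subseteq> \<Union>?\<O>"
  proof
    fix y assume "y \<in> ?K"
    then have "y \<in> preim Y f U" using xU by (auto simp: preim_def)
    then show "y \<in> \<Union>?\<O>" using sq unfolding square_integrable_def by blast
  qed
  then obtain \<V> where \<V>: "finite \<V>" "\<V> \<subseteq> ?\<O>" "?K \<subseteq> \<Union>\<V>"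
    using compactinD[OF K, of ?\<O>] by auto
  have M: "?M (B \<inter> (\<Union>V\<in>\<V>. V)) < \<infinity>"
    by (rule manifold_nn_integral_UN_finite[OF \<V>(1)]) (use \<V>(2) in \<open>auto simp: Int_commute\<close>)
  have "openin (ctop Y) (\<Union>\<V>)" using \<V>(2) by blast
  from tube[OF this x \<V>(3)] obtain V where V: "openin (ctop X) V" "x \<in> V" "preim Y f V \<subseteq> \<Union>\<V>" by blast
  let ?V = "V \<inter> U"
  let ?S = "B \<inter> f -` (?V \<inter> A)"
  have S: "A \<inter> g -` ?S = ?V \<inter> A" by (rule rev.vimage_vimage) blast
  have "manifold_nn_integral X n kX (?V \<inter> A) (form_norm2 X n kX h n 0 \<alpha>) =
      manifold_nn_integral X n kX (A \<inter> g -` ?S) (form_norm2 X n kX h n 0 (rev.pb W n 0 (pbU \<alpha>)))"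
    using pb_inverse[OF W_sub W'_eq, of n 0 \<alpha>] \<alpha> S by (simp add: is_form_def)
  also have "\<dots> \<le> ?M ?S"
  proof (rule rev.norm_integral_pb_le[OF W'_sub W'_image[OF W_sub W'_eq] kY kX hY])
    show "h x = h' (g x)" if "x \<in> A" for x using h'[OF g_in[OF that]] f_g[OF that] by simp
    show "is_form Y E' W' n 0 (pbU \<alpha>)" by (rule pb_is_form[OF W_sub W'_eq \<alpha>])
    show "?S \<subseteq> W'" unfolding W'_eq by blast
  qed
  also have "\<dots> \<le> ?M (B \<inter> (\<Union>V\<in>\<V>. V))"
  proof (rule manifold_nn_integral_mono_set)
    show "?S \<subseteq> B \<inter> (\<Union>V\<in>\<V>. V)"
      using V(3) openin_subset[OF B_open] by (auto simp: preim_def)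
  qed
  also note M
  finally show "\<exists>V. openin (ctop X) V \<and> x \<in> V \<and> V \<subseteq> U \<and>
      manifold_nn_integral X n kX (V \<inter> A) (form_norm2 X n kX h n 0 \<alpha>) < \<infinity>"
    using V U xU by (intro exI[of _ ?V]) auto
qed

abbreviation "closed_forms_X \<equiv> {\<alpha> \<in> L2_forms X n A E kX h n 0 U.
  dbar_distr X n E W n 0 \<alpha> (mk_form X W n 1 (\<lambda>x vs ws. vb_zero E x))}"

abbreviation "closed_forms_Y \<equiv> {\<alpha> \<in> L2_forms Y n B E' kY h' n 0 (preim Y f U).
  dbar_distr Y n E' W' n 0 \<alpha> (mk_form Y W' n 1 (\<lambda>x vs ws. vb_zero E' x))}"

lemma closed_forms_X_eq: "closed_forms_X =
  {\<alpha>. measurable_form X n E W n 0 \<alpha> \<and> square_integrable X n A kX h n 0 U \<alpha> \<and>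
     dbar_distr X n E W n 0 \<alpha> (mk_form X W n 1 (\<lambda>x vs ws. vb_zero E x))}"
  unfolding One_nat_def
  by (rule dbar_closed_L2_forms[OF sheaf_X kX _ hX U zero_measurable[OF W_sub] refl])
    (use linear in auto)

lemma closed_forms_Y_eq: "closed_forms_Y =
  {\<alpha>. measurable_form Y n E' W' n 0 \<alpha> \<and> square_integrable Y n B kY h' n 0 (preim Y f U) \<alpha> \<and>
     dbar_distr Y n E' W' n 0 \<alpha> (mk_form Y W' n 1 (\<lambda>x vs ws. vb_zero E' x))}"
  unfolding One_nat_def
proof (rule dbar_closed_L2_forms[OF sheaf_Y kY _ hY preim_open[OF U] _ refl])
  show "measurable_form Y n E' W' n (Suc 0) (mk_form Y W' n (Suc 0) (\<lambda>x vs ws. vb_zero E' x))"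
    using measurable_form_pb[OF W_sub W'_eq zero_measurable[OF W_sub, of n "Suc 0"]]
    unfolding pb_zero[OF W_sub W'_eq] .
qed (use linear' in auto)

lemma pb_closed_forms: "pbU ` closed_forms_X = closed_forms_Y"
proof
  interpret rev: bundle_biholomorphism Y X B A g f E' E by (rule reverse_bundle)
  note Wi = W'_image[OF W_sub W'_eq]
  show "pbU ` closed_forms_X \<subseteq> closed_forms_Y"
    unfolding closed_forms_X_eq closed_forms_Y_eq
  proof (rule image_subsetI, elim CollectE conjE, intro CollectI conjI)
    fix \<alpha> assume m: "measurable_form X n E W n 0 \<alpha>" and sq: "square_integrable X n A kX h n 0 U \<alpha>"
      and d: "dbar_distr X n E W n 0 \<alpha> (mk_form X W n 1 (\<lambda>x vs ws. vb_zero E x))"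
    show "measurable_form Y n E' W' n 0 (pbU \<alpha>)" by (rule measurable_form_pb[OF W_sub W'_eq m])
    show "square_integrable Y n B kY h' n 0 (preim Y f U) (pbU \<alpha>)"
      by (rule square_integrable_pullback[OF _ sq]) (use m in \<open>simp add: measurable_form_def\<close>)
    show "dbar_distr Y n E' W' n 0 (pbU \<alpha>) (mk_form Y W' n 1 (\<lambda>x vs ws. vb_zero E' x))"
      using dbar_distr_pb[OF W_sub W'_eq d[unfolded One_nat_def]]
      unfolding pb_zero[OF W_sub W'_eq] One_nat_def .
  qed
  show "closed_forms_Y \<subseteq> pbU ` closed_forms_X"
    unfolding closed_forms_X_eq closed_forms_Y_eq
  proof (rule subsetI, elim CollectE conjE)
    fix \<beta> assume m: "measurable_form Y n E' W' n 0 \<beta>"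
      and sq: "square_integrable Y n B kY h' n 0 (preim Y f U) \<beta>"
      and d: "dbar_distr Y n E' W' n 0 \<beta> (mk_form Y W' n 1 (\<lambda>x vs ws. vb_zero E' x))"
    let ?\<alpha> = "rev.pb W n 0 \<beta>"
    have inv: "pbU ?\<alpha> = \<beta>"
      by (rule rev.pb_inverse[OF W'_sub Wi]) (use m in \<open>simp add: measurable_form_def is_form_def\<close>)
    have m': "measurable_form X n E W n 0 ?\<alpha>" by (rule rev.measurable_form_pb[OF W'_sub Wi m])
    moreover have "square_integrable X n A kX h n 0 U ?\<alpha>"
      by (rule square_integrable_pushforward) (use m' sq inv in \<open>simp_all add: measurable_form_def\<close>)
    moreover have "dbar_distr X n E W n 0 ?\<alpha> (mk_form X W n 1 (\<lambda>x vs ws. vb_zero E x))"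
      using rev.dbar_distr_pb[OF W'_sub Wi d[unfolded One_nat_def]]
      unfolding rev.pb_zero[OF W'_sub Wi] One_nat_def .
    ultimately show "\<beta> \<in> pbU ` {\<alpha>. measurable_form X n E W n 0 \<alpha> \<and>
        square_integrable X n A kX h n 0 U \<alpha> \<and>
        dbar_distr X n E W n 0 \<alpha> (mk_form X W n 1 (\<lambda>x vs ws. vb_zero E x))}"
      using inv by (intro image_eqI[of _ _ ?\<alpha>]) auto
  qed
qed

lemma closed_forms_mk_form: "\<alpha> \<in> closed_forms_X \<Longrightarrow> mk_form X W n 0 \<alpha> = \<alpha>"
  unfolding closed_forms_X_eq by (simp add: measurable_form_def is_form_def)

lemma form_class_mk_form: "\<beta> \<in> form_class X n E W n 0 \<alpha> \<Longrightarrow> mk_form X W n 0 \<beta> = \<beta>"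
  by (simp add: form_class_def measurable_form_def is_form_def)

lemma inj_on_pb: "inj_on pbU {\<beta>. mk_form X W n 0 \<beta> = \<beta>}"
  by (rule inj_on_inverseI[where g = "pullback_form X Y g W n 0"]) (simp add: pb_inverse[OF W_sub W'_eq])

text \<open>
  Sections are classes of forms modulo equality almost everywhere. The map on forms is injective on all
  representatives, hence the map on classes is injective as well.
\<close>

lemma pb_sections_bij:
  "bij_betw ((`) pbU) (form_class X n E W n 0 ` closed_forms_X) (form_class Y n E' W' n 0 ` closed_forms_Y)"
proof (rule bij_betw_imageI)
  show "inj_on ((`) pbU) (form_class X n E W n 0 ` closed_forms_X)"
  proof (rule inj_onI)
    fix c d assume "c \<in> form_class X n E W n 0 ` closed_forms_X" "d \<in> form_class X n E W n 0 ` closed_forms_X"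
      and eq: "pbU ` c = pbU ` d"
    then have "c \<subseteq> {\<beta>. mk_form X W n 0 \<beta> = \<beta>}" "d \<subseteq> {\<beta>. mk_form X W n 0 \<beta> = \<beta>}"
      using form_class_mk_form by blast+
    then show "c = d" using inj_on_image_eq_iff[OF inj_on_pb] eq by blast
  qed
  have "(`) pbU ` form_class X n E W n 0 ` closed_forms_X = form_class Y n E' W' n 0 ` pbU ` closed_forms_X"
    unfolding image_image
    by (rule image_cong[OF refl]) (rule pb_form_class[OF W_sub W'_eq closed_forms_mk_form])
  then show "(`) pbU ` form_class X n E W n 0 ` closed_forms_X = form_class Y n E' W' n 0 ` closed_forms_Y"
    unfolding pb_closed_forms .
qed

lemma pb_class_mk_form:
  "pbU ` form_class X n E W n 0 (mk_form X W n 0 \<alpha>) =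
    form_class Y n E' W' n 0 (mk_form Y W' n 0 (\<lambda>y vs ws. \<alpha> (f y) (map (df y) vs) (map (df y) ws)))"
proof -
  have "mk_form X W n 0 (mk_form X W n 0 \<alpha>) = mk_form X W n 0 \<alpha>" by (simp add: mk_form_def fun_eq_iff)
  from pb_form_class[OF W_sub W'_eq this] show ?thesis unfolding pb_mk_form[OF W_sub W'_eq] .
qed

lemma mk_form_cong:
  "(\<And>y vs ws. form_args Y S p q y vs ws \<Longrightarrow> \<alpha> y vs ws = \<beta> y vs ws) \<Longrightarrow> mk_form Y S p q \<alpha> = mk_form Y S p q \<beta>"
  by (simp add: mk_form_def fun_eq_iff)

lemma W'_args: "form_args Y W' p q y vs ws \<Longrightarrow> y \<in> B"
  by (auto simp: form_args_def)

lemma pb_class_add: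
  "pbU ` form_class X n E W n 0 (mk_form X W n 0 (\<lambda>x vs ws. vb_add E x (\<alpha> x vs ws) (\<beta> x vs ws))) =
   form_class Y n E' W' n 0 (mk_form Y W' n 0 (\<lambda>y vs ws. vb_add E' y (pbU \<alpha> y vs ws) (pbU \<beta> y vs ws)))"
  unfolding pb_class_mk_form
  by (intro arg_cong[of _ _ "form_class Y n E' W' n 0"] mk_form_cong)
    (simp add: pb_apply[OF W_sub W'_eq] add[OF W'_args])

lemma pb_class_scale:
  "pbU ` form_class X n E W n 0 (mk_form X W n 0 (\<lambda>x vs ws. vb_scale E x (u x) (\<alpha> x vs ws))) =
   form_class Y n E' W' n 0 (mk_form Y W' n 0 (\<lambda>y vs ws. vb_scale E' y ((u \<circ> f) y) (pbU \<alpha> y vs ws)))"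
  unfolding pb_class_mk_form
  by (intro arg_cong[of _ _ "form_class Y n E' W' n 0"] mk_form_cong)
    (simp add: pb_apply[OF W_sub W'_eq] scale[OF W'_args])

end

lemma pb_class_restrict:
  assumes U: "openin (ctop X) U" and V: "openin (ctop X) V" "V \<subseteq> U"
  shows "pb (preim Y f V \<inter> B) n 0 ` form_class X n E (V \<inter> A) n 0 (mk_form X (V \<inter> A) n 0 \<alpha>) =
   form_class Y n E' (preim Y f V \<inter> B) n 0
     (mk_form Y (preim Y f V \<inter> B) n 0 (pb (preim Y f U \<inter> B) n 0 \<alpha>))"
  unfolding pb_class_mk_form[OF V(1)]
proof (intro arg_cong[of _ _ "form_class Y n E' (preim Y f V \<inter> B) n 0"] mk_form_cong[OF V(1)])
  fix y vs ws assume "form_args Y (preim Y f V \<inter> B) n 0 y vs ws"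
  then have "form_args Y (preim Y f U \<inter> B) n 0 y vs ws"
    using V(2) by (auto simp: form_args_def preim_def)
  then show "\<alpha> (f y) (map (df y) vs) (map (df y) ws) = pb (preim Y f U \<inter> B) n 0 \<alpha> y vs ws"
    by (simp add: pullback_form_def mk_form_def)
qed

theorem pullback_sections_iso:
  "module_sheaf_iso X (S_sheaf X n A kX E h) (direct_image Y f (S_sheaf Y n B kY E' h'))
     (pullback_sections Y X f A n)"
proof -
  have \<Phi>: "pullback_sections Y X f A n U = (`) (pb (preim Y f U \<inter> B) n 0)" for U
    by (rule ext) (simp add: pullback_sections_def B_eq)
  show ?thesis
    unfolding module_sheaf_iso_def \<Phi> direct_image_def S_sheaf_def module_sheaf.simps
  proof (intro allI impI conjI ballI, goal_cases)
    case (1 U) then show ?case by (rule pb_sections_bij)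
  next
    case (2 U s t) then show ?case
      by (simp only: image_UN pb_class_add UN_simps)
  next
    case (3 U u s) then show ?case
      by (simp only: image_UN pb_class_scale UN_simps)
  next
    case (4 U V s) then show ?case
      by (simp only: image_UN pb_class_restrict UN_simps)
  qed
qed

end

lemma open_biholomorphism_preim:
  assumes fsX: "function_sheaf X" and fsY: "function_sheaf Y" and A: "openin (ctop X) A"
    and cont: "continuous_map (ctop Y) (ctop X) f"
    and bih: "biholomorphic_map (open_subspace Y (preim Y f A)) (open_subspace X A) f"
  shows "\<exists>g. open_biholomorphism X Y A (preim Y f A) f g"
proof -
  let ?B = "preim Y f A"
  have B: "openin (ctop Y) ?B"
    unfolding preim_def by (rule openin_continuous_map_preimage[OF cont A])
  have tA: "topspace (subtopology (ctop X) A) = A" using openin_subset[OF A] by auto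
  have tB: "topspace (subtopology (ctop Y) ?B) = ?B" using openin_subset[OF B] by auto
  have tA': "topspace (ctop (open_subspace X A)) = A"
    and tB': "topspace (ctop (open_subspace Y ?B)) = ?B"
    using tA tB by (simp_all only: open_subspace_def cspace.simps)
  obtain g where f: "holomorphic_map (open_subspace Y ?B) (open_subspace X A) f"
    and g: "holomorphic_map (open_subspace X A) (open_subspace Y ?B) g"
    and gf: "\<And>y. y \<in> ?B \<Longrightarrow> g (f y) = y" and fg: "\<And>x. x \<in> A \<Longrightarrow> f (g x) = x"
    using bih unfolding biholomorphic_map_def tA' tB' by blast
  have pY: "preim (open_subspace Y ?B) f U = ?B \<inter> f -` U" for U
    unfolding preim_def[of "open_subspace Y ?B"] tB' by blast
  have pX: "preim (open_subspace X A) g V = A \<inter> g -` V" for V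
    unfolding preim_def[of "open_subspace X A"] tA' by blast
  have cg: "continuous_map (subtopology (ctop X) A) (subtopology (ctop Y) ?B) g"
    using g by (simp add: holomorphic_map_def open_subspace_def)
  have oX: "openin (subtopology (ctop X) A) U" if "openin (ctop X) U" "U \<subseteq> A" for U
    using that A by (simp add: openin_open_subtopology)
  have oY: "openin (subtopology (ctop Y) ?B) V" if "openin (ctop Y) V" "V \<subseteq> ?B" for V
    using that B by (simp add: openin_open_subtopology)
  have "open_biholomorphism X Y A ?B f g"
  proof
    show "function_sheaf X" "function_sheaf Y" "openin (ctop X) A" "openin (ctop Y) ?B"
      by (rule fsX fsY A B)+
    show "f y \<in> A" if "y \<in> ?B" for y using that by (simp add: preim_def)
    show "g x \<in> ?B" if "x \<in> A" for x
      using continuous_map_image_subset_topspace[OF cg] that unfolding tA tB by blast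
    show "g (f y) = y" if "y \<in> ?B" for y by (rule gf[OF that])
    show "f (g x) = x" if "x \<in> A" for x by (rule fg[OF that])
    show "openin (ctop Y) (?B \<inter> f -` U)" if "openin (ctop X) U" "U \<subseteq> A" for U
    proof -
      have "openin (ctop Y) (?B \<inter> {y \<in> topspace (ctop Y). f y \<in> U})"
        using B openin_continuous_map_preimage[OF cont that(1)] by blast
      moreover have "?B \<inter> {y \<in> topspace (ctop Y). f y \<in> U} = ?B \<inter> f -` U"
        using openin_subset[OF B] by blast
      ultimately show ?thesis by simp
    qed
    show "openin (ctop X) (A \<inter> g -` V)" if "openin (ctop Y) V" "V \<subseteq> ?B" for V
    proof -
      have "openin (subtopology (ctop X) A) {x \<in> A. g x \<in> V}"
        using openin_continuous_map_preimage[OF cg oY[OF that]] unfolding tA .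
      moreover have "{x \<in> A. g x \<in> V} = A \<inter> g -` V" by blast
      ultimately show ?thesis using A openin_trans_full by metis
    qed
    show "hol Y (?B \<inter> f -` U) (u \<circ> f)" if "openin (ctop X) U" "U \<subseteq> A" "hol X U u" for U u
      using f oX[OF that(1,2)] that(3) unfolding holomorphic_map_def pY by (simp add: open_subspace_def)
    show "hol X (A \<inter> g -` V) (v \<circ> g)" if "openin (ctop Y) V" "V \<subseteq> ?B" "hol Y V v" for V v
      using g oY[OF that(1,2)] that(3) unfolding holomorphic_map_def pX by (simp add: open_subspace_def)
  qed
  then show ?thesis by blast
qed

lemma bundle_biholomorphism_pullback:
  assumes b: "open_biholomorphism X Y A (preim Y f A) f g" and A: "A \<subseteq> regular_points X"
    and E: "holomorphic_vector_bundle X A E"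
  shows "bundle_biholomorphism X Y A (preim Y f A) f g E (pullback_bundle Y f E)"
proof -
  interpret open_biholomorphism X Y A "preim Y f A" f g by (rule b)
  show ?thesis
  proof unfold_locales
    fix T \<tau> assume "(T, \<tau>) \<in> vb_trivs (pullback_bundle Y f E)"
    then obtain S \<sigma> where S: "(S, \<sigma>) \<in> vb_trivs E" "T = preim Y f S" "\<tau> = \<sigma> \<circ> f"
      by (auto simp: pullback_bundle_def)
    moreover have "S \<subseteq> A" by (rule holomorphic_vector_bundle_triv(2)[OF E S(1)])
    ultimately show "\<exists>S \<sigma>. (S, \<sigma>) \<in> vb_trivs E \<and> S \<subseteq> A \<and> T = preim Y f A \<inter> f -` S \<and> (\<forall>y\<in>T. \<tau> y = \<sigma> (f y))"
      by (intro exI[of _ S] exI[of _ \<sigma>]) (auto simp: preim_def)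
  next
    fix S \<sigma> assume S: "(S, \<sigma>) \<in> vb_trivs E"
    have SA: "S \<subseteq> A" by (rule holomorphic_vector_bundle_triv(2)[OF E S])
    show "\<exists>T \<tau>. (T, \<tau>) \<in> vb_trivs (pullback_bundle Y f E) \<and> T \<subseteq> preim Y f A \<and> S = A \<inter> g -` T \<and> (\<forall>x\<in>S. \<sigma> x = \<tau> (g x))"
    proof (intro exI[of _ "preim Y f S"] exI[of _ "\<sigma> \<circ> f"] conjI ballI)
      show "(preim Y f S, \<sigma> \<circ> f) \<in> vb_trivs (pullback_bundle Y f E)"
        using S by (force simp: pullback_bundle_def)
      show "preim Y f S \<subseteq> preim Y f A" using SA by (auto simp: preim_def)
      show "S = A \<inter> g -` preim Y f S"
      proof (intro equalityI subsetI)
        fix x assume x: "x \<in> S"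
        then have "x \<in> A" using SA by blast
        then show "x \<in> A \<inter> g -` preim Y f S"
          using x f_g[of x] g_in[of x] by (simp add: preim_def)
      next
        fix x assume "x \<in> A \<inter> g -` preim Y f S"
        then show "x \<in> S" using f_g[of x] by (simp add: preim_def)
      qed
      show "\<sigma> x = (\<sigma> \<circ> f) (g x)" if "x \<in> S" for x using f_g[of x] SA that by auto
    qed
  next
    show "\<exists>t. linear_fibre E x t" if "x \<in> A" for x by (rule holomorphic_vector_bundle_fibre[OF E that])
  qed (use A in \<open>simp_all add: pullback_bundle_def\<close>)
qed

theorem proposition4p3:
  fixes X :: "'a cspace" and X' :: "'b cspace" and \<pi> :: "'b \<Rightarrow> 'a"
    and E :: "('a, 'e) vbundle" and h :: "'a \<Rightarrow> 'e \<Rightarrow> ennreal"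
    and g :: "'a \<Rightarrow> 'a tangent \<Rightarrow> 'a tangent \<Rightarrow> complex"
    and g' :: "'b \<Rightarrow> 'b tangent \<Rightarrow> 'b tangent \<Rightarrow> complex"
  assumes "complex_space X" and "has_dimension X n"
    and "zariski_open X Xo" and "Xo \<subseteq> regular_points X"
    and "holomorphic_vector_bundle X Xo E" and "singular_hermitian_metric X n Xo E h"
    and "complex_space X'" and "has_dimension X' n'"
    and "holomorphic_map X' X \<pi>" and "proper_map (ctop X') (ctop X) \<pi>"
    and "biholomorphic_map (open_subspace X' (preim X' \<pi> Xo)) (open_subspace X Xo) \<pi>"
    and "hermitian_metric X n Xo g" and "hermitian_metric X' n' (preim X' \<pi> Xo) g'"
  shows "module_sheaf_iso X
           (S_sheaf X n Xo g E h)
           (direct_image X' \<pi>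
              (S_sheaf X' n' (preim X' \<pi> Xo) g' (pullback_bundle X' \<pi> E) (h \<circ> \<pi>)))
           (pullback_sections X' X \<pi> Xo n)"
proof -
  let ?B = "preim X' \<pi> Xo" and ?E' = "pullback_bundle X' \<pi> E"
  have fsX: "function_sheaf X" and fsY: "function_sheaf X'"
    using assms(1,7) by (simp_all add: complex_space_def)
  have cont: "continuous_map (ctop X') (ctop X) \<pi>" using assms(9) by (simp add: holomorphic_map_def)
  have A: "openin (ctop X) Xo" by (rule holomorphic_vector_bundle_base_open[OF assms(5)])
  obtain \<rho> where b: "open_biholomorphism X X' Xo ?B \<pi> \<rho>"
    using open_biholomorphism_preim[OF fsX fsY A cont assms(11)] by blast
  interpret bundle_biholomorphism X X' Xo ?B \<pi> \<rho> E ?E'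
    by (rule bundle_biholomorphism_pullback[OF b assms(4,5)])
  have hg': "hermitian_form_on (tangent_space X' y) (g' y)" if "y \<in> ?B" for y
    by (rule hermitian_metric_at[OF assms(13) that])
  interpret proper_modification X X' Xo ?B \<pi> \<rho> E ?E' n g g' h "h \<circ> \<pi>"
  proof
    show "hermitian_form_on (tangent_space X x) (g x)" if "x \<in> Xo" for x
      by (rule hermitian_metric_at[OF assms(12) that])
    show "homogeneous_norm E h x" if "x \<in> Xo" for x
      by (rule singular_hermitian_metric_homogeneous[OF assms(5,6) that])
    show "measurable_form X n E W p q (mk_form X W p q (\<lambda>x vs ws. vb_zero E x))" if "W \<subseteq> Xo" for W p q
      by (rule measurable_zero_form[OF assms(5) fsX that])
  qed (use cont assms(10) hg' in simp_all)
  have "S_sheaf X' n' ?B g' ?E' (h \<circ> \<pi>) = S_sheaf X' n ?B g' ?E' (h \<circ> \<pi>)"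
  proof (cases "Xo = {}")
    case True
    \<comment> \<open>An empty \<open>Xo\<close> does not tie the two dimensions together.\<close>
    then have "?B = {}" by (simp add: preim_def)
    then show ?thesis using S_sheaf_empty by metis
  next
    case False
    then obtain x m V z where x: "x \<in> Xo" and ch: "chart X m V z" "x \<in> V"
      using assms(4) unfolding regular_points_def by blast
    interpret rev: open_biholomorphism X' X ?B Xo \<rho> \<pi> by (rule reverse)
    have "m = n" using assms(2) ch unfolding has_dimension_def by blast
    have "chart X m (V \<inter> Xo) z"
      by (rule chart_restrict[OF ch(1)]) (use chart_open[OF ch(1)] A in auto)
    from rev.chart_pushforward[OF this] have "chart X' m (?B \<inter> \<pi> -` (V \<inter> Xo)) (z \<circ> \<pi>)" by simp
    moreover have "\<rho> x \<in> ?B \<inter> \<pi> -` (V \<inter> Xo)" using g_in[OF x] f_g[OF x] x ch by simp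
    ultimately have "m = n'" using assms(8) unfolding has_dimension_def by blast
    then show ?thesis using \<open>m = n\<close> by simp
  qed
  then show ?thesis using pullback_sections_iso by simp
qed

end
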